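(* Let $(\bar y,\bar p,\bar u)\in H_0^1(\Omega)\times H_0^1(\Omega)\times\mathbb{U}_{ad}$ be the solution to the continuous optimality system and, for a mesh $\mathscr{T}\in\mathbb{T}$, let $(\bar y_{\mathscr{T}},\bar p_{\mathscr{T}},\bar u_{\mathscr{T}})\in\mathbb{V}(\mathscr{T})\times\mathbb{V}(\mathscr{T})\times\mathbb{U}_{ad,0}(\mathscr{T})$ be the solution to the discrete optimality system with piecewise constant controls. Then, for every $K\in\mathscr{T}$, $$\mathcal{E}_{y,K}\lesssim|\bar y-\bar y_{\mathscr{T}}|_{H^1(\Omega_K)}+h_K\|\bar u-\bar u_{\mathscr{T}}\|_{L^2(\Omega_K)}+\mathrm{osc}_{\mathscr{T},0}(f;\Omega_K)$$ and $$\mathcal{E}_{p,K}\lesssim|\bar p-\bar p_{\mathscr{T}}|_{H^1(\Omega_K)}+h_K\|\bar y-\bar y_{\mathscr{T}}\|_{L^2(\Omega_K)}+\mathrm{osc}_{\mathscr{T},0}(y_\Omega;\Omega_K),$$ where the hidden constants are independent of the optimal variables, their approximations, the size of the elements in the mesh $\mathscr{T}$, and $\#\mathscr{T}$.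
   Context: $A\lesssim B$ means $A\le CB$ with a constant $C$ (with the independence stated in the claim). Data. $d\in\{2,3\}$; $\Omega\subset\mathbb{R}^d$ is an open bounded polytopal domain with Lipschitz boundary; $f,y_\Omega\in L^2(\Omega)$; $\alpha>0$, $\beta>0$; $a,b\in\mathbb{R}$ with $a<0<b$; $\mathbb{U}_{ad}=\{v\in L^2(\Omega): a\le v(x)\le b \text{ for a.e. } x\in\Omega\}$. Continuous optimality system. With $\psi(u)=\|u\|_{L^1(\Omega)}$ and $\partial\psi$ its convex subdifferential, find $(\bar y,\bar p,\bar u)\in H_0^1(\Omega)\times H_0^1(\Omega)\times\mathbb{U}_{ad}$ and $\bar\lambda\in\partial\psi(\bar u)$ such that $(\nabla\bar y,\nabla v)_{L^2(\Omega)}=(\bar u+f,v)_{L^2(\Omega)}$ for all $v\in H_0^1(\Omega)$; $(\nabla w,\nabla\bar p)_{L^2(\Omega)}=(\bar y-y_\Omega,w)_{L^2(\Omega)}$ for all $w\in H_0^1(\Omega)$; $(\bar p+\alpha\bar u+\beta\bar\lambda,u-\bar u)_{L^2(\Omega)}\ge0$ for all $u\in\mathbb{U}_{ad}$. The solution is unique. Meshes. $\mathbb{T}$ is a collection of conforming, (uniformly) shape regular simplicial meshes $\mathscr{T}=\{K\}$ of $\bar\Omega$ that are refinements of an initial mesh $\mathscr{T}_0$; $h_K=\mathrm{diam}(K)$. $\mathbb{V}(\mathscr{T})$ is the space of continuous functions on $\bar\Omega$ that are affine on each $K\in\mathscr{T}$ and vanish on $\partial\Omega$. $\mathscr{S}$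 is the set of internal $(d-1)$-dimensional interelement sides of $\mathscr{T}$, $\mathscr{S}_K\subset\mathscr{S}$ the set of those that are sides of $K$, and $\Omega_K=\bigcup\{K'\in\mathscr{T}:\mathscr{S}_K\cap\mathscr{S}_{K'}\ne\emptyset\}$ (also regarded as the corresponding subset of $\mathscr{T}$). Discrete system (piecewise constant controls). $\mathbb{U}_0(\mathscr{T})=\{u_{\mathscr{T}}\in L^2(\Omega): u_{\mathscr{T}}|_K\in\mathbb{P}_0(K)\ \forall K\in\mathscr{T}\}$, $\mathbb{U}_{ad,0}(\mathscr{T})=\mathbb{U}_0(\mathscr{T})\cap\mathbb{U}_{ad}$. Find $(\bar y_{\mathscr{T}},\bar p_{\mathscr{T}},\bar u_{\mathscr{T}})\in\mathbb{V}(\mathscr{T})\times\mathbb{V}(\mathscr{T})\times\mathbb{U}_{ad,0}(\mathscr{T})$ and $\bar\lambda_{\mathscr{T}}\in\partial\psi(\bar u_{\mathscr{T}})$ (subdifferential of $\psi(u_{\mathscr{T}})=\int_\Omega|u_{\mathscr{T}}|\,dx$ on $\mathbb{U}_0(\mathscr{T})$, with $\bar\lambda_{\mathscr{T}}$ identified with an element of $\mathbb{U}_0(\mathscr{T})$ by the $L^2(\Omega)$ inner product) such that $(\nabla\bar y_{\mathscr{T}},\nabla v_{\mathscr{T}})_{L^2(\Omega)}=(\bar u_{\mathscr{T}}+f,v_{\mathscr{T}})_{L^2(\Omega)}$ and $(\nabla w_{\mathscr{T}},\nabla\bar p_{\mathscr{T}})_{L^2(\Omega)}=(\bar y_{\mathscr{T}}-y_\Omega,w_{\mathscr{T}})_{L^2(\Omega)}$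 for all $v_{\mathscr{T}},w_{\mathscr{T}}\in\mathbb{V}(\mathscr{T})$, and $(\bar p_{\mathscr{T}}+\alpha\bar u_{\mathscr{T}}+\beta\bar\lambda_{\mathscr{T}},u_{\mathscr{T}}-\bar u_{\mathscr{T}})_{L^2(\Omega)}\ge0$ for all $u_{\mathscr{T}}\in\mathbb{U}_{ad,0}(\mathscr{T})$. Indicators. For $\gamma\in\mathscr{S}$ shared by $K^+\ne K^-$ and $z_{\mathscr{T}}\in\mathbb{V}(\mathscr{T})$, $[\![\nabla z_{\mathscr{T}}\cdot\nu]\!]_\gamma=\nu^+\cdot\nabla z_{\mathscr{T}}|_{K^+}+\nu^-\cdot\nabla z_{\mathscr{T}}|_{K^-}$, where $\nu^\pm$ is the unit normal to $\gamma$ pointing outward of $K^\pm$. Set $\mathcal{E}_{y,K}^2=h_K^2\|\bar u_{\mathscr{T}}+f\|_{L^2(K)}^2+h_K\|[\![\nabla\bar y_{\mathscr{T}}\cdot\nu]\!]_\gamma\|_{L^2(\partial K\setminus\partial\Omega)}^2$, $\mathcal{E}_{p,K}^2=h_K^2\|\bar y_{\mathscr{T}}-y_\Omega\|_{L^2(K)}^2+h_K\|[\![\nabla\bar p_{\mathscr{T}}\cdot\nu]\!]_\gamma\|_{L^2(\partial K\setminus\partial\Omega)}^2$. Oscillation. For $\ell\in\{0,1\}$ (either choice), $\Pi_K^\ell$ is the $L^2(K)$-orthogonal projection onto $\mathbb{P}_\ell(K)$; for $\kappa\in\{0,1\}$, $g\in L^2(\Omega)$ and $\mathscr{M}\subset\mathscr{T}$,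 $\mathrm{osc}_{\mathscr{T},\kappa}(g;\mathscr{M})=\big(\sum_{K\in\mathscr{M}}h_K^{2(\kappa+1)}\|g-\Pi_K^\ell(g)\|_{L^2(K)}^2\big)^{1/2}$.
   Formalization: The patch Ω_K is taken to contain K always; this differs from the stated definition only when the mesh is the single element K, where Ω_K would be empty and the first bound fails (e.g. f = 1, y_Ω = 0). *)

theory Defs
  imports "HOL-Analysis.Analysis"
begin

section \<open>Lebesgue and Sobolev spaces\<close>

text \<open>
  Elements of \<open>L\<^sup>2\<close> are represented by functions, not by equivalence classes, and only their values
  almost everywhere on the set in question matter.  Since \<^const>\<open>lebesgue\<close> is complete, a function
  that is measurable on \<open>\<Omega>\<close> is also measurable on the closed elements of a mesh, which meet the
  complement of \<open>\<Omega>\<close> in null sets.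
\<close>

definition L2 :: "'a::euclidean_space set \<Rightarrow> ('a \<Rightarrow> 'b::euclidean_space) set" where
  "L2 S = {g \<in> borel_measurable (lebesgue_on S). integrable (lebesgue_on S) (\<lambda>x. (norm (g x))\<^sup>2)}"

definition L2_inner ::
  "'a::euclidean_space set \<Rightarrow> ('a \<Rightarrow> 'b::euclidean_space) \<Rightarrow> ('a \<Rightarrow> 'b) \<Rightarrow> real" where
  "L2_inner S g h = (LINT x|lebesgue_on S. g x \<bullet> h x)"

definition L2_norm :: "'a::euclidean_space set \<Rightarrow> ('a \<Rightarrow> 'b::euclidean_space) \<Rightarrow> real" where
  "L2_norm S g = sqrt (LINT x|lebesgue_on S. (norm (g x))\<^sup>2)"

definition L1_norm :: "'a::euclidean_space set \<Rightarrow> ('a \<Rightarrow> real) \<Rightarrow> real" where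
  "L1_norm S g = (LINT x|lebesgue_on S. \<bar>g x\<bar>)"

primrec times_cont_diff :: "nat \<Rightarrow> ('a::euclidean_space \<Rightarrow> real) \<Rightarrow> bool" where
  "times_cont_diff 0 \<phi> \<longleftrightarrow> continuous_on UNIV \<phi>"
| "times_cont_diff (Suc k) \<phi> \<longleftrightarrow>
     (\<forall>x. \<phi> differentiable (at x)) \<and>
     (\<forall>v. times_cont_diff k (\<lambda>x. frechet_derivative \<phi> (at x) v))"

definition test_functions :: "'a::euclidean_space set \<Rightarrow> ('a \<Rightarrow> real) set" where
  "test_functions \<Omega> =
     {\<phi>. (\<forall>k. times_cont_diff k \<phi>) \<and> (\<exists>K. compact K \<and> K \<subseteq> \<Omega> \<and> (\<forall>x. x \<notin> K \<longrightarrow> \<phi> x = 0))}"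

definition is_weak_gradient ::
  "'a::euclidean_space set \<Rightarrow> ('a \<Rightarrow> real) \<Rightarrow> ('a \<Rightarrow> 'a) \<Rightarrow> bool" where
  "is_weak_gradient \<Omega> g G \<longleftrightarrow>
     (\<forall>\<phi>\<in>test_functions \<Omega>. \<forall>i\<in>Basis.
        (LINT x|lebesgue_on \<Omega>. g x * frechet_derivative \<phi> (at x) i)
          = - (LINT x|lebesgue_on \<Omega>. (G x \<bullet> i) * \<phi> x))"

definition H1 :: "'a::euclidean_space set \<Rightarrow> ('a \<Rightarrow> real) set" where
  "H1 \<Omega> = {g \<in> L2 \<Omega>. \<exists>G\<in>L2 \<Omega>. is_weak_gradient \<Omega> g G}"

text \<open>For \<open>g \<in> H1 \<Omega>\<close> the weak gradient is unique up to a null set of \<open>\<Omega>\<close>.\<close>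

definition wgrad :: "'a::euclidean_space set \<Rightarrow> ('a \<Rightarrow> real) \<Rightarrow> 'a \<Rightarrow> 'a" where
  "wgrad \<Omega> g = (SOME G. G \<in> L2 \<Omega> \<and> is_weak_gradient \<Omega> g G)"

definition H1_norm :: "'a::euclidean_space set \<Rightarrow> ('a \<Rightarrow> real) \<Rightarrow> real" where
  "H1_norm \<Omega> g = sqrt ((L2_norm \<Omega> g)\<^sup>2 + (L2_norm \<Omega> (wgrad \<Omega> g))\<^sup>2)"

definition H1_0 :: "'a::euclidean_space set \<Rightarrow> ('a \<Rightarrow> real) set" where
  "H1_0 \<Omega> =
     {g \<in> H1 \<Omega>. \<exists>\<phi>. (\<forall>n. \<phi> n \<in> test_functions \<Omega>) \<and>
                     (\<lambda>n. H1_norm \<Omega> (\<lambda>x. g x - \<phi> n x)) \<longlonglongrightarrow> 0}"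

text \<open>The seminorm \<open>|g|\<close> of \<open>H\<^sup>1(S)\<close>, for \<open>g \<in> H1 \<Omega>\<close> and \<open>S\<close> contained in the closure of \<open>\<Omega>\<close>.\<close>

definition H1_seminorm ::
  "'a::euclidean_space set \<Rightarrow> 'a set \<Rightarrow> ('a \<Rightarrow> real) \<Rightarrow> real" where
  "H1_seminorm \<Omega> S g = L2_norm S (wgrad \<Omega> g)"


section \<open>Domains and meshes\<close>

text \<open>
  Near each boundary point, \<open>\<Omega>\<close> is the strict epigraph of a Lipschitz function over the hyperplane
  orthogonal to some unit vector \<open>e\<close>.
\<close>

definition lipschitz_boundary :: "'a::euclidean_space set \<Rightarrow> bool" where
  "lipschitz_boundary \<Omega> \<longleftrightarrow>
     (\<forall>p\<in>frontier \<Omega>. \<exists>r>0. \<exists>e \<phi> L. norm e = 1 \<and> L-lipschitz_on {z. z \<bullet> e = 0} \<phi> \<and>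
        \<Omega> \<inter> ball p r = {x \<in> ball p r. \<phi> (x - (x \<bullet> e) *\<^sub>R e) < x \<bullet> e})"

definition lipschitz_polytopal_domain :: "'a::euclidean_space set \<Rightarrow> bool" where
  "lipschitz_polytopal_domain \<Omega> \<longleftrightarrow>
     open \<Omega> \<and> connected \<Omega> \<and> \<Omega> \<noteq> {} \<and> bounded \<Omega> \<and>
     (\<exists>\<P>. finite \<P> \<and> (\<forall>P\<in>\<P>. polytope P) \<and> closure \<Omega> = \<Union>\<P>) \<and>
     lipschitz_boundary \<Omega>"

definition simplicial_mesh :: "'a::euclidean_space set \<Rightarrow> 'a set set \<Rightarrow> bool" where
  "simplicial_mesh \<Omega> T \<longleftrightarrow>
     triangulation T \<and> (\<forall>K\<in>T. int DIM('a) simplex K) \<and> \<Union>T = closure \<Omega>"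

definition refines :: "'a set set \<Rightarrow> 'a set set \<Rightarrow> bool" where
  "refines T T0 \<longleftrightarrow> (\<forall>K\<in>T. \<exists>K0\<in>T0. K \<subseteq> K0)"

definition inball_diameter :: "'a::euclidean_space set \<Rightarrow> real" where
  "inball_diameter K = Sup {2 * r |r. 0 \<le> r \<and> (\<exists>x. cball x r \<subseteq> K)}"

definition shape_regular :: "'a::euclidean_space set set set \<Rightarrow> bool" where
  "shape_regular \<TT> \<longleftrightarrow> (\<exists>\<sigma>>0. \<forall>T\<in>\<TT>. \<forall>K\<in>T. diameter K \<le> \<sigma> * inball_diameter K)"

definition mesh_family ::
  "'a::euclidean_space set \<Rightarrow> 'a set set \<Rightarrow> 'a set set set \<Rightarrow> bool" where
  "mesh_family \<Omega> T0 \<TT> \<longleftrightarrow>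
     simplicial_mesh \<Omega> T0 \<and> (\<forall>T\<in>\<TT>. simplicial_mesh \<Omega> T \<and> refines T T0) \<and> shape_regular \<TT>"

definition internal_sides :: "'a::euclidean_space set set \<Rightarrow> 'a set set" where
  "internal_sides T = {\<gamma>. \<exists>K\<in>T. \<exists>K'\<in>T. K \<noteq> K' \<and> \<gamma> facet_of K \<and> \<gamma> facet_of K'}"

definition sides_of :: "'a::euclidean_space set set \<Rightarrow> 'a set \<Rightarrow> 'a set set" where
  "sides_of T K = {\<gamma> \<in> internal_sides T. \<gamma> facet_of K}"

text \<open>
  The patch as a set of elements; its union is the corresponding subset of the domain.  The element
  \<open>K\<close> shares a side with itself as soon as it has an internal side, so that \<open>insert K\<close> only has an
  effect if \<open>K\<close> is the whole mesh.
\<close>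

definition patch :: "'a::euclidean_space set set \<Rightarrow> 'a set \<Rightarrow> 'a set set" where
  "patch T K = insert K {K' \<in> T. sides_of T K \<inter> sides_of T K' \<noteq> {}}"


section \<open>Discrete spaces\<close>

text \<open>Polynomials of degree at most \<open>l\<close>; only meant for \<open>l \<in> {0, 1}\<close>.\<close>

definition polys :: "nat \<Rightarrow> ('a::euclidean_space \<Rightarrow> real) set" where
  "polys l = {q. \<exists>c g. (l = 0 \<longrightarrow> g = 0) \<and> q = (\<lambda>x. c + g \<bullet> x)}"

definition fe_space :: "'a::euclidean_space set \<Rightarrow> 'a set set \<Rightarrow> ('a \<Rightarrow> real) set" where
  "fe_space \<Omega> T =
     {z. continuous_on (closure \<Omega>) z \<and> (\<forall>K\<in>T. \<exists>q\<in>polys 1. \<forall>x\<in>K. z x = q x) \<and>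
         (\<forall>x\<in>frontier \<Omega>. z x = 0)}"

text \<open>
  The elements are closed and overlap in their sides, so piecewise constant functions have to be
  required to be constant on each element only almost everywhere.
\<close>

definition pw_const :: "'a::euclidean_space set \<Rightarrow> 'a set set \<Rightarrow> ('a \<Rightarrow> real) set" where
  "pw_const \<Omega> T = {u \<in> L2 \<Omega>. \<forall>K\<in>T. \<exists>q\<in>polys 0. AE x in lebesgue_on K. u x = q x}"


section \<open>The optimality systems\<close>

definition U_ad :: "'a::euclidean_space set \<Rightarrow> real \<Rightarrow> real \<Rightarrow> ('a \<Rightarrow> real) set" where
  "U_ad \<Omega> a b = {v \<in> L2 \<Omega>. AE x in lebesgue_on \<Omega>. a \<le> v x \<and> v x \<le> b}"

text \<open>
  The convex subdifferential at \<open>u\<close> of the \<open>L\<^sup>1(\<Omega>)\<close> norm as a functional on the subspace \<open>U\<close> of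
  \<open>L\<^sup>2(\<Omega>)\<close>, the dual of \<open>U\<close> being identified with \<open>U\<close> by the \<open>L\<^sup>2(\<Omega>)\<close> inner product.
\<close>

definition subdiff_L1 ::
  "'a::euclidean_space set \<Rightarrow> ('a \<Rightarrow> real) set \<Rightarrow> ('a \<Rightarrow> real) \<Rightarrow> ('a \<Rightarrow> real) set" where
  "subdiff_L1 \<Omega> U u =
     {lam \<in> U. \<forall>v\<in>U. L1_norm \<Omega> u + L2_inner \<Omega> lam (\<lambda>x. v x - u x) \<le> L1_norm \<Omega> v}"

text \<open>
  The state and adjoint equations are posed in the space \<open>V\<close>, the controls are taken from \<open>U\<close>.
  Finite element functions are weakly differentiable, and their weak gradients are their elementwise
  gradients.
\<close>

definition optimality_system ::
  "'a::euclidean_space set \<Rightarrow> ('a \<Rightarrow> real) set \<Rightarrow> ('a \<Rightarrow> real) set \<Rightarrow>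
   ('a \<Rightarrow> real) \<Rightarrow> ('a \<Rightarrow> real) \<Rightarrow> real \<Rightarrow> real \<Rightarrow> real \<Rightarrow> real \<Rightarrow>
   ('a \<Rightarrow> real) \<Rightarrow> ('a \<Rightarrow> real) \<Rightarrow> ('a \<Rightarrow> real) \<Rightarrow> ('a \<Rightarrow> real) \<Rightarrow> bool" where
  "optimality_system \<Omega> V U f y\<^sub>\<Omega> \<alpha> \<beta> a b y p u lam \<longleftrightarrow>
     y \<in> V \<and> p \<in> V \<and> u \<in> U \<inter> U_ad \<Omega> a b \<and> lam \<in> subdiff_L1 \<Omega> U u \<and>
     (\<forall>v\<in>V. L2_inner \<Omega> (wgrad \<Omega> y) (wgrad \<Omega> v) = L2_inner \<Omega> (\<lambda>x. u x + f x) v) \<and>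
     (\<forall>w\<in>V. L2_inner \<Omega> (wgrad \<Omega> w) (wgrad \<Omega> p) = L2_inner \<Omega> (\<lambda>x. y x - y\<^sub>\<Omega> x) w) \<and>
     (\<forall>w\<in>U \<inter> U_ad \<Omega> a b.
        0 \<le> L2_inner \<Omega> (\<lambda>x. p x + \<alpha> * u x + \<beta> * lam x) (\<lambda>x. w x - u x))"

definition continuous_system ::
  "'a::euclidean_space set \<Rightarrow> ('a \<Rightarrow> real) \<Rightarrow> ('a \<Rightarrow> real) \<Rightarrow> real \<Rightarrow> real \<Rightarrow> real \<Rightarrow> real \<Rightarrow>
   ('a \<Rightarrow> real) \<Rightarrow> ('a \<Rightarrow> real) \<Rightarrow> ('a \<Rightarrow> real) \<Rightarrow> ('a \<Rightarrow> real) \<Rightarrow> bool" where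
  "continuous_system \<Omega> = optimality_system \<Omega> (H1_0 \<Omega>) (L2 \<Omega>)"

definition discrete_system ::
  "'a::euclidean_space set \<Rightarrow> 'a set set \<Rightarrow>
   ('a \<Rightarrow> real) \<Rightarrow> ('a \<Rightarrow> real) \<Rightarrow> real \<Rightarrow> real \<Rightarrow> real \<Rightarrow> real \<Rightarrow>
   ('a \<Rightarrow> real) \<Rightarrow> ('a \<Rightarrow> real) \<Rightarrow> ('a \<Rightarrow> real) \<Rightarrow> ('a \<Rightarrow> real) \<Rightarrow> bool" where
  "discrete_system \<Omega> T = optimality_system \<Omega> (fe_space \<Omega> T) (pw_const \<Omega> T)"


section \<open>Error indicators and oscillation\<close>

definition outer_normal :: "'a::euclidean_space set \<Rightarrow> 'a set \<Rightarrow> 'a" where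
  "outer_normal K \<gamma> =
     (THE \<nu>. norm \<nu> = 1 \<and> (\<exists>c. (\<forall>x\<in>\<gamma>. \<nu> \<bullet> x = c) \<and> (\<forall>x\<in>K. \<nu> \<bullet> x \<le> c)))"

definition elem_grad :: "('a::euclidean_space \<Rightarrow> real) \<Rightarrow> 'a set \<Rightarrow> 'a" where
  "elem_grad z K = (THE g. \<exists>c. \<forall>x\<in>K. z x = c + g \<bullet> x)"

text \<open>For an internal side \<open>\<gamma>\<close> the sum has two terms, one for each of the elements sharing \<open>\<gamma>\<close>.\<close>

definition jump :: "'a::euclidean_space set set \<Rightarrow> ('a \<Rightarrow> real) \<Rightarrow> 'a set \<Rightarrow> real" where
  "jump T z \<gamma> = (\<Sum>K | K \<in> T \<and> \<gamma> facet_of K. outer_normal K \<gamma> \<bullet> elem_grad z K)"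

text \<open>
  For a unit vector \<open>\<nu>\<close>, the \<open>(d-1)\<close>-dimensional Lebesgue measure on the hyperplane \<open>\<nu> \<bullet> x = c\<close>: the
  measure of a subset is the \<open>d\<close>-dimensional measure of the right prism of height \<open>1\<close> over it.
\<close>

definition hyperplane_measure :: "'a::euclidean_space \<Rightarrow> real \<Rightarrow> 'a measure" where
  "hyperplane_measure \<nu> c =
     distr (restrict_space lborel {x. c \<le> \<nu> \<bullet> x \<and> \<nu> \<bullet> x \<le> c + 1}) borel
           (\<lambda>x. x - (\<nu> \<bullet> x - c) *\<^sub>R \<nu>)"

definition side_integral ::
  "'a::euclidean_space \<Rightarrow> 'a set \<Rightarrow> ('a \<Rightarrow> real) \<Rightarrow> real" where
  "side_integral \<nu> \<gamma> g =
     (LINT x:\<gamma>|hyperplane_measure \<nu> (THE c. \<forall>x\<in>\<gamma>. \<nu> \<bullet> x = c). g x)"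

text \<open>
  The norm of the normal jumps in \<open>L\<^sup>2(\<partial>K \<setminus> \<partial>\<Omega>)\<close>: up to a set of surface measure zero,
  \<open>\<partial>K \<setminus> \<partial>\<Omega>\<close> is the union of the internal sides of \<open>K\<close>, and the jump is constant on each of them.
\<close>

definition jump_norm :: "'a::euclidean_space set set \<Rightarrow> 'a set \<Rightarrow> ('a \<Rightarrow> real) \<Rightarrow> real" where
  "jump_norm T K z =
     sqrt (\<Sum>\<gamma>\<in>sides_of T K. side_integral (outer_normal K \<gamma>) \<gamma> (\<lambda>_. (jump T z \<gamma>)\<^sup>2))"

definition indicator_y ::
  "'a::euclidean_space set set \<Rightarrow> ('a \<Rightarrow> real) \<Rightarrow> ('a \<Rightarrow> real) \<Rightarrow> ('a \<Rightarrow> real) \<Rightarrow> 'a set \<Rightarrow> real"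
  where
  "indicator_y T f u\<^sub>T y\<^sub>T K =
     sqrt ((diameter K)\<^sup>2 * (L2_norm K (\<lambda>x. u\<^sub>T x + f x))\<^sup>2 + diameter K * (jump_norm T K y\<^sub>T)\<^sup>2)"

definition indicator_p ::
  "'a::euclidean_space set set \<Rightarrow> ('a \<Rightarrow> real) \<Rightarrow> ('a \<Rightarrow> real) \<Rightarrow> ('a \<Rightarrow> real) \<Rightarrow> 'a set \<Rightarrow> real"
  where
  "indicator_p T y\<^sub>\<Omega> y\<^sub>T p\<^sub>T K =
     sqrt ((diameter K)\<^sup>2 * (L2_norm K (\<lambda>x. y\<^sub>T x - y\<^sub>\<Omega> x))\<^sup>2 + diameter K * (jump_norm T K p\<^sub>T)\<^sup>2)"

definition L2_proj ::
  "nat \<Rightarrow> 'a::euclidean_space set \<Rightarrow> ('a \<Rightarrow> real) \<Rightarrow> 'a \<Rightarrow> real" where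
  "L2_proj l K g =
     (THE q. q \<in> polys l \<and> (\<forall>r\<in>polys l. L2_inner K (\<lambda>x. g x - q x) r = 0))"

definition osc ::
  "nat \<Rightarrow> nat \<Rightarrow> ('a::euclidean_space \<Rightarrow> real) \<Rightarrow> 'a set set \<Rightarrow> real" where
  "osc l \<kappa> g M =
     sqrt (\<Sum>K\<in>M. diameter K ^ (2 * (\<kappa> + 1)) * (L2_norm K (\<lambda>x. g x - L2_proj l K g x))\<^sup>2)"

end

theory Submission
  imports Defs
begin

text \<open>
  The lower bounds only use the continuous equations and hold for any function \<open>y\<^sub>T\<close> of the finite
  element space.  The equation for \<open>\<nabla>(y - y\<^sub>T)\<close> is tested with bubbles, for which we take one smooth
  radial function, translated and scaled, instead of the usual polynomials on simplices.

  On an element, the residual with \<open>f\<close> replaced by its projection is affine, so it keeps its sign and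
  stays comparable to its maximum on some ball whose radius is a fixed multiple of \<open>h\<^sub>K\<close>; a bubble on
  this ball bounds it.  Since \<open>\<nabla>y\<^sub>T\<close> is constant there, it does not contribute.  Around a suitable point
  of an interior side, shape regularity gives a ball of radius comparable to \<open>h\<^sub>K\<close> inside the union of
  the two elements that share the side.  The gradient of a bubble on this ball has integral \<open>m \<nu>\<close> over
  one half of the ball and \<open>- m \<nu>\<close> over the other one, so that the bubble sees the jump times \<open>m\<close>, and
  \<open>m\<close> has the order of the volume of the ball divided by its radius.

  Integration by parts is only needed in the form of difference quotients of Lipschitz functions, so
  no divergence theorem on simplices enters.
\<close>

text \<open>Both estimates are instances of one statement: the state equation has the data
  \<open>u + f\<close>, approximated by \<open>u\<^sub>T + f\<close>, the adjoint equation has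
  \<open>y - y\<^sub>\<Omega>\<close>, approximated by \<open>y\<^sub>T - y\<^sub>\<Omega>\<close>.
  In both, the discrete part is affine on each element up to a null set, so one abstract residual
  covers the two. Bumps have to live in the open set \<Omega>, whereas a mesh covers its closure.
  The Lipschitz boundary excludes slits, along which two elements could share a side that lies on
  the boundary. A side contains a disc as large as the inscribed ball of either adjacent element.
  For d \<ge> 2 this makes the diameters of neighbours comparable, and it provides the centre of the
  ball for the jump. Since the surface measure is the volume of a prism of height 1, covering by
  balls yields a factor 1 + h and not a pure power of h; the constant therefore depends on the
  diameter of \<Omega>, which bounds all element sizes. Weak gradients are chosen ones in the
  definitions, so their uniqueness is needed before explicit gradients of bumps and finite element
  functions can replace them.\<close>

section \<open>Smooth functions with compact support\<close>

text \<open>This class of functions is closed under differentiation, hence all of them are smooth.\<close>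

definition flat_exp :: "real poly \<Rightarrow> real \<Rightarrow> real" where
  "flat_exp P t = (if t \<le> 0 then 0 else poly P (1 / t) * exp (- (1 / t)))"

lemma flat_exp_pos: "t > 0 \<Longrightarrow> flat_exp P t = poly P (1 / t) * exp (- (1 / t))"
  by (simp add: flat_exp_def)

text \<open>The factor \<open>s ^ n\<close> makes the induction work: \<open>pCons a P\<close> is a
  + s P, and the extra s is absorbed into the power. The case n = 1 is the decay of the difference
  quotient of \<open>flat_exp P\<close> at 0, in the variable s = 1 / h.\<close>

lemma power_poly_exp_tendsto_0:
  "((\<lambda>s. s ^ n * poly P s * exp (- s)) \<longlongrightarrow> 0) (at_top :: real filter)"
proof (induction P arbitrary: n)
  case 0
  show ?case by simp
next
  case (pCons a P)
  have 1: "((\<lambda>s. s ^ n * exp (- s)) \<longlongrightarrow> 0) (at_top :: real filter)"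
    using tendsto_power_div_exp_0[of n] by (simp add: exp_minus divide_inverse)
  have 2: "(\<lambda>s. s ^ n * poly (pCons a P) s * exp (- s)) =
      (\<lambda>s. a * (s ^ n * exp (- s)) + s ^ Suc n * poly P s * exp (- s))"
    by (auto simp: algebra_simps)
  show ?case
    unfolding 2 using tendsto_add[OF tendsto_mult_right_zero[OF 1, of a] pCons(2)[of "Suc n"]]
    by simp
qed

lemma flat_exp_has_derivative_0: "(flat_exp P has_real_derivative 0) (at 0)"
proof -
  have r: "((\<lambda>h. (flat_exp P h - flat_exp P 0) / (h - 0)) \<longlongrightarrow> 0) (at_right 0)"
  proof (rule Lim_transform_eventually)
    have "((\<lambda>s. s ^ 1 * poly P s * exp (- s)) \<longlongrightarrow> 0) (at_top :: real filter)"
      by (rule power_poly_exp_tendsto_0)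
    then show "((\<lambda>h. (inverse h) ^ 1 * poly P (inverse h) * exp (- inverse h)) \<longlongrightarrow> 0)
        (at_right (0::real))"
      by (rule filterlim_compose[OF _ filterlim_inverse_at_top_right])
    have "(inverse h) ^ 1 * poly P (inverse h) * exp (- inverse h)
        = (flat_exp P h - flat_exp P 0) / (h - 0)" if "h > 0" for h
    proof -
      have "inverse h ^ 1 * a * b = (a * b - 0) / (h - 0)" for a b :: real
        by (simp add: divide_inverse mult_ac)
      moreover have "flat_exp P 0 = 0" "flat_exp P h = poly P (inverse h) * exp (- inverse h)"
        using that by (auto simp only: flat_exp_def inverse_eq_divide split: if_splits)
      ultimately show ?thesis by metis
    qed
    then show "eventually (\<lambda>h. (inverse h) ^ 1 * poly P (inverse h) * exp (- inverse h)
        = (flat_exp P h - flat_exp P 0) / (h - 0)) (at_right (0::real))"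
      by (rule eventually_mono[OF eventually_at_right_less[of 0]])
  qed
  have l: "((\<lambda>h. (flat_exp P h - flat_exp P 0) / (h - 0)) \<longlongrightarrow> 0) (at_left 0)"
  proof (rule tendsto_eventually)
    show "eventually (\<lambda>h. (flat_exp P h - flat_exp P 0) / (h - 0) = 0) (at_left (0::real))"
      unfolding eventually_at_left_field
      by (rule exI[of _ "-1"]) (auto simp: flat_exp_def)
  qed
  show ?thesis
    unfolding has_field_derivative_iff using filterlim_split_at[OF l r] by simp
qed

text \<open>\<open>[:0, 0, 1:]\<close> is the square of the variable. With s = 1 / t the chain rule
  gives the factor - s^2 for P(s) and + s^2 for the exponential, hence the polynomial (P - P')
  s^2.\<close>

lemma flat_exp_has_derivative:
  "(flat_exp P has_real_derivative flat_exp ((P - pderiv P) * [:0, 0, 1:]) t) (at t)"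
proof (cases "t = 0")
  case True
  then show ?thesis using flat_exp_has_derivative_0[of P] by (simp add: flat_exp_def)
next
  case False
  show ?thesis
  proof (cases "t < 0")
    case True
    have "((\<lambda>_. 0) has_real_derivative 0) (at t)" by simp
    then have "(flat_exp P has_real_derivative 0) (at t)"
      by (rule has_field_derivative_transform_within_open[where S = "{..<0}"])
         (use True in \<open>auto simp: flat_exp_def\<close>)
    then show ?thesis using True by (simp add: flat_exp_def)
  next
    case neg: False
    then have t: "t > 0" using False by simp
    have "((\<lambda>t. poly P (1 / t) * exp (- (1 / t))) has_real_derivative
        flat_exp ((P - pderiv P) * [:0, 0, 1:]) t) (at t)"
    proof -
      have i: "((\<lambda>t. 1 / t) has_real_derivative - (1 / t\<^sup>2)) (at t)"
        using DERIV_inverse[of t] t by (simp add: inverse_eq_divide power2_eq_square)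
      have "((\<lambda>t. poly P (1 / t) * exp (- (1 / t))) has_real_derivative
          poly (pderiv P) (1 / t) * - (1 / t\<^sup>2) * exp (- (1 / t))
          + exp (- (1 / t)) * - (- (1 / t\<^sup>2)) * poly P (1 / t)) (at t)"
        by (intro DERIV_mult DERIV_chain2[OF poly_DERIV i] DERIV_chain2[OF DERIV_exp DERIV_minus[OF i]])
      moreover have "poly (pderiv P) (1 / t) * - (1 / t\<^sup>2) * exp (- (1 / t))
          + exp (- (1 / t)) * - (- (1 / t\<^sup>2)) * poly P (1 / t)
          = flat_exp ((P - pderiv P) * [:0, 0, 1:]) t"
        using t by (simp add: flat_exp_def power2_eq_square algebra_simps)
      ultimately show ?thesis by metis
    qed
    then show ?thesis
      by (rule has_field_derivative_transform_within_open[where S = "{0<..}"])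
         (use t in \<open>auto simp: flat_exp_def\<close>)
  qed
qed

lemma continuous_on_flat_exp: "continuous_on S (flat_exp P)"
  by (meson DERIV_isCont continuous_at_imp_continuous_on flat_exp_has_derivative)

section \<open>Closure properties of k times continuously differentiable functions\<close>

lemma times_cont_diff_Suc_D: "times_cont_diff (Suc k) f \<Longrightarrow> times_cont_diff k f"
proof (induction k arbitrary: f)
  case 0
  then show ?case
    by (simp add: continuous_on_eq_continuous_at differentiable_imp_continuous_within)
next
  case (Suc k)
  have "\<forall>x. f differentiable (at x)"
    and "\<forall>v. times_cont_diff (Suc k) (\<lambda>x. frechet_derivative f (at x) v)"
    using Suc.prems times_cont_diff.simps(2)[of "Suc k" f] by blast+
  then show ?case
    using Suc.IH times_cont_diff.simps(2)[of k f] by blast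
qed

lemma times_cont_diff_const: "times_cont_diff k (\<lambda>x. c)"
  by (induction k arbitrary: c) (auto simp: frechet_derivative_const)

lemma times_cont_diff_inner: "times_cont_diff k (\<lambda>x. x \<bullet> a)"
proof (cases k)
  case (Suc n)
  have d: "((\<lambda>x. x \<bullet> a) has_derivative (\<lambda>v. v \<bullet> a)) (at x)" for x
    by (rule derivative_eq_intros refl)+ auto
  have "frechet_derivative (\<lambda>x. x \<bullet> a) (at x) v = v \<bullet> a" for x v
    using frechet_derivative_at[OF d] by metis
  then show ?thesis
    using d unfolding Suc by (auto simp: differentiable_def times_cont_diff_const)
qed (auto intro!: continuous_intros)

lemma times_cont_diff_add:
  "times_cont_diff k f \<Longrightarrow> times_cont_diff k g \<Longrightarrow> times_cont_diff k (\<lambda>x. f x + g x)"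
proof (induction k arbitrary: f g)
  case (Suc k)
  have "frechet_derivative (\<lambda>x. f x + g x) (at x) v =
      frechet_derivative f (at x) v + frechet_derivative g (at x) v" for x v
  proof -
    have "(f has_derivative frechet_derivative f (at x)) (at x)"
      "(g has_derivative frechet_derivative g (at x)) (at x)"
      using Suc.prems by (auto simp flip: frechet_derivative_works)
    from frechet_derivative_at[OF has_derivative_add[OF this]] show ?thesis by metis
  qed
  then show ?case using Suc by auto
qed (auto intro: continuous_intros)

lemma times_cont_diff_mult:
  "times_cont_diff k f \<Longrightarrow> times_cont_diff k g \<Longrightarrow> times_cont_diff k (\<lambda>x. f x * g x)"
proof (induction k arbitrary: f g)
  case (Suc k)
  have "frechet_derivative (\<lambda>x. f x * g x) (at x) v =
      f x * frechet_derivative g (at x) v + frechet_derivative f (at x) v * g x" for x v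
  proof -
    have "(f has_derivative frechet_derivative f (at x)) (at x)"
      "(g has_derivative frechet_derivative g (at x)) (at x)"
      using Suc.prems by (auto simp flip: frechet_derivative_works)
    from frechet_derivative_at[OF has_derivative_mult[OF this]] show ?thesis by metis
  qed
  then show ?case
    using Suc times_cont_diff_Suc_D[OF Suc.prems(1)] times_cont_diff_Suc_D[OF Suc.prems(2)]
    by (auto intro!: times_cont_diff_add)
qed (auto intro: continuous_intros)

lemma times_cont_diff_prod:
  "(\<And>i. i \<in> I \<Longrightarrow> times_cont_diff k (f i)) \<Longrightarrow> times_cont_diff k (\<lambda>x. \<Prod>i\<in>I. f i x)"
  by (induction I rule: infinite_finite_induct)
     (auto intro!: times_cont_diff_const times_cont_diff_mult)

lemma times_cont_diff_sum:
  "(\<And>i. i \<in> I \<Longrightarrow> times_cont_diff k (f i)) \<Longrightarrow> times_cont_diff k (\<lambda>x. \<Sum>i\<in>I. f i x)"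
  by (induction I rule: infinite_finite_induct)
     (auto intro!: times_cont_diff_const times_cont_diff_add)

lemma has_derivative_flat_exp_compose:
  assumes "(w has_derivative w') (at x)"
  shows "((\<lambda>x. flat_exp P (w x)) has_derivative
    (\<lambda>v. flat_exp ((P - pderiv P) * [:0, 0, 1:]) (w x) * w' v)) (at x)"
  using has_derivative_compose[OF assms
      flat_exp_has_derivative[of P "w x", unfolded has_field_derivative_def]]
  by (simp add: mult.commute)

text \<open>The induction runs over all P at once: differentiation replaces P by another polynomial
  and multiplies by a derivative of w, which is again smooth.\<close>

lemma times_cont_diff_flat_exp:
  assumes "\<And>k. times_cont_diff k w"
  shows "times_cont_diff k (\<lambda>x. flat_exp P (w x))"
proof (induction k arbitrary: P)
  case 0
  have "continuous_on UNIV w" using assms[of 0] by simp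
  then show ?case
    by (auto intro: continuous_on_compose2[OF continuous_on_flat_exp[of UNIV P]])
next
  case (Suc k)
  have "w differentiable (at x)" for x using assms[of 1] by simp
  then have "(w has_derivative frechet_derivative w (at x)) (at x)" for x
    by (simp add: frechet_derivative_works)
  note d = has_derivative_flat_exp_compose[OF this]
  have 1: "frechet_derivative (\<lambda>x. flat_exp P (w x)) (at x) v =
     flat_exp ((P - pderiv P) * [:0, 0, 1:]) (w x) * frechet_derivative w (at x) v" for x v P
    using frechet_derivative_at[OF d] by metis
  have "times_cont_diff k (\<lambda>x. frechet_derivative w (at x) v)" for v
    using assms[of "Suc k"] by simp
  then show ?case
    using d unfolding times_cont_diff.simps 1
    by (auto simp: differentiable_def intro!: times_cont_diff_mult Suc)
qed

section \<open>Radial bumps and their gradients\<close>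

definition flat_exp1 :: "real \<Rightarrow> real" where
  "flat_exp1 = flat_exp [:0, 0, 1:]"

lemma flat_exp_1_le_1: "flat_exp 1 t \<le> 1" and flat_exp_1_nonneg: "0 \<le> flat_exp 1 t"
  by (auto simp: flat_exp_def)

lemma flat_exp1_nonneg: "0 \<le> flat_exp1 t"
  by (auto simp: flat_exp1_def flat_exp_def)

lemma flat_exp1_bounded: "\<exists>C>0. \<forall>t\<le>1. flat_exp1 t \<le> C"
proof -
  have "compact (flat_exp1 ` {0..1})"
    unfolding flat_exp1_def by (intro compact_continuous_image continuous_on_flat_exp) auto
  then obtain B where B: "\<forall>t\<in>{0..1}. norm (flat_exp1 t) \<le> B"
    by (metis bounded_iff compact_imp_bounded imageI)
  have "flat_exp1 t \<le> max B 1" if "t \<le> 1" for t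
  proof (cases "t \<ge> 0")
    case True
    with B that have "norm (flat_exp1 t) \<le> B" by simp
    then show ?thesis by simp
  qed (simp add: flat_exp1_def flat_exp_def)
  then show ?thesis by (intro exI[of _ "max B 1"]) auto
qed

text \<open>The threshold 7/16 is 1 - (3/4)^2, the value of 1 - |x - x0|^2 / r^2 at distance 3r/4
  from the centre.\<close>

lemma flat_exp1_ge:
  assumes "7 / 16 \<le> t" "t \<le> 1"
  shows "exp (- (16 / 7)) \<le> flat_exp1 t"
proof -
  have "1 / t \<le> 1 / (7 / 16)" using assms(1) by (intro divide_left_mono) auto
  then have e: "exp (- (16 / 7)) \<le> exp (- (1 / t))" by simp
  have q: "1 / t \<ge> 1" using assms by simp
  then have "(1 / t) * (1 / t) \<ge> 1 * 1" using assms(1) by (intro mult_mono) auto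
  then have "1 * exp (- (16 / 7)) \<le> (1 / t) * (1 / t) * exp (- (1 / t))"
    using e assms(1) by (intro mult_mono) auto
  then show ?thesis using assms unfolding flat_exp1_def by (subst flat_exp_pos) simp_all
qed

text \<open>The usual mollifier e^(-1/(1 - |z|^2)) with z = (x - x0) / r, not normalised. The
  derivative of its profile \<open>flat_exp 1\<close> is \<open>flat_exp1\<close>.\<close>

definition bump :: "'a::euclidean_space \<Rightarrow> real \<Rightarrow> 'a \<Rightarrow> real" where
  "bump x0 r x = flat_exp 1 (1 - ((x - x0) \<bullet> (x - x0)) / r\<^sup>2)"

definition bump_grad :: "'a::euclidean_space \<Rightarrow> real \<Rightarrow> 'a \<Rightarrow> 'a" where
  "bump_grad x0 r x = (- 2 * flat_exp1 (1 - ((x - x0) \<bullet> (x - x0)) / r\<^sup>2) / r\<^sup>2) *\<^sub>R (x - x0)"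

lemma bump_has_derivative: "(bump x0 r has_derivative (\<lambda>v. bump_grad x0 r x \<bullet> v)) (at x)"
proof -
  have "((\<lambda>x. (x - x0) \<bullet> (x - x0)) has_derivative
      (\<lambda>v. (x - x0) \<bullet> (v - 0) + (v - 0) \<bullet> (x - x0))) (at x)"
    by (intro has_derivative_inner has_derivative_diff has_derivative_ident has_derivative_const)
  then have "((\<lambda>x. 1 - (1 / r\<^sup>2) *\<^sub>R ((x - x0) \<bullet> (x - x0))) has_derivative
      (\<lambda>v. 0 - (1 / r\<^sup>2) *\<^sub>R ((x - x0) \<bullet> (v - 0) + (v - 0) \<bullet> (x - x0)))) (at x)"
    by (intro has_derivative_diff has_derivative_const has_derivative_scaleR_right)
  then have d: "((\<lambda>x. 1 - ((x - x0) \<bullet> (x - x0)) / r\<^sup>2) has_derivative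
      (\<lambda>v. - (2 * ((x - x0) \<bullet> v)) / r\<^sup>2)) (at x)"
    by (simp add: inner_commute)
  have "(1 - pderiv 1) * [:0, 0, 1:] = [:0, 0, 1::real:]" by simp
  with has_derivative_flat_exp_compose[OF d, of 1]
  have "((\<lambda>x. flat_exp 1 (1 - ((x - x0) \<bullet> (x - x0)) / r\<^sup>2)) has_derivative
      (\<lambda>v. flat_exp1 (1 - ((x - x0) \<bullet> (x - x0)) / r\<^sup>2) * (- (2 * ((x - x0) \<bullet> v)) / r\<^sup>2))) (at x)"
    unfolding flat_exp1_def by metis
  then show ?thesis
    unfolding bump_def[abs_def] bump_grad_def by (simp add: mult.commute mult.left_commute mult.assoc)
qed

lemma times_cont_diff_bump: "times_cont_diff k (bump x0 r)"
proof -
  have sq: "times_cont_diff k (\<lambda>x. (x \<bullet> i + (- (x0 \<bullet> i))) * (x \<bullet> i + (- (x0 \<bullet> i))))" for k i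
    by (rule times_cont_diff_mult times_cont_diff_add times_cont_diff_inner times_cont_diff_const)+
  have "times_cont_diff k (\<lambda>x. 1 + (- 1 / r\<^sup>2) *
      (\<Sum>i\<in>Basis. (x \<bullet> i + (- (x0 \<bullet> i))) * (x \<bullet> i + (- (x0 \<bullet> i)))))" (is "times_cont_diff k ?w") for k
    by (rule times_cont_diff_add times_cont_diff_mult times_cont_diff_const times_cont_diff_sum sq)+
  then have "times_cont_diff k (\<lambda>x. flat_exp 1 (?w x))"
    by (rule times_cont_diff_flat_exp)
  moreover have "bump x0 r = (\<lambda>x. flat_exp 1 (?w x))"
    unfolding bump_def[abs_def] by (subst euclidean_inner) (simp add: inner_diff_left)
  ultimately show ?thesis by metis
qed

lemma bump_outside:
  assumes "r > 0" "x \<notin> ball x0 r"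
  shows "bump x0 r x = 0" "bump_grad x0 r x = 0"
proof -
  have "r\<^sup>2 \<le> (x - x0) \<bullet> (x - x0)"
    using assms by (simp add: dot_square_norm dist_norm norm_minus_commute)
  then have "1 - ((x - x0) \<bullet> (x - x0)) / r\<^sup>2 \<le> 0" using assms(1) by (simp add: field_simps)
  then show "bump x0 r x = 0" "bump_grad x0 r x = 0"
    by (auto simp: bump_def bump_grad_def flat_exp1_def flat_exp_def)
qed

lemma bump_nonneg: "0 \<le> bump x0 r x" and bump_le_1: "bump x0 r x \<le> 1"
  by (auto simp: bump_def flat_exp_1_le_1 flat_exp_1_nonneg)

lemma bump_test_function:
  assumes "r > 0" "cball x0 r \<subseteq> S"
  shows "bump x0 r \<in> test_functions S"
proof -
  have "bump x0 r x = 0" if "x \<notin> cball x0 r" for x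
    using bump_outside(1)[of r x x0] that assms(1) by auto
  then show ?thesis
    unfolding test_functions_def using assms by (auto intro!: exI[of _ "cball x0 r"] times_cont_diff_bump)
qed

lemma continuous_on_bump: "continuous_on S (bump x0 r)"
  using times_cont_diff_bump[of 0] continuous_on_subset by force

lemma continuous_on_bump_grad: "continuous_on S (bump_grad x0 r)"
proof -
  have "continuous_on S (\<lambda>x. 1 - (1 / r\<^sup>2) * ((x - x0) \<bullet> (x - x0)))"
    by (intro continuous_intros)
  then have c: "continuous_on S (\<lambda>x. flat_exp1 (1 - (1 / r\<^sup>2) * ((x - x0) \<bullet> (x - x0))))"
    unfolding flat_exp1_def
    by (rule continuous_on_compose2[OF continuous_on_flat_exp[of UNIV]]) simp
  have "continuous_on S (\<lambda>x. (- 2 / r\<^sup>2 * flat_exp1 (1 - (1 / r\<^sup>2) * ((x - x0) \<bullet> (x - x0)))) *\<^sub>R (x - x0))"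
    by (intro continuous_on_scaleR continuous_on_mult continuous_on_const c continuous_on_diff continuous_on_id)
  then show ?thesis
    unfolding bump_grad_def[abs_def] by simp
qed

text \<open>The order of the quantifiers is the point: one constant serves all centres and radii, so
  that it may enter the final constant.\<close>

lemma bump_grad_bound: "\<exists>C>0. \<forall>(x0::'a::euclidean_space) r x. r > 0 \<longrightarrow> norm (bump_grad x0 r x) \<le> C / r"
proof -
  obtain C where C: "C > 0" "\<And>t. t \<le> 1 \<Longrightarrow> flat_exp1 t \<le> C" using flat_exp1_bounded by blast
  have "norm (bump_grad x0 r x) \<le> (2 * C) / r" if r: "r > 0" for x0 x :: 'a and r
  proof (cases "x \<in> ball x0 r")
    case True
    have "norm (bump_grad x0 r x)
        = 2 * flat_exp1 (1 - ((x - x0) \<bullet> (x - x0)) / r\<^sup>2) / r\<^sup>2 * norm (x - x0)"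
      by (simp add: bump_grad_def abs_mult flat_exp1_nonneg)
    also have "\<dots> \<le> 2 * C / r\<^sup>2 * r"
      using True C r
      by (intro mult_mono divide_right_mono) (auto simp: dist_norm norm_minus_commute flat_exp1_nonneg)
    also have "\<dots> = (2 * C) / r" using r by (simp add: power2_eq_square)
    finally show ?thesis .
  next
    case False
    then show ?thesis using bump_outside(2)[OF r False] C r by simp
  qed
  then show ?thesis using C(1) by (intro exI[of _ "2 * C"]) auto
qed

text \<open>Up to distance r/2 the argument of the profile is at least 1 - 1/4 = 3/4, whence the
  exponent -4/3.\<close>

lemma bump_lower:
  assumes "r > 0" "x \<in> ball x0 (r / 2)"
  shows "exp (- (4 / 3)) \<le> bump x0 r x"
proof -
  have "(x - x0) \<bullet> (x - x0) \<le> (r / 2)\<^sup>2"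
    using assms unfolding dot_square_norm
    by (intro power_mono) (auto simp: dist_norm norm_minus_commute)
  then have "((x - x0) \<bullet> (x - x0)) / r\<^sup>2 \<le> 1 / 4" using assms(1) by (simp add: field_simps power2_eq_square)
  then have t: "1 - ((x - x0) \<bullet> (x - x0)) / r\<^sup>2 \<ge> 3 / 4" (is "?t \<ge> _") by simp
  then have "1 / ?t \<le> 1 / (3 / 4)" by (intro divide_left_mono) auto
  then have "exp (- (4 / 3)) \<le> exp (- (1 / ?t))" by simp
  moreover have "bump x0 r x = exp (- (1 / ?t))" unfolding bump_def by (subst flat_exp_pos) (use t in linarith, simp)
  ultimately show ?thesis by simp
qed

text \<open>The ball in the next lemma lies in the half ball where the directional derivative is positive.\<close>

lemma bump_grad_lower:
  assumes "r > 0" "norm \<nu> = 1" "x \<in> ball (x0 - (r / 2) *\<^sub>R \<nu>) (r / 4)"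
  shows "exp (- (16 / 7)) / (2 * r) \<le> bump_grad x0 r x \<bullet> \<nu>"
proof -
  define z where "z = x - x0 + (r / 2) *\<^sub>R \<nu>"
  have z: "norm z < r / 4"
    using assms(3) by (simp add: z_def dist_norm norm_minus_commute algebra_simps)
  have x: "x - x0 = z - (r / 2) *\<^sub>R \<nu>" by (simp add: z_def)
  have "\<nu> \<bullet> \<nu> = 1" using assms(2) by (simp add: dot_square_norm)
  moreover have "z \<bullet> \<nu> \<le> r / 4"
    using norm_cauchy_schwarz[of z \<nu>] z assms(2) by simp
  \<comment> \<open>The small ball has radius r/4 and its centre at depth r/2 below x0, measured
    along \<nu>: its points have depth at least r/4 and distance at most 3r/4 from x0.\<close>
  ultimately have 1: "- ((x - x0) \<bullet> \<nu>) \<ge> r / 4" unfolding x by (simp add: inner_diff_left)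
  have "norm (x - x0) \<le> norm z + norm ((r / 2) *\<^sub>R \<nu>)" unfolding x by (rule norm_triangle_ineq4)
  then have "norm (x - x0) \<le> 3 * r / 4" using z assms by simp
  then have "(x - x0) \<bullet> (x - x0) \<le> (3 * r / 4)\<^sup>2"
    unfolding dot_square_norm by (intro power_mono) auto
  then have "((x - x0) \<bullet> (x - x0)) / r\<^sup>2 \<le> 9 / 16" using assms(1) by (simp add: field_simps power2_eq_square)
  then have t: "1 - ((x - x0) \<bullet> (x - x0)) / r\<^sup>2 \<ge> 7 / 16" (is "?t \<ge> _") by simp
  moreover have "?t \<le> 1" using assms(1) by simp
  ultimately have 2: "exp (- (16 / 7)) \<le> flat_exp1 ?t" by (rule flat_exp1_ge)
  have "exp (- (16 / 7)) / (2 * r) = exp (- (16 / 7)) * (r / 4) * (2 / r\<^sup>2)"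
    using assms(1) by (simp add: power2_eq_square)
  also have "\<dots> \<le> flat_exp1 ?t * (- ((x - x0) \<bullet> \<nu>)) * (2 / r\<^sup>2)"
    using 1 2 assms(1) flat_exp1_nonneg by (intro mult_right_mono mult_mono) auto
  also have "\<dots> = bump_grad x0 r x \<bullet> \<nu>" by (simp add: bump_grad_def)
  finally show ?thesis .
qed

section \<open>Smooth approximations of box indicators\<close>

definition box_bump :: "nat \<Rightarrow> 'a::euclidean_space \<Rightarrow> 'a \<Rightarrow> 'a \<Rightarrow> real" where
  "box_bump n a b x = (\<Prod>i\<in>Basis. flat_exp 1 (real n * ((x \<bullet> i - a \<bullet> i) * (b \<bullet> i - x \<bullet> i))))"

lemma box_bump_nonneg: "0 \<le> box_bump n a b x" and box_bump_le_1: "box_bump n a b x \<le> 1"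
  unfolding box_bump_def
  by (auto intro!: prod_nonneg prod_le_1 simp: flat_exp_1_le_1 flat_exp_1_nonneg)

lemma box_bump_outside:
  assumes "x \<notin> box a b" "box a b \<noteq> {}"
  shows "box_bump n a b x = 0"
proof -
  obtain i where i: "i \<in> Basis" "\<not> (a \<bullet> i < x \<bullet> i \<and> x \<bullet> i < b \<bullet> i)"
    using assms(1) by (auto simp: mem_box)
  have "a \<bullet> i < b \<bullet> i" using assms(2) i(1) by (auto simp: box_ne_empty)
  then have "(x \<bullet> i - a \<bullet> i) * (b \<bullet> i - x \<bullet> i) \<le> 0"
    using i(2) by (cases "a \<bullet> i < x \<bullet> i") (auto intro: mult_nonneg_nonpos mult_nonpos_nonneg)
  then have "flat_exp 1 (real n * ((x \<bullet> i - a \<bullet> i) * (b \<bullet> i - x \<bullet> i))) = 0"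
    by (simp add: flat_exp_def mult_nonneg_nonpos)
  then show ?thesis unfolding box_bump_def using i(1) by (intro prod_zero) auto
qed

lemma box_bump_test_function:
  assumes "box a b \<noteq> {}" "cbox a b \<subseteq> S"
  shows "box_bump n a b \<in> test_functions S"
proof -
  have "box_bump n a b x = 0" if "x \<notin> cbox a b" for x
    using box_bump_outside[of x a b n] that assms(1) box_subset_cbox by blast
  moreover have "times_cont_diff k (box_bump n a b)" for k
  proof -
    have "times_cont_diff k (\<lambda>x. real n * ((x \<bullet> i + (- (a \<bullet> i))) * (b \<bullet> i + (- 1) * (x \<bullet> i))))" for k i
      by (intro times_cont_diff_add times_cont_diff_mult times_cont_diff_const times_cont_diff_inner)
    then have "times_cont_diff k (\<lambda>x. real n * ((x \<bullet> i - a \<bullet> i) * (b \<bullet> i - x \<bullet> i)))" for k i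
      by simp
    then show ?thesis
      unfolding box_bump_def[abs_def] by (intro times_cont_diff_prod times_cont_diff_flat_exp)
  qed
  ultimately show ?thesis
    unfolding test_functions_def using assms by (auto intro!: exI[of _ "cbox a b"])
qed

text \<open>Inside the box each factor is e^(-1/(n m)) with some m > 0 and tends to 1; outside, the
  product is 0 for every n. The values stay in [0, 1], so dominated convergence will apply.\<close>

lemma box_bump_tendsto:
  assumes "box a b \<noteq> {}"
  shows "(\<lambda>n. box_bump n a b x) \<longlonglongrightarrow> indicator (box a b) x"
proof (cases "x \<in> box a b")
  case True
  have "(\<lambda>n. flat_exp 1 (real n * ((x \<bullet> i - a \<bullet> i) * (b \<bullet> i - x \<bullet> i)))) \<longlonglongrightarrow> 1" if "i \<in> Basis" for i
  proof -
    define m where "m = (x \<bullet> i - a \<bullet> i) * (b \<bullet> i - x \<bullet> i)"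
    have m: "m > 0" using True that by (auto simp: m_def mem_box)
    have "(\<lambda>n. 1 / real n) \<longlonglongrightarrow> 0" by (rule lim_const_over_n)
    from tendsto_mult_left_zero[OF this, of "1 / m"]
    have "(\<lambda>n. exp (- (1 / (real n * m)))) \<longlonglongrightarrow> exp (- 0)" by (intro tendsto_intros) simp
    moreover have "eventually (\<lambda>n. exp (- (1 / (real n * m))) = flat_exp 1 (real n * m)) sequentially"
      using eventually_gt_at_top[of 0]
      by eventually_elim (use m in \<open>auto simp: flat_exp_def not_le mult_le_0_iff\<close>)
    ultimately show ?thesis
      unfolding m_def by (auto elim: Lim_transform_eventually)
  qed
  then have "(\<lambda>n. box_bump n a b x) \<longlonglongrightarrow> (\<Prod>i\<in>(Basis::'a set). 1)"
    unfolding box_bump_def by (intro tendsto_prod) auto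
  then show ?thesis using True by simp
next
  case False
  then show ?thesis using box_bump_outside[OF False assms] by simp
qed

section \<open>Square integrable functions\<close>

lemma L2_borel: "g \<in> L2 S \<Longrightarrow> g \<in> borel_measurable (lebesgue_on S)"
  and L2_square_integrable: "g \<in> L2 S \<Longrightarrow> integrable (lebesgue_on S) (\<lambda>x. (norm (g x))\<^sup>2)"
  by (auto simp: L2_def)

lemma L2_norm_nonneg [simp]: "0 \<le> L2_norm S g"
  by (simp add: L2_norm_def)

lemma L2_norm_square: "(L2_norm S g)\<^sup>2 = (LINT x|lebesgue_on S. (norm (g x))\<^sup>2)"
  unfolding L2_norm_def by (rule real_sqrt_pow2) (rule Bochner_Integration.integral_nonneg, simp)

lemma L2_integrable_inner:
  assumes "g \<in> L2 S" "h \<in> L2 S"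
  shows "integrable (lebesgue_on S) (\<lambda>x. g x \<bullet> h x)"
proof (rule Bochner_Integration.integrable_bound)
  show "integrable (lebesgue_on S) (\<lambda>x. (norm (g x))\<^sup>2 + (norm (h x))\<^sup>2)"
    using assms by (intro Bochner_Integration.integrable_add L2_square_integrable)
  show "(\<lambda>x. g x \<bullet> h x) \<in> borel_measurable (lebesgue_on S)"
    using assms by (intro borel_measurable_inner L2_borel)
  have "norm (g x \<bullet> h x) \<le> norm ((norm (g x))\<^sup>2 + (norm (h x))\<^sup>2)" for x
  proof -
    have "\<bar>g x \<bullet> h x\<bar> \<le> norm (g x) * norm (h x)" by (rule Cauchy_Schwarz_ineq2)
    moreover have "2 * (norm (g x) * norm (h x)) \<le> (norm (g x))\<^sup>2 + (norm (h x))\<^sup>2"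
      using sum_squares_bound[of "norm (g x)" "norm (h x)"] by simp
    moreover have "0 \<le> norm (g x) * norm (h x)" by simp
    ultimately show ?thesis by simp
  qed
  then show "AE x in lebesgue_on S. norm (g x \<bullet> h x) \<le> norm ((norm (g x))\<^sup>2 + (norm (h x))\<^sup>2)"
    by simp
qed

lemma L2_scaleR: "g \<in> L2 S \<Longrightarrow> (\<lambda>x. c *\<^sub>R g x) \<in> L2 S"
  unfolding L2_def by (auto simp: power_mult_distrib)

lemma L2_add:
  assumes "g \<in> L2 S" "h \<in> L2 S"
  shows "(\<lambda>x. g x + h x) \<in> L2 S"
proof -
  have "(\<lambda>x. (norm (g x + h x))\<^sup>2) = (\<lambda>x. (norm (g x))\<^sup>2 + (norm (h x))\<^sup>2 + 2 * (g x \<bullet> h x))"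
    by (auto simp: power2_norm_eq_inner inner_add_left inner_add_right inner_commute)
  then show ?thesis
    using assms L2_integrable_inner[OF assms] unfolding L2_def by auto
qed

lemma L2_minus: "g \<in> L2 S \<Longrightarrow> (\<lambda>x. - g x) \<in> L2 S"
  using L2_scaleR[of g S "-1"] by simp

lemma L2_diff: "g \<in> L2 S \<Longrightarrow> h \<in> L2 S \<Longrightarrow> (\<lambda>x. g x - h x) \<in> L2 S"
  using L2_add[OF _ L2_minus, of g S h] by simp

lemma L2_inner_const:
  fixes g :: "'a::euclidean_space \<Rightarrow> 'b::euclidean_space"
  assumes "g \<in> L2 S"
  shows "(\<lambda>x. g x \<bullet> b) \<in> L2 S"
proof -
  have "integrable (lebesgue_on S) (\<lambda>x. (norm (g x \<bullet> b))\<^sup>2)"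
  proof (rule Bochner_Integration.integrable_bound)
    show "integrable (lebesgue_on S) (\<lambda>x. (norm b)\<^sup>2 * (norm (g x))\<^sup>2)"
      using L2_square_integrable[OF assms] by simp
    have "norm ((norm (g x \<bullet> b))\<^sup>2) \<le> norm ((norm b)\<^sup>2 * (norm (g x))\<^sup>2)" for x
      using power_mono[OF Cauchy_Schwarz_ineq2[of "g x" b], of 2]
      by (simp add: power_mult_distrib mult.commute)
    then show "AE x in lebesgue_on S. norm ((norm (g x \<bullet> b))\<^sup>2) \<le> norm ((norm b)\<^sup>2 * (norm (g x))\<^sup>2)"
      by simp
  qed (use L2_borel[OF assms] in measurable)
  then show ?thesis using L2_borel[OF assms] unfolding L2_def by auto
qed

lemma L2_bounded:
  assumes "S \<in> lmeasurable" "g \<in> borel_measurable (lebesgue_on S)" "\<And>x. x \<in> S \<Longrightarrow> norm (g x) \<le> B"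
  shows "g \<in> L2 S"
proof -
  interpret finite_measure "lebesgue_on S" using assms(1) by (rule finite_measure_lebesgue_on)
  have "integrable (lebesgue_on S) (\<lambda>x. (norm (g x))\<^sup>2)"
  proof (rule integrable_const_bound)
    show "AE x in lebesgue_on S. norm ((norm (g x))\<^sup>2) \<le> B\<^sup>2"
      using assms(3) by (intro AE_I2) (auto intro: power_mono)
  qed (use assms(2) in measurable)
  then show ?thesis using assms(2) by (simp add: L2_def)
qed

lemma L2_continuous:
  assumes "compact S" "continuous_on S g"
  shows "g \<in> L2 S"
proof -
  have "compact (g ` S)" using assms by (intro compact_continuous_image)
  then obtain B where "\<forall>x\<in>S. norm (g x) \<le> B" by (metis bounded_iff compact_imp_bounded imageI)
  moreover have "S \<in> sets lebesgue" using assms(1) lmeasurable_compact by blast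
  ultimately show ?thesis
    using assms by (intro L2_bounded[of _ _ B] continuous_imp_measurable_on_sets_lebesgue)
      (auto simp: lmeasurable_compact)
qed

text \<open>The null set N is there for closed elements: they lie in \<Omega> only up to points of
  its boundary, and completeness of the Lebesgue measure still makes g measurable on them.\<close>

lemma L2_mono:
  fixes g :: "'a::euclidean_space \<Rightarrow> 'b::euclidean_space"
  assumes g: "g \<in> L2 S" and S: "S \<in> sets lebesgue" and T: "T \<in> sets lebesgue"
    and N: "negligible N" "T \<subseteq> S \<union> N"
  shows "g \<in> L2 T" and "L2_norm T g \<le> L2_norm S g"
proof -
  let ?h = "\<lambda>x. if x \<in> S then g x else 0"
  have ST: "S \<inter> T \<in> sets lebesgue" using S T by auto
  have N0: "N \<in> null_sets lebesgue" using N(1) by (simp add: negligible_iff_null_sets)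
  have ae: "AE x in lebesgue_on T. x \<in> S"
    unfolding AE_restrict_space_iff[of T lebesgue, simplified, OF T]
    using AE_not_in[OF N0] by eventually_elim (use N(2) in auto)
  have hm: "(\<lambda>x. if x \<in> S then g x else 0) \<in> borel_measurable lebesgue"
    using L2_borel[OF g] S by (simp add: borel_measurable_if)
  have gm: "g \<in> borel_measurable (lebesgue_on T)"
  proof -
    have 1: "(\<lambda>x. if x \<in> T then (if x \<in> S then g x else 0) else 0) \<in> borel_measurable lebesgue"
      using hm T by measurable
    have "AE x in lebesgue. (if x \<in> T then (if x \<in> S then g x else 0) else 0) = (if x \<in> T then g x else 0)"
      using AE_not_in[OF N0] by eventually_elim (use N(2) in auto)
    then have "(\<lambda>x. if x \<in> T then g x else 0) \<in> borel_measurable lebesgue"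
      by (rule borel_measurable_AE[OF 1])
    then show ?thesis using T by (simp add: borel_measurable_if)
  qed
  have i0: "integrable lebesgue (\<lambda>x. if x \<in> S then (norm (g x))\<^sup>2 else 0)"
    using L2_square_integrable[OF g] S by (simp add: Lebesgue_Measure.integrable_restrict_UNIV)
  have i1: "integrable lebesgue (\<lambda>x. if x \<in> S \<inter> T then (norm (g x))\<^sup>2 else 0)"
  proof (rule Bochner_Integration.integrable_bound[OF i0])
    have "(\<lambda>x. (norm (?h x))\<^sup>2 * indicator T x) \<in> borel_measurable lebesgue"
      using hm T by measurable
    also have "(\<lambda>x. (norm (?h x))\<^sup>2 * indicator T x) = (\<lambda>x. if x \<in> S \<inter> T then (norm (g x))\<^sup>2 else 0)"
      by (auto simp: indicator_def)
    finally show "(\<lambda>x. if x \<in> S \<inter> T then (norm (g x))\<^sup>2 else 0) \<in> borel_measurable lebesgue" .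
  qed auto
  have eq: "AE x in lebesgue. (if x \<in> S \<inter> T then (norm (g x))\<^sup>2 else 0) = (if x \<in> T then (norm (g x))\<^sup>2 else 0)"
    using AE_not_in[OF N0] by eventually_elim (use N(2) in auto)
  have m2: "(\<lambda>x. if x \<in> T then (norm (g x))\<^sup>2 else 0) \<in> borel_measurable lebesgue"
  proof -
    have "(\<lambda>x. (norm (g x))\<^sup>2) \<in> borel_measurable (lebesgue_on T)" using gm by measurable
    then show ?thesis using T by (simp add: borel_measurable_if)
  qed
  have i2: "integrable lebesgue (\<lambda>x. if x \<in> T then (norm (g x))\<^sup>2 else 0)"
    using integrable_cong_AE[OF _ m2 eq] i1 by auto
  then show "g \<in> L2 T" using gm T by (simp add: L2_def Lebesgue_Measure.integrable_restrict_UNIV)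
  have "(LINT x|lebesgue_on T. (norm (g x))\<^sup>2) = (LINT x|lebesgue. (if x \<in> T then (norm (g x))\<^sup>2 else 0))"
    using T by (simp add: Lebesgue_Measure.integral_restrict_UNIV)
  also have "\<dots> = (LINT x|lebesgue. (if x \<in> S \<inter> T then (norm (g x))\<^sup>2 else 0))"
    using integral_cong_AE[OF _ m2 eq] i1 by auto
  also have "\<dots> \<le> (LINT x|lebesgue. (if x \<in> S then (norm (g x))\<^sup>2 else 0))"
    by (intro integral_mono i0 i1) auto
  also have "\<dots> = (LINT x|lebesgue_on S. (norm (g x))\<^sup>2)"
    using S by (simp add: Lebesgue_Measure.integral_restrict_UNIV)
  finally show "L2_norm T g \<le> L2_norm S g" unfolding L2_norm_def by simp
qed

lemma L2_norm_add_square: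
  assumes "g \<in> L2 S" "h \<in> L2 S"
  shows "(L2_norm S (\<lambda>x. g x + h x))\<^sup>2 \<le> 2 * (L2_norm S g)\<^sup>2 + 2 * (L2_norm S h)\<^sup>2"
proof -
  have p: "(norm (g x + h x))\<^sup>2 \<le> 2 * (norm (g x))\<^sup>2 + 2 * (norm (h x))\<^sup>2" for x
  proof -
    have "(norm (g x + h x))\<^sup>2 \<le> (norm (g x) + norm (h x))\<^sup>2"
      by (intro power_mono norm_triangle_ineq) auto
    also have "\<dots> \<le> 2 * (norm (g x))\<^sup>2 + 2 * (norm (h x))\<^sup>2"
      using sum_squares_bound[of "norm (g x)" "norm (h x)"] by (simp add: power2_sum)
    finally show ?thesis .
  qed
  have "(L2_norm S (\<lambda>x. g x + h x))\<^sup>2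
      \<le> (LINT x|lebesgue_on S. 2 * (norm (g x))\<^sup>2 + 2 * (norm (h x))\<^sup>2)"
    unfolding L2_norm_square
    using assms L2_add[OF assms] p by (intro integral_mono) (auto simp: L2_def)
  also have "\<dots> = 2 * (L2_norm S g)\<^sup>2 + 2 * (L2_norm S h)\<^sup>2"
    unfolding L2_norm_square using assms by (simp add: L2_def)
  finally show ?thesis .
qed

text \<open>The square of the difference of \<open>norm g\<close> and its mean value has a nonnegative integral.\<close>

lemma L2_Cauchy_Schwarz_1:
  assumes S: "S \<in> lmeasurable" and g: "g \<in> L2 S"
  shows "integrable (lebesgue_on S) (\<lambda>x. norm (g x))"
    and "(LINT x|lebesgue_on S. norm (g x))\<^sup>2 \<le> measure lebesgue S * (L2_norm S g)\<^sup>2"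
proof -
  interpret finite_measure "lebesgue_on S" using S by (rule finite_measure_lebesgue_on)
  have S': "S \<in> sets lebesgue" using S by auto
  have m: "measure (lebesgue_on S) (space (lebesgue_on S)) = measure lebesgue S"
    using S' by (simp add: measure_restrict_space)
  have "(\<lambda>_. 1::real) \<in> L2 S" using S by (intro L2_bounded[of _ _ 1]) auto
  moreover have "(\<lambda>x. norm (g x)) \<in> L2 S" using g by (auto simp: L2_def)
  ultimately have i: "integrable (lebesgue_on S) (\<lambda>x. norm (g x))"
    using L2_integrable_inner by fastforce
  show "integrable (lebesgue_on S) (\<lambda>x. norm (g x))" by (rule i)
  define I where "I = (LINT x|lebesgue_on S. norm (g x))"
  define \<mu> where "\<mu> = measure lebesgue S"
  have "0 \<le> (LINT x|lebesgue_on S. (\<mu> * norm (g x) - I)\<^sup>2)"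
    by (intro Bochner_Integration.integral_nonneg) auto
  also have "(\<lambda>x. (\<mu> * norm (g x) - I)\<^sup>2) = (\<lambda>x. \<mu>\<^sup>2 * (norm (g x))\<^sup>2 - 2 * \<mu> * I * norm (g x) + I\<^sup>2)"
    by (auto simp: power2_eq_square algebra_simps)
  also have "(LINT x|lebesgue_on S. \<mu>\<^sup>2 * (norm (g x))\<^sup>2 - 2 * \<mu> * I * norm (g x) + I\<^sup>2)
      = \<mu>\<^sup>2 * (L2_norm S g)\<^sup>2 - 2 * \<mu> * I * I + \<mu> * I\<^sup>2"
    using i L2_square_integrable[OF g] m unfolding L2_norm_square
    by (simp add: I_def[symmetric] \<mu>_def[symmetric])
  finally have 1: "0 \<le> \<mu> * (\<mu> * (L2_norm S g)\<^sup>2 - I\<^sup>2)"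
    by (simp add: power2_eq_square algebra_simps)
  show "(LINT x|lebesgue_on S. norm (g x))\<^sup>2 \<le> measure lebesgue S * (L2_norm S g)\<^sup>2"
  \<comment> \<open>The deviation from the mean was multiplied by \<open>\<mu>\<close> to avoid a
    quotient; only now the inequality has to be divided by \<open>\<mu>\<close>.\<close>
  proof (cases "\<mu> = 0")
    case True
    then have "S \<in> null_sets lebesgue"
      using S negligible_iff_measure[of S] by (simp add: \<mu>_def negligible_iff_null_sets)
    then show ?thesis by (simp add: integral_eq_zero_null_sets)
  next
    case False
    then have "\<mu> > 0" by (simp add: \<mu>_def zero_less_measure_iff)
    then show ?thesis using 1 by (simp add: zero_le_mult_iff I_def \<mu>_def)
  qed
qed

text \<open>Translations and image measures are handled over \<open>lborel\<close>, the function
  spaces over \<open>lebesgue_on\<close>; a Borel function vanishing off S can be moved between the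
  two.\<close>

lemma lebesgue_on_eq_lborel:
  fixes f :: "'a::euclidean_space \<Rightarrow> real"
  assumes "f \<in> borel_measurable borel" "S \<in> sets lebesgue" "\<And>x. x \<notin> S \<Longrightarrow> f x = 0"
  shows "(LINT x|lebesgue_on S. f x) = (LINT x|lborel. f x)"
    and "integrable (lebesgue_on S) f \<longleftrightarrow> integrable lborel f"
proof -
  have f: "(\<lambda>x. if x \<in> S then f x else 0) = f" using assms(3) by auto
  show "(LINT x|lebesgue_on S. f x) = (LINT x|lborel. f x)"
    using Lebesgue_Measure.integral_restrict_UNIV[OF assms(2), of f] assms(1) unfolding f by (simp add: integral_completion)
  show "integrable (lebesgue_on S) f \<longleftrightarrow> integrable lborel f"
    using Lebesgue_Measure.integrable_restrict_UNIV[OF assms(2), of f] assms(1) unfolding f by (simp add: integrable_completion)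
qed

lemma lebesgue_on_eq_lebesgue_on:
  fixes f :: "'a::euclidean_space \<Rightarrow> real"
  assumes "S \<in> sets lebesgue" "T \<in> sets lebesgue" "S \<subseteq> T" "\<And>x. x \<in> T - S \<Longrightarrow> f x = 0"
  shows "(LINT x|lebesgue_on S. f x) = (LINT x|lebesgue_on T. f x)"
proof -
  have "(LINT x|lebesgue_on S. f x) = (LINT x|lebesgue_on T. (if x \<in> S then f x else 0))"
    using assms by (simp add: integral_restrict)
  also have "\<dots> = (LINT x|lebesgue_on T. f x)"
    using assms(4) by (intro Bochner_Integration.integral_cong) auto
  finally show ?thesis .
qed

section \<open>Weak gradients\<close>

text \<open>Both sides are limits of \<open>\<integral>g(x)(\<phi>(x+t\<tau>)-\<phi>(x))/t dx = \<integral>(g(x-t\<tau>)-g(x))/t \<phi>(x) dx\<close>.\<close>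

lemma integral_by_parts_difference_quotient:
  fixes g \<phi> G \<Phi> :: "'a::euclidean_space \<Rightarrow> real" and \<tau> :: 'a
  assumes g[measurable]: "g \<in> borel_measurable borel" and gB: "\<And>x. \<bar>g x\<bar> \<le> B"
    and gL: "\<And>x t. \<bar>g (x + t *\<^sub>R \<tau>) - g x\<bar> \<le> L * \<bar>t\<bar>"
    and G[measurable]: "G \<in> borel_measurable borel"
    and gD: "AE x in lborel. ((\<lambda>t. (g (x + t *\<^sub>R \<tau>) - g x) / t) \<longlongrightarrow> G x) (at 0)"
    and p[measurable]: "\<phi> \<in> borel_measurable borel" and pB: "\<And>x. \<bar>\<phi> x\<bar> \<le> A"
    and pR: "\<And>x. x \<notin> cball 0 R \<Longrightarrow> \<phi> x = 0"
    and pL: "\<And>x t. \<bar>\<phi> (x + t *\<^sub>R \<tau>) - \<phi> x\<bar> \<le> M * \<bar>t\<bar>"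
    and P[measurable]: "\<Phi> \<in> borel_measurable borel"
    and pD: "\<And>x. ((\<lambda>t. (\<phi> (x + t *\<^sub>R \<tau>) - \<phi> x) / t) \<longlongrightarrow> \<Phi> x) (at 0)"
  shows "(LINT x|lborel. g x * \<Phi> x) = - (LINT x|lborel. G x * \<phi> x)"
proof -
  define t where "t n = 1 / real (Suc n)" for n
  have t: "t n > 0" "t n \<le> 1" for n by (auto simp: t_def)
  have tl: "t \<longlonglongrightarrow> 0"
    unfolding t_def[abs_def] by (rule LIMSEQ_Suc[OF lim_const_over_n])
  have tn: "t n \<noteq> 0" for n using t(1)[of n] by simp
  have t0: "filterlim t (at 0) sequentially"
    unfolding filterlim_at using tl tn by simp
  have t1: "filterlim (\<lambda>n. - t n) (at 0) sequentially"
    unfolding filterlim_at using tendsto_minus[OF tl] tn by simp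
  \<comment> \<open>The steps \<open>t n\<close> are at most 1, so all shifted copies of \<phi> are
    supported in this one ball, which carries the dominating functions.\<close>
  define Q where "Q = cball (0::'a) (R + norm \<tau>)"
  have Qi: "integrable lborel (\<lambda>x. c * indicator Q x)" for c :: real
    using emeasure_lborel_cball_finite[of "0::'a" "R + norm \<tau>"]
    by (intro integrable_mult_right integrable_real_indicator) (auto simp: Q_def)
  have Q0: "\<phi> x = 0" if "x \<notin> Q" for x
    by (rule pR) (use that norm_ge_zero[of \<tau>] in \<open>simp add: Q_def not_le, linarith\<close>)
  have Q1: "\<phi> (x + t n *\<^sub>R \<tau>) = 0" if "x \<notin> Q" for x n
  proof (rule pR)
    have "norm x \<le> norm (x + t n *\<^sub>R \<tau>) + norm (t n *\<^sub>R \<tau>)"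
      using norm_triangle_ineq4[of "x + t n *\<^sub>R \<tau>" "t n *\<^sub>R \<tau>"] by simp
    moreover have "norm (t n *\<^sub>R \<tau>) \<le> norm \<tau>" using t[of n] by (simp add: mult_left_le_one_le)
    ultimately show "x + t n *\<^sub>R \<tau> \<notin> cball 0 R" using that by (auto simp: Q_def)
  qed
  have mm: "\<bar>a * b\<bar> \<le> C * D" if "\<bar>a\<bar> \<le> C" "\<bar>b\<bar> \<le> D" for a b C D :: real
    unfolding abs_mult using that by (intro mult_mono) auto
  define s where "s n x = g x * ((\<phi> (x + t n *\<^sub>R \<tau>) - \<phi> x) / t n)" for n x
  \<comment> \<open>Backward quotients: a translation of the integral moves the shift from \<phi> to
    g with the opposite sign.\<close>
  define r where "r n x = (g (x + (- t n) *\<^sub>R \<tau>) - g x) / (- t n) * \<phi> x" for n x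
  have sL: "(\<lambda>n. integral\<^sup>L lborel (s n)) \<longlonglongrightarrow> (LINT x|lborel. g x * \<Phi> x)"
  proof (rule integral_dominated_convergence[OF _ _ Qi[of "B * M"]])
    show "AE x in lborel. (\<lambda>n. s n x) \<longlonglongrightarrow> g x * \<Phi> x"
      unfolding s_def by (intro always_eventually allI tendsto_intros filterlim_compose[OF pD t0])
    have "norm (s n x) \<le> B * M * indicator Q x" for n x
    proof (cases "x \<in> Q")
      case True
      have "\<bar>(\<phi> (x + t n *\<^sub>R \<tau>) - \<phi> x) / t n\<bar> \<le> M"
        using pL[of x "t n"] t(1)[of n] by (simp add: abs_divide pos_divide_le_eq)
      from mm[OF gB[of x] this] show ?thesis
        using True by (simp only: s_def indicator_simps real_norm_def mult_1_right)
    qed (simp add: s_def Q0 Q1)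
    then show "AE x in lborel. norm (s n x) \<le> B * M * indicator Q x" for n by simp
  qed (unfold s_def, measurable)
  have rL: "(\<lambda>n. integral\<^sup>L lborel (r n)) \<longlonglongrightarrow> (LINT x|lborel. G x * \<phi> x)"
  proof (rule integral_dominated_convergence[OF _ _ Qi[of "L * A"]])
    show "AE x in lborel. (\<lambda>n. r n x) \<longlonglongrightarrow> G x * \<phi> x"
      using gD unfolding r_def
      by eventually_elim (intro tendsto_intros filterlim_compose[OF _ t1])
    have "norm (r n x) \<le> L * A * indicator Q x" for n x
    proof (cases "x \<in> Q")
      case True
      have "\<bar>(g (x + (- t n) *\<^sub>R \<tau>) - g x) / (- t n)\<bar> \<le> L"
        using gL[of x "- t n"] t(1)[of n] by (simp add: abs_divide pos_divide_le_eq)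
      from mm[OF this pB[of x]] show ?thesis
        using True by (simp only: r_def indicator_simps real_norm_def mult_1_right)
    qed (simp add: r_def Q0)
    then show "AE x in lborel. norm (r n x) \<le> L * A * indicator Q x" for n by simp
  qed (unfold r_def, measurable)
  have "integral\<^sup>L lborel (s n) = - integral\<^sup>L lborel (r n)" for n
  proof -
    have bi: "integrable lborel f" if "f \<in> borel_measurable borel" "\<And>x. \<bar>f x\<bar> \<le> C" "\<And>x. x \<notin> Q \<Longrightarrow> f x = 0"
      for f :: "'a \<Rightarrow> real" and C
      by (rule Bochner_Integration.integrable_bound[OF Qi[of C]])
         (use that in \<open>auto intro!: always_eventually simp: indicator_def dest: order_trans[OF _ abs_ge_self]\<close>)
    have i1: "integrable lborel (\<lambda>x. g x * \<phi> (x + t n *\<^sub>R \<tau>))"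
      by (rule bi[of _ "B * A"]) (use mm gB pB Q1 in auto)
    have i2: "integrable lborel (\<lambda>x. g x * \<phi> x)"
      by (rule bi[of _ "B * A"]) (use mm gB pB Q0 in auto)
    have i3: "integrable lborel (\<lambda>x. g (x + (- t n) *\<^sub>R \<tau>) * \<phi> x)"
      by (rule bi[of _ "B * A"]) (use mm gB pB Q0 in auto)
    have "(LINT x|lborel. g (x + (- t n) *\<^sub>R \<tau>) * \<phi> x)
        = (LINT x|distr lborel borel ((+) (t n *\<^sub>R \<tau>)). g (x + (- t n) *\<^sub>R \<tau>) * \<phi> x)"
      by (simp only: lborel_distr_plus)
    also have "\<dots> = (LINT x|lborel. g x * \<phi> (x + t n *\<^sub>R \<tau>))"
      by (subst integral_distr) (auto simp: add.commute)
    finally have sh: "(LINT x|lborel. g (x + (- t n) *\<^sub>R \<tau>) * \<phi> x) = (LINT x|lborel. g x * \<phi> (x + t n *\<^sub>R \<tau>))" .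
    have "integral\<^sup>L lborel (s n) = (LINT x|lborel. (1 / t n) * (g x * \<phi> (x + t n *\<^sub>R \<tau>) - g x * \<phi> x))"
      by (intro Bochner_Integration.integral_cong) (auto simp: s_def right_diff_distrib diff_divide_distrib)
    also have "\<dots> = (1 / t n) * ((LINT x|lborel. g x * \<phi> (x + t n *\<^sub>R \<tau>)) - (LINT x|lborel. g x * \<phi> x))"
      using i1 i2 by (subst integral_mult_right_zero) simp
    also have "\<dots> = (1 / t n) * ((LINT x|lborel. g (x + (- t n) *\<^sub>R \<tau>) * \<phi> x) - (LINT x|lborel. g x * \<phi> x))"
      by (simp only: sh)
    also have "\<dots> = (LINT x|lborel. (1 / t n) * (g (x + (- t n) *\<^sub>R \<tau>) * \<phi> x - g x * \<phi> x))"
      using i2 i3 by (subst integral_mult_right_zero) simp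
    also have "\<dots> = (LINT x|lborel. - r n x)"
    proof (intro Bochner_Integration.integral_cong refl)
      have "(1 / c) * (a * b - d * b) = - ((a - d) / (- c) * b)" for a b c d :: real
        by (cases "c = 0") (auto simp: divide_simps left_diff_distrib)
      then show "(1 / t n) * (g (x + (- t n) *\<^sub>R \<tau>) * \<phi> x - g x * \<phi> x) = - r n x" for x
        unfolding r_def by blast
    qed
    finally show ?thesis by simp
  qed
  then have "(\<lambda>n. - integral\<^sup>L lborel (r n)) \<longlonglongrightarrow> (LINT x|lborel. g x * \<Phi> x)" using sL by simp
  then show ?thesis using tendsto_minus[OF rL] LIMSEQ_unique by blast
qed

lemma differentiable_difference_quotient:
  fixes f :: "'a::real_normed_vector \<Rightarrow> real"
  assumes "(f has_derivative f') (at x)"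
  shows "((\<lambda>t. (f (x + t *\<^sub>R \<tau>) - f x) / t) \<longlongrightarrow> f' \<tau>) (at 0)"
proof -
  interpret bounded_linear f' using assms by (rule has_derivative_bounded_linear)
  have "((\<lambda>t. x + t *\<^sub>R \<tau>) has_derivative (\<lambda>t. t *\<^sub>R \<tau>)) (at 0)"
    by (auto intro!: derivative_eq_intros)
  from has_derivative_compose[OF this] assms
  have "((\<lambda>t. f (x + t *\<^sub>R \<tau>)) has_derivative (\<lambda>t. f' (t *\<^sub>R \<tau>))) (at 0)" by simp
  then have "((\<lambda>t. f (x + t *\<^sub>R \<tau>)) has_real_derivative f' \<tau>) (at 0)"
    by (simp add: has_field_derivative_def scaleR mult.commute[of _ "f' \<tau>"] mult_commute_abs)
  then show ?thesis unfolding has_field_derivative_iff by simp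
qed

text \<open>The bounds hold on the whole space, since integration by parts is carried out there. The
  derivative vanishes off the compact set K because the complement of K is open.\<close>

lemma test_function_properties:
  fixes \<phi> :: "'a::euclidean_space \<Rightarrow> real"
  assumes "\<phi> \<in> test_functions S"
  obtains A M R where "continuous_on UNIV \<phi>" "\<And>x. \<bar>\<phi> x\<bar> \<le> A" "\<And>x. x \<notin> cball 0 R \<Longrightarrow> \<phi> x = 0"
    "\<And>x. x \<notin> S \<Longrightarrow> \<phi> x = 0" "\<And>x. x \<notin> S \<Longrightarrow> frechet_derivative \<phi> (at x) \<tau> = 0"
    "\<And>x t. \<bar>\<phi> (x + t *\<^sub>R \<tau>) - \<phi> x\<bar> \<le> M * \<bar>t\<bar>"
    "continuous_on UNIV (\<lambda>x. frechet_derivative \<phi> (at x) \<tau>)"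
    "\<And>x. ((\<lambda>t. (\<phi> (x + t *\<^sub>R \<tau>) - \<phi> x) / t) \<longlongrightarrow> frechet_derivative \<phi> (at x) \<tau>) (at 0)"
    "\<And>x. \<bar>frechet_derivative \<phi> (at x) \<tau>\<bar> \<le> M"
proof -
  have tc: "times_cont_diff k \<phi>" for k using assms by (simp add: test_functions_def)
  obtain K where K: "compact K" "K \<subseteq> S" "\<And>x. x \<notin> K \<Longrightarrow> \<phi> x = 0"
    using assms by (auto simp: test_functions_def)
  have d: "(\<phi> has_derivative frechet_derivative \<phi> (at x)) (at x)" for x
    using tc[of 1] by (simp flip: frechet_derivative_works)
  have c: "continuous_on UNIV \<phi>" using tc[of 0] by simp
  have cd: "continuous_on UNIV (\<lambda>x. frechet_derivative \<phi> (at x) \<tau>)" using tc[of 1] by simp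
  have d0: "frechet_derivative \<phi> (at x) \<tau> = 0" if "x \<notin> K" for x
  proof -
    have "open (- K)" using K(1) by (simp add: compact_imp_closed open_Compl)
    have "((\<lambda>_. 0) has_derivative (\<lambda>_. 0)) (at x)" by simp
    then have "(\<phi> has_derivative (\<lambda>_. 0)) (at x)"
      by (rule has_derivative_transform_within_open[OF _ \<open>open (- K)\<close>]) (use that K(3) in auto)
    then show ?thesis using frechet_derivative_at by metis
  qed
  obtain A where A: "\<And>x. \<bar>\<phi> x\<bar> \<le> A"
  proof -
    have "compact (\<phi> ` K)" by (rule compact_continuous_image[OF continuous_on_subset[OF c] K(1)]) simp
    then obtain a where "\<forall>x\<in>K. norm (\<phi> x) \<le> a" by (metis bounded_iff compact_imp_bounded imageI)
    then have "\<bar>\<phi> x\<bar> \<le> max a 0" for x using K(3)[of x] by (cases "x \<in> K") fastforce+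
    then show thesis by (rule that)
  qed
  obtain M where M: "\<And>x. \<bar>frechet_derivative \<phi> (at x) \<tau>\<bar> \<le> M"
  proof -
    have "compact ((\<lambda>x. frechet_derivative \<phi> (at x) \<tau>) ` K)"
      by (rule compact_continuous_image[OF continuous_on_subset[OF cd] K(1)]) simp
    then obtain a where "\<forall>x\<in>K. norm (frechet_derivative \<phi> (at x) \<tau>) \<le> a"
      by (metis (no_types, lifting) bounded_iff compact_imp_bounded imageI)
    then have "\<bar>frechet_derivative \<phi> (at x) \<tau>\<bar> \<le> max a 0" for x
      using d0[of x] by (cases "x \<in> K") fastforce+
    then show thesis by (rule that)
  qed
  have lip: "\<bar>\<phi> (x + t *\<^sub>R \<tau>) - \<phi> x\<bar> \<le> M * \<bar>t\<bar>" for x t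
  proof -
    have "((\<lambda>t. \<phi> (x + t *\<^sub>R \<tau>)) has_field_derivative frechet_derivative \<phi> (at (x + s *\<^sub>R \<tau>)) \<tau>) (at s)" for s
    proof -
      interpret bounded_linear "frechet_derivative \<phi> (at (x + s *\<^sub>R \<tau>))"
        using d by (rule has_derivative_bounded_linear)
      have "((\<lambda>t. x + t *\<^sub>R \<tau>) has_derivative (\<lambda>t. t *\<^sub>R \<tau>)) (at s)"
        by (auto intro!: derivative_eq_intros)
      from has_derivative_compose[OF this d] show ?thesis
        by (simp add: has_field_derivative_def scaleR mult_commute_abs)
    qed
    then have "norm (\<phi> (x + t *\<^sub>R \<tau>) - \<phi> (x + 0 *\<^sub>R \<tau>)) \<le> M * norm (t - 0)"
      by (intro field_differentiable_bound[of UNIV _ "\<lambda>s. frechet_derivative \<phi> (at (x + s *\<^sub>R \<tau>)) \<tau>"])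
         (use M in auto)
    then show ?thesis by simp
  qed
  obtain R where R: "K \<subseteq> cball 0 R"
    using compact_imp_bounded[OF K(1)] by (auto simp: bounded_iff subset_eq)
  show thesis
  proof (rule that)
    show "\<phi> x = 0" if "x \<notin> cball 0 R" for x using that R K(3) by blast
    show "frechet_derivative \<phi> (at x) \<tau> = 0" if "x \<notin> S" for x using that K(2) d0 by blast
    show "\<phi> x = 0" if "x \<notin> S" for x using that K by blast
  qed (fact c A lip cd M differentiable_difference_quotient[OF d])+
qed

text \<open>For a Lipschitz function on the whole space differentiability off a null set suffices,
  because the difference quotients are bounded. Test functions vanish off S, which moves the
  integrals from S to the whole space.\<close>

lemma weak_gradientI:
  fixes g :: "'a::euclidean_space \<Rightarrow> real"
  assumes S: "S \<in> sets lebesgue"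
    and g: "g \<in> borel_measurable borel" "\<And>x. \<bar>g x\<bar> \<le> B" "\<And>x \<tau> t. \<bar>g (x + t *\<^sub>R \<tau>) - g x\<bar> \<le> L \<tau> * \<bar>t\<bar>"
    and G: "G \<in> borel_measurable borel" "negligible N"
    and D: "\<And>x \<tau>. x \<notin> N \<Longrightarrow> ((\<lambda>t. (g (x + t *\<^sub>R \<tau>) - g x) / t) \<longlongrightarrow> G x \<bullet> \<tau>) (at 0)"
  shows "is_weak_gradient S g G"
  unfolding is_weak_gradient_def
proof (intro ballI)
  fix \<phi> and i :: 'a assume p: "\<phi> \<in> test_functions S"
  obtain A M R where P: "continuous_on UNIV \<phi>" "\<And>x. \<bar>\<phi> x\<bar> \<le> A" "\<And>x. x \<notin> cball 0 R \<Longrightarrow> \<phi> x = 0"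
    "\<And>x. x \<notin> S \<Longrightarrow> \<phi> x = 0" "\<And>x. x \<notin> S \<Longrightarrow> frechet_derivative \<phi> (at x) i = 0"
    "\<And>x t. \<bar>\<phi> (x + t *\<^sub>R i) - \<phi> x\<bar> \<le> M * \<bar>t\<bar>"
    "continuous_on UNIV (\<lambda>x. frechet_derivative \<phi> (at x) i)"
    "\<And>x. ((\<lambda>t. (\<phi> (x + t *\<^sub>R i) - \<phi> x) / t) \<longlongrightarrow> frechet_derivative \<phi> (at x) i) (at 0)"
    "\<And>x. \<bar>frechet_derivative \<phi> (at x) i\<bar> \<le> M"
    by (rule test_function_properties[OF p, of i]) (rule that)
  have m: "\<phi> \<in> borel_measurable borel" "(\<lambda>x. frechet_derivative \<phi> (at x) i) \<in> borel_measurable borel"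
    using P(1,7) by (auto intro: borel_measurable_continuous_onI)
  have "AE x in lborel. x \<notin> N"
    using G(2) AE_not_in[of N lebesgue] by (simp add: negligible_iff_null_sets AE_completion_iff)
  then have ae: "AE x in lborel. ((\<lambda>t. (g (x + t *\<^sub>R i) - g x) / t) \<longlongrightarrow> G x \<bullet> i) (at 0)"
    by eventually_elim (rule D)
  have "(LINT x|lborel. g x * frechet_derivative \<phi> (at x) i) = - (LINT x|lborel. (G x \<bullet> i) * \<phi> x)"
    by (rule integral_by_parts_difference_quotient[OF g(1,2) g(3) _ ae m(1) P(2,3,6) m(2) P(8)])
       (use G(1) in measurable)
  moreover have "(LINT x|lebesgue_on S. g x * frechet_derivative \<phi> (at x) i)
      = (LINT x|lborel. g x * frechet_derivative \<phi> (at x) i)"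
    by (rule lebesgue_on_eq_lborel(1)[OF _ S]) (use g(1) m P(5) in auto)
  moreover have "(LINT x|lebesgue_on S. (G x \<bullet> i) * \<phi> x) = (LINT x|lborel. (G x \<bullet> i) * \<phi> x)"
    by (rule lebesgue_on_eq_lborel(1)[OF _ S]) (use G(1) m P(4) in auto)
  ultimately show "(LINT x|lebesgue_on S. g x * frechet_derivative \<phi> (at x) i)
      = - (LINT x|lebesgue_on S. (G x \<bullet> i) * \<phi> x)" by simp
qed

lemma test_function_lipschitz:
  assumes "\<phi> \<in> test_functions S"
  shows "\<exists>M. \<forall>x t. \<bar>\<phi> (x + t *\<^sub>R \<tau>) - \<phi> x\<bar> \<le> M * \<bar>t\<bar>"
  by (rule test_function_properties[OF assms, of \<tau>]) blast

lemma test_function_bounded_support: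
  assumes "\<phi> \<in> test_functions S"
  shows "\<exists>A R. (\<forall>x. \<bar>\<phi> x\<bar> \<le> A) \<and> (\<forall>x. x \<notin> cball 0 R \<longrightarrow> \<phi> x = 0)"
  by (rule test_function_properties[OF assms]) blast

lemma test_function_borel: "\<phi> \<in> test_functions S \<Longrightarrow> \<phi> \<in> borel_measurable borel"
  using times_cont_diff.simps(1)[of \<phi>] by (auto simp: test_functions_def intro: borel_measurable_continuous_onI)

lemma bump_weak_gradient:
  assumes "r > 0" "S \<in> sets lebesgue"
  shows "is_weak_gradient S (bump x0 r) (bump_grad x0 r)"
proof -
  obtain L where L: "\<And>\<tau> x t. \<bar>bump x0 r (x + t *\<^sub>R \<tau>) - bump x0 r x\<bar> \<le> L \<tau> * \<bar>t\<bar>"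
  proof -
    have "\<forall>\<tau>. \<exists>M. \<forall>x t. \<bar>bump x0 r (x + t *\<^sub>R \<tau>) - bump x0 r x\<bar> \<le> M * \<bar>t\<bar>"
      using test_function_lipschitz[OF bump_test_function[OF assms(1) subset_UNIV]] by blast
    from choice[OF this] show thesis using that by blast
  qed
  show ?thesis
  proof (rule weak_gradientI[where B = 1 and L = L and N = "{}"])
    show "\<bar>bump x0 r x\<bar> \<le> 1" for x using bump_nonneg[of x0 r x] bump_le_1[of x0 r x] by simp
    show "bump x0 r \<in> borel_measurable borel" "bump_grad x0 r \<in> borel_measurable borel"
      by (auto intro: borel_measurable_continuous_onI continuous_on_bump continuous_on_bump_grad)
  qed (use assms L differentiable_difference_quotient[OF bump_has_derivative] in auto)
qed

text \<open>The difference quotients of H along \<tau> vanish, so integration by parts leaves 0.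
  With H = 1 this removes constant gradients, with the indicator of a half space it removes the
  tangential part of a gradient difference.\<close>

lemma integral_bump_grad_translation_invariant:
  assumes r: "r > 0" and H: "H \<in> borel_measurable borel" "\<And>x. \<bar>H x\<bar> \<le> B"
    and inv: "\<And>x t. H (x + t *\<^sub>R \<tau>) = H x"
  shows "(LINT x|lborel. H x * (bump_grad x0 r x \<bullet> \<tau>)) = 0"
proof -
  have t: "bump x0 r \<in> test_functions UNIV" by (rule bump_test_function[OF r subset_UNIV])
  obtain M where M: "\<And>x t. \<bar>bump x0 r (x + t *\<^sub>R \<tau>) - bump x0 r x\<bar> \<le> M * \<bar>t\<bar>"
    using test_function_lipschitz[OF t] by blast
  obtain A R where A: "\<And>x. \<bar>bump x0 r x\<bar> \<le> A" and R: "\<And>x. x \<notin> cball 0 R \<Longrightarrow> bump x0 r x = 0"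
    using test_function_bounded_support[OF t] by blast
  have m: "bump x0 r \<in> borel_measurable borel" "(\<lambda>x. bump_grad x0 r x \<bullet> \<tau>) \<in> borel_measurable borel"
    by (auto intro!: borel_measurable_continuous_onI continuous_on_bump continuous_on_bump_grad
        continuous_on_inner continuous_on_const)
  have "(LINT x|lborel. H x * (bump_grad x0 r x \<bullet> \<tau>)) = - (LINT x|lborel. 0 * bump x0 r x)"
    by (rule integral_by_parts_difference_quotient[OF H, where \<tau> = \<tau> and L = 0, OF _ _ _ m(1) A R M m(2)])
       (use inv differentiable_difference_quotient[OF bump_has_derivative] in auto)
  then show ?thesis by simp
qed

text \<open>The indicator functions of boxes are bounded limits of test functions, and boxes generate the
  Borel sets.\<close>

lemma test_functions_separate:
  fixes H :: "'a::euclidean_space \<Rightarrow> real"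
  assumes S: "open S" and H: "integrable (lebesgue_on S) H"
    and 0: "\<And>\<phi>. \<phi> \<in> test_functions S \<Longrightarrow> (LINT x|lebesgue_on S. H x * \<phi> x) = 0"
  shows "AE x in lebesgue_on S. H x = 0"
proof -
  have S': "S \<in> sets lebesgue" using S by auto
  define Hz where "Hz x = (if x \<in> S then H x else 0)" for x
  have Hz: "integrable lebesgue Hz"
    unfolding Hz_def using H S' by (simp add: Lebesgue_Measure.integrable_restrict_UNIV)
  \<comment> \<open>Boxes generate the Borel sets only, so the extension of H by zero is replaced by
    a Borel representative.\<close>
  obtain h where h[measurable]: "h \<in> borel_measurable borel" and hH: "AE x in lborel. Hz x = h x"
    using completion_ex_borel_measurable_real[OF borel_measurable_integrable[OF Hz]] by auto
  have h'[measurable]: "h \<in> borel_measurable lborel" using h by simp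
  have hH': "AE x in lebesgue. Hz x = h x" using hH by (simp add: AE_completion_iff)
  have hi: "integrable lborel h"
  proof -
    have "h \<in> borel_measurable lebesgue" using h by (simp add: measurable_completion)
    then have "integrable lebesgue h" using integrable_cong_AE[OF _ _ hH'] Hz by auto
    then show ?thesis by (simp add: integrable_completion)
  qed
  have b0: "(LINT x|lborel. indicator (box a b) x * h x) = 0" if ab: "cbox a b \<subseteq> S" for a b
  proof (cases "box a b = {}")
    case False
    have z: "(LINT x|lborel. box_bump n a b x * h x) = 0" for n
    proof -
      have t: "box_bump n a b \<in> test_functions S" by (rule box_bump_test_function[OF False ab])
      have c: "box_bump n a b \<in> borel_measurable borel"
        by (rule test_function_borel[OF t])
      have "(LINT x|lborel. box_bump n a b x * h x) = (LINT x|lebesgue. box_bump n a b x * h x)"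
        using c h by (intro integral_completion[symmetric]) simp
      also have "\<dots> = (LINT x|lebesgue. Hz x * box_bump n a b x)"
      proof (rule integral_cong_AE)
        show "(\<lambda>x. box_bump n a b x * h x) \<in> borel_measurable lebesgue"
          using c h by (intro borel_measurable_times measurable_completion) auto
        show "(\<lambda>x. Hz x * box_bump n a b x) \<in> borel_measurable lebesgue"
          using c borel_measurable_integrable[OF Hz]
          by (intro borel_measurable_times) (auto intro: measurable_completion)
        show "AE x in lebesgue. box_bump n a b x * h x = Hz x * box_bump n a b x"
          using hH' by eventually_elim simp
      qed
      also have "\<dots> = (LINT x|lebesgue. (if x \<in> S then H x * box_bump n a b x else 0))"
        by (intro Bochner_Integration.integral_cong) (auto simp: Hz_def)
      also have "\<dots> = (LINT x|lebesgue_on S. H x * box_bump n a b x)"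
        using S' by (simp add: Lebesgue_Measure.integral_restrict_UNIV)
      finally show ?thesis using 0[OF t] by simp
    qed
    have "(\<lambda>n. LINT x|lborel. box_bump n a b x * h x) \<longlonglongrightarrow> (LINT x|lborel. indicator (box a b) x * h x)"
    proof (rule integral_dominated_convergence[where w = "\<lambda>x. \<bar>h x\<bar>"])
      show "AE x in lborel. (\<lambda>n. box_bump n a b x * h x) \<longlonglongrightarrow> indicator (box a b) x * h x"
        by (intro always_eventually allI tendsto_mult box_bump_tendsto[OF False] tendsto_const)
      show "(\<lambda>x. box_bump n a b x * h x) \<in> borel_measurable lborel" for n
      proof -
        have [measurable]: "box_bump n a b \<in> borel_measurable borel"
          by (rule test_function_borel[OF box_bump_test_function[OF False ab]])
        have "(\<lambda>x. box_bump n a b x * h x) \<in> borel_measurable borel" by measurable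
        then show ?thesis by simp
      qed
      show "AE x in lborel. norm (box_bump n a b x * h x) \<le> \<bar>h x\<bar>" for n
        by (auto simp: abs_mult box_bump_nonneg box_bump_le_1 intro!: mult_left_le_one_le)
    qed (use hi in auto)
    then show ?thesis unfolding z using LIMSEQ_unique tendsto_const by metis
  qed simp
  have c0: "AE x in lborel. indicator (box c d) x * h x = 0" if cd: "cbox c d \<subseteq> S" for c d
  proof -
    \<comment> \<open>After cutting off by a box inside S, the integral over every box vanishes: its
      intersection with the fixed box is a box whose closure stays in S. Boxes are stable under
      intersection, so the claim extends to all Borel sets.\<close>
    define k where "k x = indicator (box c d) x * h x" for x
    have k: "integrable lborel k" 
      unfolding k_def real_scaleR_def[symmetric] using hi by (intro integrable_mult_indicator) auto
    have "set_lebesgue_integral lborel A k = 0" if "A \<in> sets borel" for A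
    proof -
      have "Int_stable (range (\<lambda>(a, b). box a b :: 'a set))"
        by (auto simp: Int_stable_def box_Int_box)
      moreover have "range (\<lambda>(a, b). box a b :: 'a set) \<subseteq> Pow UNIV" by simp
      moreover have "A \<in> sigma_sets UNIV (range (\<lambda>(a, b). box a b :: 'a set))"
        using that unfolding borel_eq_box by simp
      ultimately show ?thesis
      proof (induction rule: sigma_sets_induct_disjoint)
        case (basic A)
        then obtain p where "A = (\<lambda>(a, b). box a b) p" by (rule rangeE)
        then obtain a b where A: "A = box a b" by (cases p) simp
        obtain a' b' where ab: "box a b \<inter> box c d = box a' b'" unfolding box_Int_box by blast
        have "indicator A x *\<^sub>R k x = indicator (box a' b') x * h x" for x
          unfolding k_def A ab[symmetric] by (simp add: indicator_inter_arith)
        moreover have "(LINT x|lborel. indicator (box a' b') x * h x) = 0"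
        proof (cases "box a' b' = {}")
          case False
          have "box a' b' \<subseteq> cbox c d" using ab box_subset_cbox[of c d] by blast
          then have "closure (box a' b') \<subseteq> cbox c d" by (rule closure_minimal) (rule closed_cbox)
          then have "cbox a' b' \<subseteq> cbox c d" unfolding closure_box[OF False] .
          then show ?thesis using cd by (intro b0) auto
        qed simp
        ultimately show ?case unfolding set_lebesgue_integral_def by simp
      next
        case (compl A)
        have [measurable]: "A \<in> sets borel" using compl(1) unfolding borel_eq_box by simp
        have "set_lebesgue_integral lborel (UNIV - A) k = (LINT x|lborel. k x - indicator A x *\<^sub>R k x)"
          unfolding set_lebesgue_integral_def by (intro Bochner_Integration.integral_cong) (auto simp: indicator_def)
        also have "\<dots> = (LINT x|lborel. k x) - (LINT x|lborel. indicator A x *\<^sub>R k x)"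
          using k by (intro Bochner_Integration.integral_diff integrable_mult_indicator) auto
        also have "\<dots> = 0" using compl(2) b0[OF cd] by (simp add: set_lebesgue_integral_def k_def)
        finally show ?case .
      next
        case (union A)
        have Am: "A i \<in> sets lborel" for i using union(2) unfolding sets_lborel borel_eq_box by auto
        then have UA: "(\<Union>i. A i) \<in> sets lborel" by blast
        have "set_lebesgue_integral lborel (\<Union>i. A i) k = (\<Sum>i. set_lebesgue_integral lborel (A i) k)"
        proof (rule lebesgue_integral_countable_add)
          show "set_integrable lborel (\<Union>i. A i) k"
            unfolding set_integrable_def by (rule integrable_mult_indicator[OF UA k])
          show "A i \<inter> A j = {}" if "i \<noteq> j" for i j
            using union(1) that by (simp add: disjoint_family_on_def)
        qed (rule Am)
        then show ?case using union(3) by simp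
      qed (auto simp: set_lebesgue_integral_def)
    qed
    then have "AE x in lborel. k x = 0" using k by (intro density_unique_real[of lborel k "\<lambda>_. 0"]) (auto simp: set_lebesgue_integral_def)
    then show ?thesis by (simp add: k_def)
  qed
  obtain D where D: "countable D" "\<And>X. X \<in> D \<Longrightarrow> X \<subseteq> S" "\<And>X. X \<in> D \<Longrightarrow> \<exists>a b. X = cbox a b" "\<Union>D = S"
    using open_countable_Union_open_cbox[OF S] by (metis PowD in_mono)
  \<comment> \<open>The closed boxes in D cover S, their interiors only up to countably many
    frontiers, which form a null set.\<close>
  have "AE x in lborel. \<forall>X\<in>D. x \<notin> frontier X \<and> (x \<in> interior X \<longrightarrow> h x = 0)"
  proof (rule AE_ball_countable'[OF _ D(1)])
    fix X assume X: "X \<in> D"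
    obtain a b where ab: "X = cbox a b" using D(3)[OF X] by auto
    have "negligible (frontier X)" unfolding ab by (intro negligible_convex_frontier) simp
    then have "AE x in lborel. x \<notin> frontier X"
      using AE_not_in[of _ lebesgue] by (simp add: negligible_iff_null_sets AE_completion_iff)
    moreover have "AE x in lborel. indicator (box a b) x * h x = 0" using D(2)[OF X] ab by (intro c0) simp
    ultimately show "AE x in lborel. x \<notin> frontier X \<and> (x \<in> interior X \<longrightarrow> h x = 0)"
      by eventually_elim (auto simp: ab interior_cbox indicator_def)
  qed
  then have "AE x in lborel. x \<in> S \<longrightarrow> H x = 0"
    using hH
  proof eventually_elim
    case (elim x)
    show ?case
    proof
      assume "x \<in> S"
      then obtain X where "X \<in> D" "x \<in> X" using D(4) by auto
      then have "x \<in> interior X" using elim(1) closure_subset[of X] by (auto simp: frontier_def)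
      then show "H x = 0" using elim \<open>X \<in> D\<close> \<open>x \<in> S\<close> by (simp add: Hz_def)
    qed
  qed
  then show ?thesis using S' by (simp add: AE_restrict_space_iff AE_completion_iff)
qed


section \<open>Differences and uniqueness of weak gradients, and the tested error equation\<close>

lemma test_function_L2:
  assumes "\<phi> \<in> test_functions U" "S \<in> lmeasurable"
  shows "\<phi> \<in> L2 S" and "(\<lambda>x. frechet_derivative \<phi> (at x) v) \<in> L2 S"
proof -
  have m: "f \<in> borel_measurable (lebesgue_on S)" if "continuous_on UNIV f" for f :: "'a \<Rightarrow> real"
    using that assms(2) by (intro continuous_imp_measurable_on_sets_lebesgue)
      (auto intro: continuous_on_subset)
  show "\<phi> \<in> L2 S"
    by (rule test_function_properties[OF assms(1)], rule L2_bounded[OF assms(2) m]) auto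
  show "(\<lambda>x. frechet_derivative \<phi> (at x) v) \<in> L2 S"
    by (rule test_function_properties[OF assms(1), of v], rule L2_bounded[OF assms(2) m]) auto
qed

lemma weak_gradient_diff:
  assumes S: "S \<in> lmeasurable" and L: "g \<in> L2 S" "h \<in> L2 S" "G \<in> L2 S" "H \<in> L2 S"
    and w: "is_weak_gradient S g G" "is_weak_gradient S h H"
  shows "is_weak_gradient S (\<lambda>x. g x - h x) (\<lambda>x. G x - H x)"
  unfolding is_weak_gradient_def
proof (intro ballI)
  fix \<phi> and i :: 'a assume p: "\<phi> \<in> test_functions S" and i: "i \<in> Basis"
  note P = test_function_L2[OF p S]
  have 1: "integrable (lebesgue_on S) (\<lambda>x. f x * frechet_derivative \<phi> (at x) i)" if "f \<in> L2 S" for f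
    using L2_integrable_inner[OF that P(2)] by simp
  have 2: "integrable (lebesgue_on S) (\<lambda>x. (F x \<bullet> i) * \<phi> x)" if "F \<in> L2 S" for F :: "'a \<Rightarrow> 'a"
    using L2_integrable_inner[OF L2_inner_const[OF that] P(1)] by simp
  show "(LINT x|lebesgue_on S. (g x - h x) * frechet_derivative \<phi> (at x) i)
      = - (LINT x|lebesgue_on S. ((G x - H x) \<bullet> i) * \<phi> x)"
    using w p i 1[OF L(1)] 1[OF L(2)] 2[OF L(3)] 2[OF L(4)]
    by (simp add: is_weak_gradient_def left_diff_distrib inner_diff_left)
qed

lemma weak_gradient_unique:
  assumes S: "open S" "S \<in> lmeasurable" and L: "G \<in> L2 S" "H \<in> L2 S"
    and w: "is_weak_gradient S g G" "is_weak_gradient S g H"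
  shows "AE x in lebesgue_on S. G x = H x"
proof -
  have "AE x in lebesgue_on S. (G x - H x) \<bullet> i = 0" if i: "i \<in> Basis" for i
  proof (rule test_functions_separate[OF S(1)])
    have L2: "(\<lambda>x. (F x) \<bullet> i) \<in> L2 S" if "F \<in> L2 S" for F :: "'a \<Rightarrow> 'a" by (rule L2_inner_const[OF that])
    have "(\<lambda>_. 1::real) \<in> L2 S" using S(2) by (intro L2_bounded[of _ _ 1]) auto
    from L2_integrable_inner[OF L2[OF L2_diff[OF L]] this]
    show "integrable (lebesgue_on S) (\<lambda>x. (G x - H x) \<bullet> i)" by simp
    fix \<phi> assume p: "\<phi> \<in> test_functions S"
    note P = test_function_L2(1)[OF p S(2)]
    have "integrable (lebesgue_on S) (\<lambda>x. (F x \<bullet> i) * \<phi> x)" if "F \<in> L2 S" for F :: "'a \<Rightarrow> 'a"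
      using L2_integrable_inner[OF L2[OF that] P] by simp
    from this[OF L(1)] this[OF L(2)] show "(LINT x|lebesgue_on S. ((G x - H x) \<bullet> i) * \<phi> x) = 0"
      using w p i by (auto simp: is_weak_gradient_def left_diff_distrib inner_diff_left)
  qed
  then have "AE x in lebesgue_on S. \<forall>i\<in>Basis. (G x - H x) \<bullet> i = 0"
    by (rule AE_ball_countable'[OF _ countable_finite[OF finite_Basis]])
  then show ?thesis
    by eventually_elim (rule euclidean_eqI, simp add: inner_diff_left)
qed

lemma wgrad_weak_gradient:
  assumes "G \<in> L2 S" "is_weak_gradient S g G"
  shows "wgrad S g \<in> L2 S" "is_weak_gradient S g (wgrad S g)"
  using someI[of "\<lambda>G. G \<in> L2 S \<and> is_weak_gradient S g G"] assms by (auto simp: wgrad_def)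

text \<open>\<open>wgrad\<close> is an arbitrary choice, so an explicit gradient can replace it only
  almost everywhere, which is enough under integrals.\<close>

lemma wgrad_AE:
  assumes "open S" "S \<in> lmeasurable" "G \<in> L2 S" "is_weak_gradient S g G"
  shows "AE x in lebesgue_on S. wgrad S g x = G x"
  using weak_gradient_unique[OF assms(1,2) wgrad_weak_gradient(1)[OF assms(3,4)] assms(3)
      wgrad_weak_gradient(2)[OF assms(3,4)] assms(4)] .

lemma bump_L2:
  assumes "S \<in> lmeasurable" "r > 0"
  shows "bump x0 r \<in> L2 S" "bump_grad x0 r \<in> L2 S"
proof -
  show "bump x0 r \<in> L2 S"
    by (rule test_function_L2(1)[OF bump_test_function[OF assms(2) subset_UNIV] assms(1)])
  obtain C where "\<forall>(x0::'a) r x. r > 0 \<longrightarrow> norm (bump_grad x0 r x) \<le> C / r"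
    using bump_grad_bound by blast
  then show "bump_grad x0 r \<in> L2 S"
    using assms by (intro L2_bounded[of _ _ "C / r"] continuous_imp_measurable_on_sets_lebesgue
        continuous_on_bump_grad) auto
qed

lemma bump_H1_0:
  assumes S: "open S" "S \<in> lmeasurable" and r: "r > 0" "cball x0 r \<subseteq> S"
  shows "bump x0 r \<in> H1_0 S"
proof -
  have "bump x0 r \<in> H1 S"
    unfolding H1_def using bump_L2[OF S(2) r(1)] bump_weak_gradient[OF r(1)] S(2) by blast
  moreover have "H1_norm S (\<lambda>x. bump x0 r x - bump x0 r x) = 0"
  proof -
    \<comment> \<open>The constant sequence approximates the bump, but the norm of the difference 0
      still contains a chosen gradient, which is 0 only almost everywhere.\<close>
    have "is_weak_gradient S (\<lambda>x. 0) (\<lambda>x. 0)" by (simp add: is_weak_gradient_def)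
    moreover have "(\<lambda>x. 0) \<in> L2 S" using S(2) by (intro L2_bounded[of _ _ 0]) auto
    ultimately have "AE x in lebesgue_on S. wgrad S (\<lambda>x. 0) x = 0" by (rule wgrad_AE[OF S, rotated])
    then have "(LINT x|lebesgue_on S. (norm (wgrad S (\<lambda>x. 0) x))\<^sup>2) = 0"
      by (intro integral_eq_zero_AE) auto
    then show ?thesis by (simp add: H1_norm_def L2_norm_def)
  qed
  ultimately show ?thesis
    unfolding H1_0_def using bump_test_function[OF r] by (auto intro!: exI[of _ "\<lambda>_. bump x0 r"])
qed

text \<open>The equation for z is tested with a bump, and the gradient of z is split into that of
  the error z - y and D. The chosen gradients of z, of the error and of the bump are compared
  through explicit ones.\<close>

lemma galerkin_error_bump:
  assumes S: "open S" "S \<in> lmeasurable" and z: "z \<in> H1_0 S" and F: "F \<in> L2 S"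
    and eq: "\<And>v. v \<in> H1_0 S \<Longrightarrow> L2_inner S (wgrad S z) (wgrad S v) = L2_inner S F v"
    and y: "y \<in> L2 S" "D \<in> L2 S" "is_weak_gradient S y D"
  shows "wgrad S (\<lambda>x. z x - y x) \<in> L2 S"
    and "r > 0 \<Longrightarrow> cball x0 r \<subseteq> S \<Longrightarrow>
      (LINT x|lebesgue_on S. wgrad S (\<lambda>x. z x - y x) x \<bullet> bump_grad x0 r x)
        + (LINT x|lebesgue_on S. D x \<bullet> bump_grad x0 r x) = (LINT x|lebesgue_on S. F x * bump x0 r x)"
proof -
  have z1: "z \<in> L2 S" "\<exists>G\<in>L2 S. is_weak_gradient S z G" using z by (auto simp: H1_0_def H1_def)
  then obtain Gz where Gz: "Gz \<in> L2 S" "is_weak_gradient S z Gz" by blast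
  define E where "E = wgrad S (\<lambda>x. z x - y x)"
  have d: "(\<lambda>x. Gz x - D x) \<in> L2 S" "is_weak_gradient S (\<lambda>x. z x - y x) (\<lambda>x. Gz x - D x)"
    using L2_diff[OF Gz(1) y(2)] weak_gradient_diff[OF S(2) z1(1) y(1) Gz(1) y(2) Gz(2) y(3)] by auto
  show "wgrad S (\<lambda>x. z x - y x) \<in> L2 S" by (rule wgrad_weak_gradient(1)[OF d])
  then have E: "E \<in> L2 S" by (simp add: E_def)
  assume r: "r > 0" "cball x0 r \<subseteq> S"
  note B = bump_L2[OF S(2) r(1), of x0]
  have b: "bump x0 r \<in> H1_0 S" by (rule bump_H1_0[OF S r])
  have w: "is_weak_gradient S (bump x0 r) (bump_grad x0 r)" using S by (intro bump_weak_gradient[OF r(1)]) auto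
  have ae: "AE x in lebesgue_on S. wgrad S z x \<bullet> wgrad S (bump x0 r) x
      = E x \<bullet> bump_grad x0 r x + D x \<bullet> bump_grad x0 r x"
    using wgrad_AE[OF S Gz] wgrad_AE[OF S d] wgrad_AE[OF S B(2) w]
    by eventually_elim (simp add: E_def inner_diff_left)
  have "L2_inner S (wgrad S z) (wgrad S (bump x0 r))
      = (LINT x|lebesgue_on S. E x \<bullet> bump_grad x0 r x + D x \<bullet> bump_grad x0 r x)"
    unfolding L2_inner_def
  proof (rule integral_cong_AE[OF _ _ ae])
    show "(\<lambda>x. wgrad S z x \<bullet> wgrad S (bump x0 r) x) \<in> borel_measurable (lebesgue_on S)"
      using wgrad_weak_gradient(1)[OF Gz] wgrad_weak_gradient(1)[OF B(2) w]
      by (intro borel_measurable_integrable L2_integrable_inner)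
    show "(\<lambda>x. E x \<bullet> bump_grad x0 r x + D x \<bullet> bump_grad x0 r x) \<in> borel_measurable (lebesgue_on S)"
      using E y(2) B(2) by (intro borel_measurable_integrable Bochner_Integration.integrable_add L2_integrable_inner)
  qed
  also have "\<dots> = (LINT x|lebesgue_on S. E x \<bullet> bump_grad x0 r x)
        + (LINT x|lebesgue_on S. D x \<bullet> bump_grad x0 r x)"
    using E y(2) B(2) by (intro Bochner_Integration.integral_add L2_integrable_inner)
  finally show "(LINT x|lebesgue_on S. wgrad S (\<lambda>x. z x - y x) x \<bullet> bump_grad x0 r x)
        + (LINT x|lebesgue_on S. D x \<bullet> bump_grad x0 r x) = (LINT x|lebesgue_on S. F x * bump x0 r x)"
    using eq[OF b] unfolding E_def L2_inner_def by simp
qed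

section \<open>Finite element functions\<close>

text \<open>The difference v of the gradients serves as its own test direction: the values at an
  interior point a and at a + t v give t |v|^2 = 0. This makes the definite description in
  \<open>elem_grad\<close> meaningful.\<close>

lemma affine_gradient_unique:
  fixes g g' :: "'a::euclidean_space"
  assumes "interior K \<noteq> {}" "\<And>x. x \<in> K \<Longrightarrow> c + g \<bullet> x = c' + g' \<bullet> x"
  shows "g = g'"
proof -
  obtain a where "a \<in> interior K" using assms(1) by blast
  then obtain e where e: "e > 0" "ball a e \<subseteq> K"
    using interior_subset open_contains_ball_eq[OF open_interior] by (metis subset_trans)
  define v where "v = g - g'"
  obtain n where n: "n > 0" "norm v \<le> n" by (rule that[of "norm v + 1"]) (auto simp: add_nonneg_pos)
  define t where "t = e / (2 * n)"
  have t: "t > 0" using e(1) n by (simp add: t_def)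
  have "t * norm v \<le> t * n" using t n by simp
  also have "\<dots> = e / 2" using n by (simp add: t_def)
  also have "\<dots> < e" using e(1) by simp
  finally have "a + t *\<^sub>R v \<in> ball a e" using t by (simp add: dist_norm)
  then have "a + t *\<^sub>R v \<in> K" "a \<in> K" using e by auto
  from assms(2)[OF this(1)] assms(2)[OF this(2)]
  have "t * (v \<bullet> v) = 0" unfolding v_def by (simp add: inner_add_right inner_diff_left algebra_simps)
  then show ?thesis using t by (simp add: v_def)
qed

lemma elem_grad_eq:
  assumes "interior K \<noteq> {}" "\<And>x. x \<in> K \<Longrightarrow> z x = c + g \<bullet> x"
  shows "elem_grad z K = g"
  unfolding elem_grad_def
proof (rule the_equality)
  show "\<exists>c. \<forall>x\<in>K. z x = c + g \<bullet> x" using assms(2) by blast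
  fix g' assume "\<exists>c. \<forall>x\<in>K. z x = c + g' \<bullet> x"
  then obtain c' where "\<forall>x\<in>K. z x = c' + g' \<bullet> x" by blast
  then show "g' = g" using assms affine_gradient_unique[OF assms(1), of c' g' c g] by simp
qed

lemma simplex_interior_nonempty:
  fixes K :: "'a::euclidean_space set"
  assumes "int DIM('a) simplex K"
  shows "interior K \<noteq> {}"
proof -
  have d: "aff_dim K = int DIM('a)" using assms by (rule aff_dim_simplex)
  then have "K \<noteq> {}" by auto
  then have "rel_interior K \<noteq> {}" using convex_simplex[OF assms] by (simp add: rel_interior_eq_empty)
  then show ?thesis using interior_rel_interior[OF d] by simp
qed

lemma mesh_element:
  fixes K :: "'a::euclidean_space set"
  assumes "simplicial_mesh \<Omega> T" "K \<in> T"
  shows "int DIM('a) simplex K" "convex K" "compact K" "closed K" "polyhedron K" "interior K \<noteq> {}"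
    "K \<subseteq> closure \<Omega>"
proof -
  show s: "int DIM('a) simplex K" using assms by (simp add: simplicial_mesh_def)
  show "convex K" "compact K" "closed K" "polyhedron K" "interior K \<noteq> {}"
    using convex_simplex[OF s] compact_simplex[OF s] closed_simplex[OF s] simplex_imp_polyhedron[OF s]
      simplex_interior_nonempty[OF s] by auto
  show "K \<subseteq> closure \<Omega>" using assms by (auto simp: simplicial_mesh_def)
qed

lemma mesh_finite: "simplicial_mesh \<Omega> T \<Longrightarrow> finite T"
  by (simp add: simplicial_mesh_def triangulation_def)

text \<open>The intersection of two elements is a face of each, and a face of K that contains a
  relative interior point of K is K itself; this is applied in both directions.\<close>

lemma mesh_interiors_disjoint:
  assumes T: "simplicial_mesh \<Omega> T" and K: "K \<in> T" "K' \<in> T" and x: "x \<in> interior K" "x \<in> interior K'"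
  shows "K = K'"
proof -
  have 1: "A = A \<inter> B" if A: "A \<in> T" "B \<in> T" "x \<in> interior A" "x \<in> B" for A B
  proof (rule ccontr)
    assume "A \<noteq> A \<inter> B"
    moreover have "(A \<inter> B) face_of A"
      using T A unfolding simplicial_mesh_def triangulation_def by blast
    ultimately have "(A \<inter> B) \<inter> rel_interior A = {}" using face_of_disjoint_rel_interior by metis
    moreover have "x \<in> rel_interior A" "x \<in> A"
      using A(3) interior_subset_rel_interior interior_subset by blast+
    ultimately show False using A(4) by blast
  qed
  have "x \<in> K" "x \<in> K'" using x interior_subset by blast+
  then show ?thesis using 1[OF K x(1)] 1[OF K(2,1) x(2)] by blast
qed

text \<open>Interiors are used because closed elements overlap and gradients would be added up on
  the sides. With the value 0 elsewhere it is a Borel function on the whole space, which will be,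
  off a null set, the gradient of the extension of z by zero.\<close>

definition pw_grad :: "'a::euclidean_space set set \<Rightarrow> ('a \<Rightarrow> real) \<Rightarrow> 'a \<Rightarrow> 'a" where
  "pw_grad T z x = (\<Sum>K\<in>T. indicator (interior K) x *\<^sub>R elem_grad z K)"

lemma pw_grad_eq:
  assumes T: "simplicial_mesh \<Omega> T" and K: "K \<in> T" and x: "x \<in> interior K"
  shows "pw_grad T z x = elem_grad z K"
proof -
  have "pw_grad T z x = (\<Sum>K'\<in>T. if K' = K then elem_grad z K else 0)"
    unfolding pw_grad_def
  proof (rule sum.cong[OF refl])
    fix K' assume K': "K' \<in> T"
    show "indicator (interior K') x *\<^sub>R elem_grad z K' = (if K' = K then elem_grad z K else 0)"
    proof (cases "K' = K")
      case False
      then have "x \<notin> interior K'" using mesh_interiors_disjoint[OF T K' K _ x] by blast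
      then show ?thesis using False by simp
    qed (use x in simp)
  qed
  then show ?thesis using mesh_finite[OF T] K by simp
qed

lemma pw_grad_borel: "pw_grad T z \<in> borel_measurable borel"
  unfolding pw_grad_def[abs_def]
  by (intro borel_measurable_sum borel_measurable_scaleR borel_measurable_indicator) auto

lemma pw_grad_L2:
  assumes "simplicial_mesh \<Omega> T" "S \<in> lmeasurable"
  shows "pw_grad T z \<in> L2 S"
proof (rule L2_bounded[OF assms(2)])
  show "pw_grad T z \<in> borel_measurable (lebesgue_on S)"
    using pw_grad_borel by (intro measurable_restrict_space1 measurable_completion) simp
  show "norm (pw_grad T z x) \<le> (\<Sum>K\<in>T. norm (elem_grad z K))" for x
    unfolding pw_grad_def by (rule sum_norm_le) (simp add: indicator_def)
qed

lemma negligible_mesh_frontiers: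
  assumes "simplicial_mesh \<Omega> T"
  shows "negligible (\<Union>(frontier ` T))"
  using mesh_finite[OF assms] mesh_element(2)[OF assms]
  by (intro negligible_Union) (auto intro: negligible_convex_frontier)

lemma fe_space_affine:
  assumes "z \<in> fe_space \<Omega> T" "simplicial_mesh \<Omega> T" "K \<in> T"
  obtains c where "\<And>x. x \<in> K \<Longrightarrow> z x = c + elem_grad z K \<bullet> x"
proof -
  obtain q where "q \<in> polys 1" "\<forall>x\<in>K. z x = q x" using assms by (auto simp: fe_space_def)
  then obtain c g where "\<And>x. x \<in> K \<Longrightarrow> z x = c + g \<bullet> x" by (auto simp: polys_def)
  then show ?thesis using that elem_grad_eq[OF mesh_element(6)[OF assms(2,3)]] by metis
qed

text \<open>A segment may leave \<Omega>, which need not be convex. Its parameter interval is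
  covered by finitely many closed sets, one for each element and one for the complement of \<Omega>,
  and the extension is Lipschitz on each of them. The zero boundary values make \<open>ze\<close>
  agree with z on all of the closure. The constant is crude; only its finiteness matters.\<close>

lemma fe_space_extension_lipschitz:
  fixes z :: "'a::euclidean_space \<Rightarrow> real"
  assumes T: "simplicial_mesh \<Omega> T" and z: "z \<in> fe_space \<Omega> T" and S: "open \<Omega>"
  defines "ze \<equiv> \<lambda>x. if x \<in> \<Omega> then z x else 0"
  shows "\<bar>ze (x + t *\<^sub>R \<tau>) - ze x\<bar> \<le> ((\<Sum>K\<in>T. norm (elem_grad z K)) * norm \<tau>) * \<bar>t\<bar>"
proof -
  define M where "M = (\<Sum>K\<in>T. norm (elem_grad z K)) * norm \<tau>"
  have M0: "M \<ge> 0" unfolding M_def by (intro mult_nonneg_nonneg sum_nonneg) auto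
  define f where "f s = ze (x + s *\<^sub>R \<tau>)" for s
  define U where "U K = {s. x + s *\<^sub>R \<tau> \<in> K}" for K
  have fin: "finite T" by (rule mesh_finite[OF T])
  have zeq: "ze x = z x" if "x \<in> closure \<Omega>" for x
    using that z S by (auto simp: ze_def fe_space_def frontier_def interior_open)
  have U: "closed (U K)" if "closed K" for K
  proof -
    have "closed ((\<lambda>s. x + s *\<^sub>R \<tau>) -` K)"
      by (intro continuous_closed_vimage that) (auto intro!: continuous_intros)
    then show ?thesis by (simp add: U_def vimage_def)
  qed
  have "M-lipschitz_on {min 0 t..max 0 t} f"
  proof (rule lipschitz_on_closed_Union[where I = "insert (- \<Omega>) T" and U = U])
    fix K assume "K \<in> insert (- \<Omega>) T"
    then consider "K = - \<Omega>" | "K \<in> T" by blast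
    then show "M-lipschitz_on (U K) f"
    proof cases
      case 1
      then show ?thesis using M0 by (intro lipschitz_onI) (auto simp: U_def f_def ze_def)
    next
      case 2
      obtain c where c: "\<And>x. x \<in> K \<Longrightarrow> z x = c + elem_grad z K \<bullet> x"
        by (rule fe_space_affine[OF z T 2]) (rule that)
      have "norm (elem_grad z K) \<le> (\<Sum>K\<in>T. norm (elem_grad z K))"
        using member_le_sum[OF 2 _ fin, of "\<lambda>K. norm (elem_grad z K)"] by simp
      then have gM: "norm (elem_grad z K) * norm \<tau> \<le> M"
        unfolding M_def by (intro mult_right_mono) auto
      show ?thesis
      proof (rule lipschitz_onI[OF _ M0])
        fix s r assume sr: "s \<in> U K" "r \<in> U K"
        have fv: "f s = c + elem_grad z K \<bullet> (x + s *\<^sub>R \<tau>)" if "s \<in> U K" for s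
          using that c[of "x + s *\<^sub>R \<tau>"] zeq mesh_element(7)[OF T 2] by (auto simp: U_def f_def)
        have "dist (f s) (f r) = \<bar>(s - r) * (elem_grad z K \<bullet> \<tau>)\<bar>"
          unfolding fv[OF sr(1)] fv[OF sr(2)] dist_real_def
          by (simp add: inner_add_right algebra_simps)
        also have "\<dots> \<le> \<bar>s - r\<bar> * (norm (elem_grad z K) * norm \<tau>)"
          unfolding abs_mult by (intro mult_left_mono Cauchy_Schwarz_ineq2) auto
        also have "\<dots> \<le> M * dist s r"
          using mult_left_mono[OF gM, of "\<bar>s - r\<bar>"] by (simp add: dist_real_def mult.commute)
        finally show "dist (f s) (f r) \<le> M * dist s r" .
      qed
    qed
  next
    show "closed (U K)" if "K \<in> insert (- \<Omega>) T" for K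
      using that U mesh_element(4)[OF T] S by (auto simp: closed_Compl)
    have "\<Union>T = closure \<Omega>" using T by (simp add: simplicial_mesh_def)
    then have "x + s *\<^sub>R \<tau> \<in> - \<Omega> \<or> (\<exists>K\<in>T. x + s *\<^sub>R \<tau> \<in> K)" for s
      using closure_subset[of \<Omega>] by blast
    then show "{min 0 t..max 0 t} \<subseteq> (\<Union>K\<in>insert (- \<Omega>) T. U K)"
      unfolding U_def by blast
  qed (use fin M0 in auto)
  from lipschitz_onD[OF this, of t 0] show ?thesis
    by (simp add: f_def dist_real_def M_def)
qed

lemma fe_space_weak_gradient:
  fixes z :: "'a::euclidean_space \<Rightarrow> real"
  assumes T: "simplicial_mesh \<Omega> T" and z: "z \<in> fe_space \<Omega> T" and S: "open \<Omega>" "bounded \<Omega>"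
  shows "z \<in> L2 \<Omega>" "is_weak_gradient \<Omega> z (pw_grad T z)"
proof -
  define ze where "ze x = (if x \<in> \<Omega> then z x else 0)" for x
  have zeq: "ze x = z x" if "x \<in> closure \<Omega>" for x
    using that z S by (auto simp: ze_def fe_space_def frontier_def interior_open)
  have cz: "continuous_on (closure \<Omega>) z" using z by (simp add: fe_space_def)
  have cl: "compact (closure \<Omega>)" using S(2) by (simp add: compact_closure)
  have S': "\<Omega> \<in> sets lebesgue" using S(1) by auto
  show "z \<in> L2 \<Omega>"
    using L2_mono(1)[OF L2_continuous[OF cl cz] _ S' negligible_empty] cl closure_subset
    by (auto simp: lmeasurable_compact)
  have "continuous_on (closure \<Omega> \<union> - \<Omega>) (\<lambda>x. if x \<in> \<Omega> then z x else 0)"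
  proof (rule continuous_on_cases)
    show "\<forall>x. x \<in> closure \<Omega> \<and> x \<notin> \<Omega> \<or> x \<in> - \<Omega> \<and> x \<in> \<Omega> \<longrightarrow> z x = 0"
      using z S by (auto simp: fe_space_def frontier_def interior_open)
  qed (use cz S in \<open>auto simp: closed_Compl\<close>)
  moreover have "closure \<Omega> \<union> - \<Omega> = UNIV" using closure_subset[of \<Omega>] by blast
  ultimately have c: "continuous_on UNIV ze" by (simp add: ze_def[abs_def])
  obtain B where B: "\<And>x. \<bar>ze x\<bar> \<le> B"
  proof -
    have "compact (z ` closure \<Omega>)" by (rule compact_continuous_image[OF cz cl])
    then obtain a where a: "\<forall>x\<in>closure \<Omega>. norm (z x) \<le> a"
      by (metis bounded_iff compact_imp_bounded imageI)
    have "\<bar>ze x\<bar> \<le> max a 0" for x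
    proof (cases "x \<in> \<Omega>")
      case True
      then have "x \<in> closure \<Omega>" using closure_subset by blast
      with a have "norm (z x) \<le> a" by blast
      then show ?thesis using True by (simp add: ze_def)
    qed (simp add: ze_def)
    then show thesis by (rule that)
  qed
  have "is_weak_gradient \<Omega> ze (pw_grad T z)"
  proof (rule weak_gradientI[OF S' _ B _ pw_grad_borel negligible_mesh_frontiers[OF T]])
    show "ze \<in> borel_measurable borel" by (rule borel_measurable_continuous_onI[OF c])
    show "\<bar>ze (x + t *\<^sub>R \<tau>) - ze x\<bar> \<le> ((\<Sum>K\<in>T. norm (elem_grad z K)) * norm \<tau>) * \<bar>t\<bar>" for x \<tau> t
      unfolding ze_def[abs_def] by (rule fe_space_extension_lipschitz[OF T z S(1)])
    \<comment> \<open>Off the frontiers a point is interior to an element, where the function is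
      affine, or outside the closure, where the extension is 0.\<close>
    fix x \<tau> :: 'a assume x: "x \<notin> \<Union>(frontier ` T)"
    have "(ze has_derivative (\<lambda>v. pw_grad T z x \<bullet> v)) (at x)"
    proof (cases "x \<in> closure \<Omega>")
      case True
      then obtain K where K: "K \<in> T" "x \<in> K" using T by (auto simp: simplicial_mesh_def)
      then have xi: "x \<in> interior K"
        using x closure_subset[of K] by (auto simp: frontier_def)
      obtain c where c: "\<And>x. x \<in> K \<Longrightarrow> z x = c + elem_grad z K \<bullet> x"
        by (rule fe_space_affine[OF z T K(1)]) (rule that)
      have "((\<lambda>x. c + elem_grad z K \<bullet> x) has_derivative (\<lambda>v. pw_grad T z x \<bullet> v)) (at x)"
        unfolding pw_grad_eq[OF T K(1) xi] by (rule derivative_eq_intros refl)+ auto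
      then show ?thesis
      proof (rule has_derivative_transform_within_open[OF _ open_interior xi])
        fix u assume "u \<in> interior K"
        then have "u \<in> K" using interior_subset by blast
        then show "c + elem_grad z K \<bullet> u = ze u" using c zeq mesh_element(7)[OF T K(1)] by force
      qed
    next
      case False
      have "indicator (interior K) x *\<^sub>R elem_grad z K = 0" if "K \<in> T" for K
        using False mesh_element(7)[OF T that] interior_subset[of K] by (auto simp: indicator_def)
      then have "pw_grad T z x = 0" unfolding pw_grad_def by (simp add: sum.neutral)
      moreover have "((\<lambda>_. 0) has_derivative (\<lambda>v. 0)) (at x)" by simp
      ultimately have "((\<lambda>_. 0) has_derivative (\<lambda>v. pw_grad T z x \<bullet> v)) (at x)" by simp
      then show ?thesis
      proof (rule has_derivative_transform_within_open)
        show "open (- closure \<Omega>)" "x \<in> - closure \<Omega>" using False by auto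
        show "0 = ze u" if "u \<in> - closure \<Omega>" for u
          using that closure_subset[of \<Omega>] by (auto simp: ze_def)
      qed
    qed
    then show "((\<lambda>t. (ze (x + t *\<^sub>R \<tau>) - ze x) / t) \<longlongrightarrow> pw_grad T z x \<bullet> \<tau>) (at 0)"
      by (rule differentiable_difference_quotient)
  qed
  moreover have "(LINT x|lebesgue_on \<Omega>. z x * h x) = (LINT x|lebesgue_on \<Omega>. ze x * h x)" for h
    by (intro Bochner_Integration.integral_cong) (auto simp: ze_def)
  ultimately show "is_weak_gradient \<Omega> z (pw_grad T z)" by (simp add: is_weak_gradient_def)
qed

section \<open>Polytopal domains with Lipschitz boundary\<close>

text \<open>At a boundary point the region strictly below the Lipschitz graph is open, disjoint from
  \<Omega> near the point, and entered by moving along - e. So no neighbourhood of the point lies in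
  the closure. As a consequence, open sets covered by elements lie in \<Omega>.\<close>

lemma interior_closure_lipschitz:
  assumes "lipschitz_polytopal_domain \<Omega>"
  shows "interior (closure \<Omega>) = \<Omega>"
proof
  have op: "open \<Omega>" using assms by (simp add: lipschitz_polytopal_domain_def)
  show "\<Omega> \<subseteq> interior (closure \<Omega>)" using op closure_subset by (rule interior_maximal[rotated])
  show "interior (closure \<Omega>) \<subseteq> \<Omega>"
  proof
    fix p assume p: "p \<in> interior (closure \<Omega>)"
    show "p \<in> \<Omega>"
    proof (rule ccontr)
      assume np: "p \<notin> \<Omega>"
      then have "p \<in> frontier \<Omega>"
        using p interior_subset op by (auto simp: frontier_def interior_open)
      then obtain r e \<phi> L where r: "r > 0" and e: "norm e = 1"
        and \<phi>: "L-lipschitz_on {z. z \<bullet> e = 0} \<phi>"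
        and eq: "\<Omega> \<inter> ball p r = {x \<in> ball p r. \<phi> (x - (x \<bullet> e) *\<^sub>R e) < x \<bullet> e}"
        using assms unfolding lipschitz_polytopal_domain_def lipschitz_boundary_def by blast
      define P where "P x = x - (x \<bullet> e) *\<^sub>R e" for x
      have ee: "e \<bullet> e = 1" using e by (simp add: dot_square_norm)
      have P0: "P x \<bullet> e = 0" for x by (simp add: P_def inner_diff_left ee)
      have "continuous_on UNIV P" unfolding P_def by (intro continuous_intros)
      then have c: "continuous_on UNIV (\<lambda>x. \<phi> (P x) - x \<bullet> e)"
        using P0 by (intro continuous_on_diff continuous_on_compose2[OF lipschitz_on_continuous_on[OF \<phi>]]
            continuous_intros) auto
      define W where "W = {x. 0 < \<phi> (P x) - x \<bullet> e}"
      have W: "open W" unfolding W_def by (rule open_Collect_less[OF continuous_on_const c])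
      obtain d where d: "d > 0" "ball p d \<subseteq> closure \<Omega>"
        using p by (meson mem_interior)
      define t where "t = min r d / 2"
      have t: "t > 0" "t < r" "t < d" using r d by (auto simp: t_def)
      define q where "q = p - t *\<^sub>R e"
      have "dist p q = t" using t e by (simp add: q_def dist_norm)
      then have q: "q \<in> ball p r" "q \<in> ball p d" using t by auto
      have "p \<in> ball p r" using r by simp
      then have "p \<bullet> e \<le> \<phi> (P p)" using np eq unfolding P_def by force
      moreover have "P q = P p" by (simp add: P_def q_def inner_diff_left ee algebra_simps)
      moreover have "q \<bullet> e = p \<bullet> e - t" by (simp add: q_def inner_diff_left ee)
      ultimately have "q \<in> W" using t by (simp add: W_def)
      moreover have "q \<in> closure \<Omega>" using d(2) q(2) by blast
      ultimately have "W \<inter> ball p r \<inter> \<Omega> \<noteq> {}"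
        using open_Int_closure_eq_empty[of "W \<inter> ball p r" \<Omega>] W q(1) by blast
      then obtain x where "x \<in> W" "x \<in> ball p r" "x \<in> \<Omega>" by blast
      then show False using eq by (force simp: W_def P_def)
    qed
  qed
qed

text \<open>A boundary point of \<Omega> in an element K cannot be interior to K, as the interior of
  K lies in \<Omega>; hence finitely many frontiers of convex sets cover the boundary.\<close>

lemma mesh_measure:
  assumes \<Omega>: "lipschitz_polytopal_domain \<Omega>" and T: "simplicial_mesh \<Omega> T"
  shows "negligible (frontier \<Omega>)" "closure \<Omega> = \<Omega> \<union> frontier \<Omega>"
proof -
  have op: "open \<Omega>" using \<Omega> by (simp add: lipschitz_polytopal_domain_def)
  show "closure \<Omega> = \<Omega> \<union> frontier \<Omega>"
    using op closure_subset[of \<Omega>] by (auto simp: frontier_def interior_open)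
  have "frontier \<Omega> \<subseteq> \<Union>(frontier ` T)"
  proof
    fix x assume x: "x \<in> frontier \<Omega>"
    then have "x \<in> closure \<Omega>" "x \<notin> \<Omega>" using op by (auto simp: frontier_def interior_open)
    then obtain K where K: "K \<in> T" "x \<in> K" using T by (auto simp: simplicial_mesh_def)
    have "interior K \<subseteq> \<Omega>"
      using interior_mono[OF mesh_element(7)[OF T K(1)]] interior_closure_lipschitz[OF \<Omega>] by simp
    then have "x \<in> frontier K" using K(2) \<open>x \<notin> \<Omega>\<close> closure_subset[of K] by (auto simp: frontier_def)
    then show "x \<in> \<Union>(frontier ` T)" using K(1) by blast
  qed
  then show "negligible (frontier \<Omega>)" using negligible_mesh_frontiers[OF T] negligible_subset by blast
qed

section \<open>Shape regular simplices\<close>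

text \<open>The supremum in \<open>inball_diameter\<close> is not taken as attained: a ball of more
  than half that diameter is chosen, which turns the constant 2\<sigma> into 4\<sigma>.\<close>

lemma shape_regular_inball:
  fixes K :: "'a::euclidean_space set"
  assumes K: "compact K" "interior K \<noteq> {}" and \<sigma>: "\<sigma> > 0" "diameter K \<le> \<sigma> * inball_diameter K"
  obtains x0 r where "r > 0" "cball x0 r \<subseteq> K" "diameter K \<le> 4 * \<sigma> * r" "2 * r \<le> diameter K"
proof -
  have bK: "bounded K" using K(1) by (rule compact_imp_bounded)
  have le: "2 * r \<le> diameter K" if "cball x r \<subseteq> K" "r \<ge> 0" for x :: 'a and r
    using diameter_subset[OF that(1) bK] that(2) by simp
  have d: "diameter K > 0"
  proof -
    obtain x where "x \<in> interior K" using K(2) by blast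
    then obtain e where "e > 0" "cball x e \<subseteq> K" by (meson mem_interior_cball)
    then show ?thesis using le[of x e] by simp
  qed
  let ?S = "{2 * r |r. 0 \<le> r \<and> (\<exists>x. cball x r \<subseteq> K)}"
  have I: "inball_diameter K > 0"
    using d \<sigma> by (meson less_le_trans zero_less_mult_pos)
  have "\<exists>s\<in>?S. inball_diameter K / 2 < s"
  proof (rule ccontr)
    assume "\<not> ?thesis"
    then have "\<And>s. s \<in> ?S \<Longrightarrow> s \<le> inball_diameter K / 2" by (meson not_le)
    moreover have "?S \<noteq> {}"
    proof -
      obtain x where "x \<in> K" using K(2) interior_subset by blast
      then have "2 * 0 \<in> ?S" by (intro CollectI exI[of _ "0::real"]) (auto intro: exI[of _ x])
      then show ?thesis by blast
    qed
    ultimately have "Sup ?S \<le> inball_diameter K / 2" by (intro cSup_least)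
    then show False using I by (simp add: inball_diameter_def)
  qed
  then obtain r x where r: "0 \<le> r" "cball x r \<subseteq> K" "inball_diameter K / 2 < 2 * r" by blast
  have "diameter K \<le> \<sigma> * (4 * r)"
    using \<sigma>(2) mult_left_mono[of "inball_diameter K" "4 * r" \<sigma>] r(3) \<sigma>(1) by linarith
  moreover have "r > 0" using r(3) I by linarith
  ultimately show ?thesis using that[of r x] r le[OF r(2,1)] by simp
qed

text \<open>Faces of a polyhedron are exposed. The exposing functional is nonzero, as a facet is
  neither empty nor all of K, and can therefore be normalised.\<close>

lemma facet_supporting_hyperplane:
  fixes K :: "'a::euclidean_space set"
  assumes "polyhedron K" "\<gamma> facet_of K"
  obtains \<nu> c where "norm \<nu> = 1" "K \<subseteq> {x. \<nu> \<bullet> x \<le> c}" "\<gamma> = K \<inter> {x. \<nu> \<bullet> x = c}"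
proof -
  have "\<gamma> exposed_face_of K"
    using assms facet_of_imp_face_of exposed_face_of_polyhedron by blast
  then obtain a b where ab: "K \<subseteq> {x. a \<bullet> x \<le> b}" "\<gamma> = K \<inter> {x. a \<bullet> x = b}"
    unfolding exposed_face_of_def by blast
  have "a \<noteq> 0"
  proof
    assume "a = 0"
    then have "\<gamma> = K \<or> \<gamma> = {}" using ab by auto
    then show False using assms(2) by (auto simp: facet_of_def)
  qed
  then have n: "norm a > 0" by simp
  have le: "(a /\<^sub>R norm a) \<bullet> x \<le> b / norm a \<longleftrightarrow> a \<bullet> x \<le> b"
    and eq: "(a /\<^sub>R norm a) \<bullet> x = b / norm a \<longleftrightarrow> a \<bullet> x = b" for x
    using n by (simp_all add: divide_simps mult.commute)
  show ?thesis
    by (rule that[of "a /\<^sub>R norm a" "b / norm a"]) (use ab n in \<open>simp_all only: le eq norm_scaleR\<close>, simp)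
qed

text \<open>Projection from the vertex u opposite to the facet: the slices of K parallel to the
  facet are copies of it scaled by s. The slice through x0 has a factor s0 \<le> 1 and contains a
  disc of radius r, so the facet contains this disc enlarged by 1/s0, in particular one of radius
  r.\<close>

lemma simplex_facet_disc:
  fixes K :: "'a::euclidean_space set"
  assumes K: "n simplex K" and \<gamma>: "\<gamma> facet_of K" and r: "r > 0" "cball x0 r \<subseteq> K"
    and \<nu>: "norm \<nu> = 1" "K \<subseteq> {x. \<nu> \<bullet> x \<le> c}" "\<gamma> = K \<inter> {x. \<nu> \<bullet> x = c}"
  obtains x\<gamma> where "\<And>w. \<nu> \<bullet> w = 0 \<Longrightarrow> norm w \<le> r \<Longrightarrow> x\<gamma> + w \<in> \<gamma>"
proof -
  have \<nu>\<nu>: "\<nu> \<bullet> \<nu> = 1" using \<nu>(1) by (simp add: dot_square_norm)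
  obtain C where C: "\<not> affine_dependent C" "K = convex hull C" using K by (auto simp: simplex_def)
  then obtain u where u: "u \<in> C" "\<gamma> = convex hull (C - {u})" "\<gamma> \<noteq> {}"
    using \<gamma> facet_of_convex_hull_affine_independent by blast
  have split: "\<exists>s g. 0 \<le> s \<and> s \<le> 1 \<and> g \<in> \<gamma> \<and> x = (1 - s) *\<^sub>R u + s *\<^sub>R g" if "x \<in> K" for x
  proof -
    have "x \<in> convex hull (insert u (C - {u}))" using that C(2) u(1) by (simp add: insert_absorb)
    moreover have ne: "C - {u} \<noteq> {}" using u(2,3) by auto
    ultimately obtain p q g where "p \<ge> 0" "q \<ge> 0" "p + q = 1" "g \<in> \<gamma>" "x = p *\<^sub>R u + q *\<^sub>R g"
      unfolding convex_hull_insert[OF ne] u(2) by blast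
    moreover from this have "p = 1 - q" by simp
    ultimately show ?thesis by (intro exI[of _ q] exI[of _ g]) auto
  qed
  have gc: "\<nu> \<bullet> g = c" if "g \<in> \<gamma>" for g using that \<nu>(3) by blast
  have height: "\<nu> \<bullet> ((1 - s) *\<^sub>R u + s *\<^sub>R g) = c - (1 - s) * (c - \<nu> \<bullet> u)" if "g \<in> \<gamma>" for s g
    using gc[OF that] by (simp add: inner_add_right algebra_simps)
  have inK: "x0 + w \<in> K" if "norm w \<le> r" for w using that r(2) by (auto simp: subset_eq dist_norm)
  have x0: "\<nu> \<bullet> x0 \<le> c - r"
    using inK[of "r *\<^sub>R \<nu>"] \<nu> r(1) \<nu>\<nu> by (auto simp: inner_add_right)
  obtain s0 g0 where s0: "0 \<le> s0" "s0 \<le> 1" "g0 \<in> \<gamma>" "x0 = (1 - s0) *\<^sub>R u + s0 *\<^sub>R g0"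
    using split[of x0] inK[of 0] r(1) by auto
  have h0: "\<nu> \<bullet> x0 = c - (1 - s0) * (c - \<nu> \<bullet> u)" unfolding s0(4) by (rule height[OF s0(3)])
  then have pos: "(1 - s0) * (c - \<nu> \<bullet> u) > 0" using x0 r(1) by linarith
  then have cu: "c - \<nu> \<bullet> u > 0" using s0(2) by (simp add: zero_less_mult_iff)
  \<comment> \<open>Otherwise x0 would lie at the level of u, the lowest one in K, while the
    inscribed ball reaches r below x0.\<close>
  have "s0 \<noteq> 0"
  proof
    assume "s0 = 0"
    have "x0 + (- r) *\<^sub>R \<nu> \<in> K" using \<nu>(1) r(1) by (intro inK) simp
    then obtain s g where s: "0 \<le> s" "s \<le> 1" "g \<in> \<gamma>" "x0 + (- r) *\<^sub>R \<nu> = (1 - s) *\<^sub>R u + s *\<^sub>R g"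
      using split by blast
    have "\<nu> \<bullet> (x0 + (- r) *\<^sub>R \<nu>) = c - (1 - s) * (c - \<nu> \<bullet> u)" unfolding s(4) by (rule height[OF s(3)])
    then have "\<nu> \<bullet> x0 - r = c - (1 - s) * (c - \<nu> \<bullet> u)" using \<nu>\<nu> by (simp add: inner_diff_right)
    moreover have "(1 - s) * (c - \<nu> \<bullet> u) \<le> 1 * (c - \<nu> \<bullet> u)" using s cu by (intro mult_right_mono) auto
    ultimately show False using h0 \<open>s0 = 0\<close> r(1) by simp
  qed
  then have s0p: "s0 > 0" using s0(1) by simp
  show ?thesis
  proof (rule that[of g0])
    fix w assume w: "\<nu> \<bullet> w = 0" "norm w \<le> r"
    have "s0 * norm w \<le> 1 * r" using s0 w(2) by (intro mult_mono) auto
    then have "norm (s0 *\<^sub>R w) \<le> r" using s0(1) by simp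
    from split[OF inK[OF this]] obtain s g
      where s: "0 \<le> s" "s \<le> 1" "g \<in> \<gamma>" "x0 + s0 *\<^sub>R w = (1 - s) *\<^sub>R u + s *\<^sub>R g" by blast
    have "\<nu> \<bullet> (x0 + s0 *\<^sub>R w) = c - (1 - s) * (c - \<nu> \<bullet> u)" unfolding s(4) by (rule height[OF s(3)])
    moreover have "\<nu> \<bullet> (x0 + s0 *\<^sub>R w) = \<nu> \<bullet> x0" using w(1) by (simp add: inner_add_right)
    ultimately have "(1 - s) * (c - \<nu> \<bullet> u) = (1 - s0) * (c - \<nu> \<bullet> u)" using h0 by linarith
    \<comment> \<open>Equal distance from the facet forces equal scaling factors.\<close>
    then have "1 - s = 1 - s0" using cu by (metis less_irrefl mult_right_cancel)
    then have "s = s0" by simp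
    then have "s0 *\<^sub>R (g0 + w) = s0 *\<^sub>R g" using s(4) s0(4) by (simp add: scaleR_add_right)
    then have "g0 + w = g" using s0p by simp
    then show "g0 + w \<in> \<gamma>" using s(3) by simp
  qed
qed

text \<open>The half ball lies in the convex hull of the disc and the centre of the inscribed ball.\<close>

lemma half_ball_subset:
  fixes K :: "'a::euclidean_space set"
  assumes K: "convex K" "\<And>x. x \<in> K \<Longrightarrow> dist x x\<gamma> \<le> h" and r: "r > 0" "cball x0 r \<subseteq> K"
    and \<nu>: "norm \<nu> = 1" "K \<subseteq> {x. \<nu> \<bullet> x \<le> c}" "\<nu> \<bullet> x\<gamma> = c"
    and D: "\<And>w. \<nu> \<bullet> w = 0 \<Longrightarrow> norm w \<le> \<delta> \<Longrightarrow> x\<gamma> + w \<in> K"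
    and \<rho>: "\<rho> > 0" "2 * \<rho> \<le> r" "2 * \<rho> * (1 + h / r) \<le> \<delta>"
    and w: "norm w \<le> \<rho>" "\<nu> \<bullet> w \<le> 0"
  shows "x\<gamma> + w \<in> K"
proof -
  have \<nu>\<nu>: "\<nu> \<bullet> \<nu> = 1" using \<nu>(1) by (simp add: dot_square_norm)
  have x0K: "x0 \<in> K" using r by auto
  define v where "v = x0 - x\<gamma>"
  have "x0 + r *\<^sub>R \<nu> \<in> K" using r \<nu>(1) by (auto simp: subset_eq dist_norm)
  then have m: "- (\<nu> \<bullet> v) \<ge> r" using \<nu> \<nu>\<nu> by (auto simp: v_def inner_add_right inner_diff_right)
  have nv: "norm v \<le> h" using K(2)[OF x0K] by (simp add: v_def dist_norm)
  \<comment> \<open>The weight of x0 is chosen such that the rest w - l v is tangential. The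
    condition 2\<rho> \<le> r gives l \<le> 1/2 and bounds the rescaling factor 1/(1 - l) by 2,
    which the last condition on \<rho> absorbs.\<close>
  define l where "l = (\<nu> \<bullet> w) / (\<nu> \<bullet> v)"
  have vn: "\<nu> \<bullet> v < 0" using m r(1) by linarith
  have "\<bar>\<nu> \<bullet> w\<bar> \<le> norm w" using Cauchy_Schwarz_ineq2[of \<nu> w] \<nu>(1) by simp
  then have "- (\<nu> \<bullet> w) \<le> \<rho>" using w(1) by linarith
  then have "- (\<nu> \<bullet> w) / - (\<nu> \<bullet> v) \<le> \<rho> / r" using m r(1) \<rho>(1) w(2) by (intro frac_le) auto
  then have l1: "l \<le> \<rho> / r" by (simp add: l_def)
  have l0: "l \<ge> 0" using vn w(2) by (simp add: l_def divide_nonpos_neg)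
  have "\<rho> / r \<le> 1 / 2" using \<rho> r(1) by (simp add: divide_simps)
  then have l2: "l \<le> 1 / 2" using l1 by linarith
  define w' where "w' = (1 / (1 - l)) *\<^sub>R (w - l *\<^sub>R v)"
  have "\<nu> \<bullet> (w - l *\<^sub>R v) = 0" using vn by (simp add: inner_diff_right l_def)
  then have w0: "\<nu> \<bullet> w' = 0" by (simp add: w'_def)
  have "norm (w - l *\<^sub>R v) \<le> norm w + norm (l *\<^sub>R v)" by (rule norm_triangle_ineq4)
  also have "\<dots> \<le> \<rho> + (\<rho> / r) * h"
  proof (rule add_mono[OF w(1)])
    have "l * norm v \<le> (\<rho> / r) * h" using l1 nv r(1) \<rho>(1) by (intro mult_mono) auto
    then show "norm (l *\<^sub>R v) \<le> (\<rho> / r) * h" using l0 by simp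
  qed
  also have "\<dots> = \<rho> * (1 + h / r)" by (simp add: algebra_simps)
  finally have n1: "norm (w - l *\<^sub>R v) \<le> \<rho> * (1 + h / r)" .
  have "1 / (1 - l) \<le> 1 / (1 / 2)" using l2 by (intro divide_left_mono) auto
  then have "norm w' \<le> 2 * (\<rho> * (1 + h / r))"
    unfolding w'_def norm_scaleR using n1 l2 by (intro mult_mono) auto
  then have "norm w' \<le> \<delta>" using \<rho>(3) by linarith
  then have "x\<gamma> + w' \<in> K" by (rule D[OF w0])
  then have "(1 - l) *\<^sub>R (x\<gamma> + w') + l *\<^sub>R x0 \<in> K" using x0K l0 l2 by (intro convexD[OF K(1)]) auto
  moreover have "(1 - l) *\<^sub>R w' = w - l *\<^sub>R v" using l2 by (simp add: w'_def)
  then have "(1 - l) *\<^sub>R (x\<gamma> + w') + l *\<^sub>R x0 = x\<gamma> + w"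
    by (simp add: scaleR_add_right v_def algebra_simps)
  ultimately show ?thesis by simp
qed

section \<open>Outer normals and two elements sharing a side\<close>

lemma normal_unique_up_to_sign:
  fixes \<nu> :: "'a::euclidean_space"
  assumes \<nu>: "norm \<nu> = 1" "norm \<nu>' = 1" and r: "r > 0"
    and D: "\<And>w. \<nu> \<bullet> w = 0 \<Longrightarrow> norm w \<le> r \<Longrightarrow> \<nu>' \<bullet> (x + w) = c'"
  shows "\<nu>' = \<nu> \<or> \<nu>' = - \<nu>"
proof -
  have \<nu>\<nu>: "\<nu> \<bullet> \<nu> = 1" using \<nu>(1) by (simp add: dot_square_norm)
  \<comment> \<open>The tangential part of \<nu>' is a direction of the disc, on which the
    functional \<nu>' is constant; hence it is orthogonal to \<nu>' and then to itself.\<close>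
  define v where "v = \<nu>' - (\<nu> \<bullet> \<nu>') *\<^sub>R \<nu>"
  have v0: "\<nu> \<bullet> v = 0" by (simp add: v_def inner_diff_right \<nu>\<nu>)
  have vv: "\<nu>' \<bullet> v = 0"
  proof (cases "v = 0")
    case False
    define t where "t = r / norm v"
    have t: "t > 0" "norm (t *\<^sub>R v) \<le> r" using r False by (auto simp: t_def)
    have "\<nu>' \<bullet> (x + t *\<^sub>R v) = \<nu>' \<bullet> (x + 0)"
      using D[of "t *\<^sub>R v"] D[of 0] v0 t r by simp
    then show ?thesis using t by (simp add: inner_add_right)
  qed simp
  have "v \<bullet> v = \<nu>' \<bullet> v - (\<nu> \<bullet> \<nu>') * (\<nu> \<bullet> v)"
    by (subst (1) v_def) (simp add: inner_diff_left)
  then have "v = 0" using v0 vv by simp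
  then have eq: "\<nu>' = (\<nu> \<bullet> \<nu>') *\<^sub>R \<nu>" by (simp add: v_def)
  then have "norm \<nu>' = \<bar>\<nu> \<bullet> \<nu>'\<bar> * norm \<nu>" by (metis norm_scaleR)
  then have "\<nu> \<bullet> \<nu>' = 1 \<or> \<nu> \<bullet> \<nu>' = - 1" using \<nu> by (simp add: abs_if split: if_splits)
  then show ?thesis using eq by (metis scaleR_one scaleR_minus1_left)
qed

text \<open>The definite description in \<open>outer_normal\<close> has exactly one solution: the
  disc in the facet leaves only the two signs, and the inward sign would force K into a hyperplane,
  against the inscribed ball.\<close>

lemma outer_normal_facet:
  fixes K :: "'a::euclidean_space set"
  assumes K: "n simplex K" and \<gamma>: "\<gamma> facet_of K" and r: "r > 0" "cball x0 r \<subseteq> K"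
  obtains c where "norm (outer_normal K \<gamma>) = 1" "K \<subseteq> {x. outer_normal K \<gamma> \<bullet> x \<le> c}"
    "\<gamma> = K \<inter> {x. outer_normal K \<gamma> \<bullet> x = c}"
proof -
  obtain \<nu> c where \<nu>: "norm \<nu> = 1" "K \<subseteq> {x. \<nu> \<bullet> x \<le> c}" "\<gamma> = K \<inter> {x. \<nu> \<bullet> x = c}"
    by (rule facet_supporting_hyperplane[OF simplex_imp_polyhedron[OF K] \<gamma>]) (rule that)
  obtain x\<gamma> where D: "\<And>w. \<nu> \<bullet> w = 0 \<Longrightarrow> norm w \<le> r \<Longrightarrow> x\<gamma> + w \<in> \<gamma>"
    by (rule simplex_facet_disc[OF K \<gamma> r \<nu>]) (rule that)
  have "outer_normal K \<gamma> = \<nu>"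
    unfolding outer_normal_def
  proof (rule the_equality)
    show "norm \<nu> = 1 \<and> (\<exists>c. (\<forall>x\<in>\<gamma>. \<nu> \<bullet> x = c) \<and> (\<forall>x\<in>K. \<nu> \<bullet> x \<le> c))" using \<nu> by blast
    fix \<nu>' assume "norm \<nu>' = 1 \<and> (\<exists>c. (\<forall>x\<in>\<gamma>. \<nu>' \<bullet> x = c) \<and> (\<forall>x\<in>K. \<nu>' \<bullet> x \<le> c))"
    then obtain c' where \<nu>': "norm \<nu>' = 1" "\<And>x. x \<in> \<gamma> \<Longrightarrow> \<nu>' \<bullet> x = c'" "\<And>x. x \<in> K \<Longrightarrow> \<nu>' \<bullet> x \<le> c'"
      by blast
    have "\<nu>' = \<nu> \<or> \<nu>' = - \<nu>"
      by (rule normal_unique_up_to_sign[OF \<nu>(1) \<nu>'(1) r(1), of x\<gamma> c']) (use D \<nu>'(2) in blast)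
    moreover have "\<nu>' \<noteq> - \<nu>"
    proof
      assume eq: "\<nu>' = - \<nu>"
      have "x\<gamma> \<in> \<gamma>" using D[of 0] r(1) by simp
      then have "c' = - c" using \<nu>(3) \<nu>'(2) eq by force
      have "x0 - r *\<^sub>R \<nu> \<in> K" "x0 + r *\<^sub>R \<nu> \<in> K" using r \<nu>(1) by (auto simp: subset_eq dist_norm)
      then have "\<nu> \<bullet> (x0 + r *\<^sub>R \<nu>) \<le> c" "- (\<nu> \<bullet> (x0 - r *\<^sub>R \<nu>)) \<le> - c"
        using \<nu>(2) \<nu>'(3) eq \<open>c' = - c\<close> by force+
      moreover have "\<nu> \<bullet> \<nu> = 1" using \<nu>(1) by (simp add: dot_square_norm)
      ultimately show False using r(1) by (simp add: inner_add_right inner_diff_right)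
    qed
    ultimately show "\<nu>' = \<nu>" by blast
  qed
  then show ?thesis using that \<nu> by blast
qed

text \<open>The disc stems from the inscribed ball of K alone; as it lies in the common side it also
  serves K', whence the bound r instead of r' in the second condition for K'. The normals are
  opposite because otherwise both elements would contain the same half ball, although their
  interiors are disjoint.\<close>

lemma interior_side_geometry:
  fixes K :: "'a::euclidean_space set"
  assumes T: "simplicial_mesh \<Omega> T" and K: "K \<in> T" "K' \<in> T" "K \<noteq> K'"
    and \<gamma>: "\<gamma> facet_of K" "\<gamma> facet_of K'"
    and r: "r > 0" "cball x0 r \<subseteq> K" and r': "r' > 0" "cball x0' r' \<subseteq> K'"
  obtains c x\<gamma> where "norm (outer_normal K \<gamma>) = 1" "outer_normal K' \<gamma> = - outer_normal K \<gamma>"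
    "K \<subseteq> {x. outer_normal K \<gamma> \<bullet> x \<le> c}" "K' \<subseteq> {x. c \<le> outer_normal K \<gamma> \<bullet> x}"
    "outer_normal K \<gamma> \<bullet> x\<gamma> = c"
    "\<And>w. outer_normal K \<gamma> \<bullet> w = 0 \<Longrightarrow> norm w \<le> r \<Longrightarrow> x\<gamma> + w \<in> \<gamma>"
    "\<And>\<rho> w. \<rho> > 0 \<Longrightarrow> 2 * \<rho> \<le> r \<Longrightarrow> 2 * \<rho> * (1 + diameter K / r) \<le> r \<Longrightarrow> norm w \<le> \<rho> \<Longrightarrow>
      outer_normal K \<gamma> \<bullet> w \<le> 0 \<Longrightarrow> x\<gamma> + w \<in> K"
    "\<And>\<rho> w. \<rho> > 0 \<Longrightarrow> 2 * \<rho> \<le> r' \<Longrightarrow> 2 * \<rho> * (1 + diameter K' / r') \<le> r \<Longrightarrow> norm w \<le> \<rho> \<Longrightarrow>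
      0 \<le> outer_normal K \<gamma> \<bullet> w \<Longrightarrow> x\<gamma> + w \<in> K'"
proof -
  note mK = mesh_element[OF T K(1)] and mK' = mesh_element[OF T K(2)]
  define \<nu> where "\<nu> = outer_normal K \<gamma>"
  define \<nu>' where "\<nu>' = outer_normal K' \<gamma>"
  obtain c where c: "norm \<nu> = 1" "K \<subseteq> {x. \<nu> \<bullet> x \<le> c}" "\<gamma> = K \<inter> {x. \<nu> \<bullet> x = c}"
    by (rule outer_normal_facet[OF mK(1) \<gamma>(1) r, folded \<nu>_def]) (rule that)
  obtain c' where c': "norm \<nu>' = 1" "K' \<subseteq> {x. \<nu>' \<bullet> x \<le> c'}" "\<gamma> = K' \<inter> {x. \<nu>' \<bullet> x = c'}"
    by (rule outer_normal_facet[OF mK'(1) \<gamma>(2) r', folded \<nu>'_def]) (rule that)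
  obtain x\<gamma> where D: "\<And>w. \<nu> \<bullet> w = 0 \<Longrightarrow> norm w \<le> r \<Longrightarrow> x\<gamma> + w \<in> \<gamma>"
    by (rule simplex_facet_disc[OF mK(1) \<gamma>(1) r c]) (rule that)
  have x\<gamma>: "x\<gamma> \<in> \<gamma>" using D[of 0] r(1) by simp
  then have xc: "\<nu> \<bullet> x\<gamma> = c" "\<nu>' \<bullet> x\<gamma> = c'" "x\<gamma> \<in> K" "x\<gamma> \<in> K'" using c(3) c'(3) by blast+
  have \<nu>\<nu>: "\<nu> \<bullet> \<nu> = 1" using c(1) by (simp add: dot_square_norm)
  have pm: "\<nu>' = \<nu> \<or> \<nu>' = - \<nu>"
    by (rule normal_unique_up_to_sign[OF c(1) c'(1) r(1), of x\<gamma> c']) (use D c'(3) in blast)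
  have hb: "x\<gamma> + w \<in> K" if "\<rho> > 0" "2 * \<rho> \<le> r" "2 * \<rho> * (1 + diameter K / r) \<le> r" "norm w \<le> \<rho>" "\<nu> \<bullet> w \<le> 0" for \<rho> w
  proof (rule half_ball_subset[OF mK(2) _ r c(1,2) xc(1) _ that])
    show "dist x x\<gamma> \<le> diameter K" if "x \<in> K" for x
      using diameter_bounded_bound[OF compact_imp_bounded[OF mK(3)] that xc(3)] .
    show "x\<gamma> + w \<in> K" if "\<nu> \<bullet> w = 0" "norm w \<le> r" for w using D[OF that] c(3) by blast
  qed
  have hb': "x\<gamma> + w \<in> K'" if "\<rho> > 0" "2 * \<rho> \<le> r'" "2 * \<rho> * (1 + diameter K' / r') \<le> r" "norm w \<le> \<rho>" "\<nu>' \<bullet> w \<le> 0" for \<rho> w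
  proof (rule half_ball_subset[OF mK'(2) _ r' c'(1,2) xc(2) _ that])
    show "dist x x\<gamma> \<le> diameter K'" if "x \<in> K'" for x
      using diameter_bounded_bound[OF compact_imp_bounded[OF mK'(3)] that xc(4)] .
    show "x\<gamma> + w \<in> K'" if "\<nu>' \<bullet> w = 0" "norm w \<le> r" for w
      using D[of w] that pm c'(3) by auto
  qed
  have opp: "\<nu>' = - \<nu>"
  proof (rule ccontr)
    assume "\<nu>' \<noteq> - \<nu>"
    then have eq: "\<nu>' = \<nu>" using pm by blast
    have dn: "diameter K \<ge> 0" "diameter K' \<ge> 0"
      using mK(3) mK'(3) by (auto intro: diameter_ge_0 compact_imp_bounded)
    then have q: "1 + diameter K / r > 0" "1 + diameter K' / r' > 0"
      using r(1) r'(1) by (auto intro: add_pos_nonneg)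
    \<comment> \<open>The largest radius that meets all four conditions of the two half balls. The
      ball of radius \<rho>/2 around p then fits into the half ball of radius \<rho>.\<close>
    define \<rho> where "\<rho> = min (min (r / 2) (r' / 2))
      (min (r / (2 * (1 + diameter K / r))) (r / (2 * (1 + diameter K' / r'))))"
    have \<rho>: "\<rho> > 0" using r(1) r'(1) q by (simp add: \<rho>_def)
    have \<rho>1: "2 * \<rho> \<le> r" "2 * \<rho> \<le> r'" by (auto simp: \<rho>_def)
    have "2 * \<rho> * b \<le> r" if "\<rho> \<le> r / (2 * b)" "b > 0" for b
      using that by (simp add: pos_le_divide_eq mult.commute mult.left_commute)
    then have \<rho>2: "2 * \<rho> * (1 + diameter K / r) \<le> r" "2 * \<rho> * (1 + diameter K' / r') \<le> r"
      using q by (simp_all only: \<rho>_def min.cobounded1 min.cobounded2 min.coboundedI2)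
    define p where "p = x\<gamma> - (\<rho> / 2) *\<^sub>R \<nu>"
    have w: "norm (x - x\<gamma>) \<le> \<rho>" "\<nu> \<bullet> (x - x\<gamma>) \<le> 0" if "x \<in> ball p (\<rho> / 2)" for x
    proof -
      define v where "v = x - p"
      have v: "norm v < \<rho> / 2" using that by (simp add: v_def dist_norm norm_minus_commute)
      have x: "x - x\<gamma> = v - (\<rho> / 2) *\<^sub>R \<nu>" by (simp add: v_def p_def)
      have "norm (v - (\<rho> / 2) *\<^sub>R \<nu>) \<le> norm v + norm ((\<rho> / 2) *\<^sub>R \<nu>)" by (rule norm_triangle_ineq4)
      then show "norm (x - x\<gamma>) \<le> \<rho>" unfolding x using v c(1) \<rho> by simp
      show "\<nu> \<bullet> (x - x\<gamma>) \<le> 0"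
        unfolding x using Cauchy_Schwarz_ineq2[of \<nu> v] v c(1) \<nu>\<nu> by (simp add: inner_diff_right)
    qed
    have "ball p (\<rho> / 2) \<subseteq> K" "ball p (\<rho> / 2) \<subseteq> K'"
    proof -
      show "ball p (\<rho> / 2) \<subseteq> K"
      proof
        fix x assume "x \<in> ball p (\<rho> / 2)"
        from hb[OF \<rho> \<rho>1(1) \<rho>2(1) w[OF this]] show "x \<in> K" by simp
      qed
      show "ball p (\<rho> / 2) \<subseteq> K'"
      proof
        fix x assume "x \<in> ball p (\<rho> / 2)"
        from hb'[OF \<rho> \<rho>1(2) \<rho>2(2) w(1)[OF this]] w(2)[OF this] show "x \<in> K'" by (simp add: eq)
      qed
    qed
    then have "p \<in> interior K" "p \<in> interior K'" using \<rho> by (auto simp: mem_interior intro!: exI[of _ "\<rho> / 2"])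
    then show False using mesh_interiors_disjoint[OF T K(1,2)] K(3) by blast
  qed
  have cc: "c' = - c" using xc opp by simp
  show ?thesis
  proof (rule that[folded \<nu>_def \<nu>'_def])
    show "K' \<subseteq> {x. c \<le> \<nu> \<bullet> x}" using c'(2) opp cc by auto
    show "x\<gamma> + w \<in> K'" if "\<rho> > 0" "2 * \<rho> \<le> r'" "2 * \<rho> * (1 + diameter K' / r') \<le> r" "norm w \<le> \<rho>"
      "0 \<le> \<nu> \<bullet> w" for \<rho> w
      using hb'[OF that(1-4)] that(5) opp by simp
  qed (fact c opp xc(1) D hb)+
qed

text \<open>Any two elements sharing \<gamma> have opposite normals, so three distinct ones would
  produce a unit vector equal to its negative.\<close>

lemma elements_of_side:
  fixes K :: "'a::euclidean_space set"
  assumes T: "simplicial_mesh \<Omega> T" and K: "K \<in> T" "K' \<in> T" "K \<noteq> K'"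
    and \<gamma>: "\<gamma> facet_of K" "\<gamma> facet_of K'"
  shows "{K \<in> T. \<gamma> facet_of K} = {K, K'}"
proof (rule ccontr)
  have ball: "\<exists>x r. r > 0 \<and> cball x r \<subseteq> L" if "L \<in> T" for L
    using mesh_element(6)[OF T that] by (metis all_not_in_conv mem_interior_cball)
  assume "{K \<in> T. \<gamma> facet_of K} \<noteq> {K, K'}"
  then obtain L where L: "L \<in> T" "\<gamma> facet_of L" "L \<noteq> K" "L \<noteq> K'" using K \<gamma> by blast
  obtain x0 r x1 r1 x2 r2 where b: "r > 0" "cball x0 r \<subseteq> K" "r1 > 0" "cball x1 r1 \<subseteq> K'" "r2 > 0" "cball x2 r2 \<subseteq> L"
    using ball[OF K(1)] ball[OF K(2)] ball[OF L(1)] by blast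
  note geo = interior_side_geometry[OF T]
  have n1: "outer_normal K' \<gamma> = - outer_normal K \<gamma>"
    by (rule geo[OF K \<gamma> b(1-4)])
  have n2: "outer_normal L \<gamma> = - outer_normal K \<gamma>"
    by (rule geo[OF K(1) L(1) L(3)[symmetric] \<gamma>(1) L(2) b(1,2,5,6)])
  have n3: "outer_normal L \<gamma> = - outer_normal K' \<gamma>" "norm (outer_normal K' \<gamma>) = 1"
    by (rule geo[OF K(2) L(1) L(4)[symmetric] \<gamma>(2) L(2) b(3,4,5,6)], assumption)+
  have "outer_normal K' \<gamma> = - outer_normal K' \<gamma>" using n1 n2 n3(1) by simp
  then have "outer_normal K' \<gamma> \<bullet> outer_normal K' \<gamma> = - (outer_normal K' \<gamma> \<bullet> outer_normal K' \<gamma>)"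
    by (metis inner_minus_left)
  then show False using n3(2) by (simp add: dot_square_norm)
qed

lemma jump_eq:
  fixes K :: "'a::euclidean_space set"
  assumes T: "simplicial_mesh \<Omega> T" and K: "K \<in> T" "K' \<in> T" "K \<noteq> K'"
    and \<gamma>: "\<gamma> facet_of K" "\<gamma> facet_of K'"
  shows "jump T z \<gamma> = outer_normal K \<gamma> \<bullet> elem_grad z K + outer_normal K' \<gamma> \<bullet> elem_grad z K'"
  unfolding jump_def elements_of_side[OF assms] using K(3) by simp

text \<open>A facet of a simplex is opposite to one of its d + 1 vertices.\<close>

lemma card_sides_of:
  fixes K :: "'a::euclidean_space set"
  assumes "simplicial_mesh \<Omega> T" "K \<in> T"
  shows "finite (sides_of T K)" "card (sides_of T K) \<le> DIM('a) + 1"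
proof -
  obtain C where C: "finite C" "\<not> affine_dependent C" "int (card C) = int DIM('a) + 1" "K = convex hull C"
    using mesh_element(1)[OF assms] unfolding simplex by blast
  have "sides_of T K \<subseteq> (\<lambda>u. convex hull (C - {u})) ` C"
    using facet_of_convex_hull_affine_independent[OF C(2)] by (auto simp: sides_of_def C(4))
  then show "finite (sides_of T K)" "card (sides_of T K) \<le> DIM('a) + 1"
    using C(1,3) card_image_le[OF C(1), of "\<lambda>u. convex hull (C - {u})"]
      card_mono[OF finite_imageI[OF C(1)]] finite_subset[OF _ finite_imageI[OF C(1)]]
    by (force, fastforce)
qed

lemma side_neighbour:
  assumes "\<gamma> \<in> sides_of T K" "K \<in> T"
  obtains K' where "K' \<in> T" "K \<noteq> K'" "\<gamma> facet_of K" "\<gamma> facet_of K'" "K' \<in> patch T K"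
proof -
  obtain K1 K2 where 1: "K1 \<in> T" "K2 \<in> T" "K1 \<noteq> K2" "\<gamma> facet_of K1" "\<gamma> facet_of K2"
    using assms(1) by (auto simp: sides_of_def internal_sides_def)
  define K' where "K' = (if K1 = K then K2 else K1)"
  have K': "K' \<in> T" "K \<noteq> K'" "\<gamma> facet_of K'" using 1 by (auto simp: K'_def)
  have "\<gamma> \<in> sides_of T K'" using assms(1) K' by (auto simp: sides_of_def)
  then have "K' \<in> patch T K" using assms(1) K' by (auto simp: patch_def)
  then show ?thesis using that K' assms(1) by (auto simp: sides_of_def)
qed

section \<open>Element residuals\<close>

lemma measure_ball:
  fixes x :: "'a::euclidean_space"
  assumes "r \<ge> 0"
  shows "measure lebesgue (ball x r) = unit_ball_vol (real DIM('a)) * r ^ DIM('a)"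
    and "measure lebesgue (cball x r) = unit_ball_vol (real DIM('a)) * r ^ DIM('a)"
proof -
  show "measure lebesgue (ball x r) = unit_ball_vol (real DIM('a)) * r ^ DIM('a)"
    using content_ball[OF assms, of x] by simp
  then show "measure lebesgue (cball x r) = unit_ball_vol (real DIM('a)) * r ^ DIM('a)"
    using content_cball_conv_ball[of x r] by simp
qed

lemma measure_subset_cball:
  fixes x :: "'a::euclidean_space"
  assumes "r \<ge> 0" "S \<in> sets lebesgue" "S \<subseteq> cball x r"
  shows "measure lebesgue S \<le> unit_ball_vol (real DIM('a)) * r ^ DIM('a)"
proof -
  have "measure lebesgue S \<le> measure lebesgue (cball x r)"
    using assms by (intro measure_mono_fmeasurable) auto
  then show ?thesis using measure_ball(2)[OF assms(1), of x] by simp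
qed

lemma L2_norm_square_bound:
  assumes S: "S \<in> lmeasurable" and g: "g \<in> L2 S" "\<And>x. x \<in> S \<Longrightarrow> norm (g x) \<le> M"
  shows "(L2_norm S g)\<^sup>2 \<le> M\<^sup>2 * measure lebesgue S"
proof -
  interpret finite_measure "lebesgue_on S" using S by (rule finite_measure_lebesgue_on)
  have "(L2_norm S g)\<^sup>2 \<le> (LINT x|lebesgue_on S. M\<^sup>2)"
    unfolding L2_norm_square using g by (intro integral_mono L2_square_integrable) (auto intro: power_mono)
  also have "\<dots> = M\<^sup>2 * measure lebesgue S"
    using S by (simp add: measure_restrict_space fmeasurableD)
  finally show ?thesis .
qed

lemma L2_norm_cong_AE:
  assumes "g \<in> L2 S" "h \<in> L2 S" "AE x in lebesgue_on S. g x = h x"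
  shows "L2_norm S g = L2_norm S h"
proof -
  have "(LINT x|lebesgue_on S. (norm (g x))\<^sup>2) = (LINT x|lebesgue_on S. (norm (h x))\<^sup>2)"
  proof (rule integral_cong_AE)
    show "(\<lambda>x. (norm (g x))\<^sup>2) \<in> borel_measurable (lebesgue_on S)"
      "(\<lambda>x. (norm (h x))\<^sup>2) \<in> borel_measurable (lebesgue_on S)"
      using assms(1,2) by (auto intro: borel_measurable_integrable L2_square_integrable)
    show "AE x in lebesgue_on S. (norm (g x))\<^sup>2 = (norm (h x))\<^sup>2"
      using assms(3) by eventually_elim simp
  qed
  then show ?thesis by (simp add: L2_norm_def)
qed

text \<open>Cauchy-Schwarz is applied on the support of h, so that the volume of the small ball
  appears and not that of S. The norm of g is then enlarged to S, which will be an element, two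
  elements or a patch.\<close>

lemma ball_integral_bound:
  fixes g h :: "'a::euclidean_space \<Rightarrow> 'b::euclidean_space"
  assumes \<rho>: "\<rho> > 0" and \<Omega>: "ball x0 \<rho> \<subseteq> \<Omega>" "\<Omega> \<in> sets lebesgue"
    and S: "ball x0 \<rho> \<subseteq> S" "S \<in> sets lebesgue" and g: "g \<in> L2 S"
    and h: "h \<in> L2 (ball x0 \<rho>)" "\<And>x. norm (h x) \<le> M" "\<And>x. x \<notin> ball x0 \<rho> \<Longrightarrow> h x = 0"
  shows "(LINT x|lebesgue_on \<Omega>. g x \<bullet> h x)\<^sup>2
    \<le> M\<^sup>2 * (unit_ball_vol (real DIM('a)) * \<rho> ^ DIM('a)) * (L2_norm S g)\<^sup>2"
proof -
  let ?B = "ball x0 \<rho>"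
  have gB: "g \<in> L2 ?B" "L2_norm ?B g \<le> L2_norm S g"
    using L2_mono[OF g S(2) _ negligible_empty, of ?B] S(1) by auto
  have M0: "M \<ge> 0" using h(2)[of x0] norm_ge_zero order_trans by blast
  have "(LINT x|lebesgue_on ?B. g x \<bullet> h x) = (LINT x|lebesgue_on \<Omega>. g x \<bullet> h x)"
    by (rule lebesgue_on_eq_lebesgue_on) (use \<Omega> h(3) in auto)
  moreover have "\<bar>LINT x|lebesgue_on ?B. g x \<bullet> h x\<bar> \<le> M * (LINT x|lebesgue_on ?B. norm (g x))"
  proof -
    have "\<bar>LINT x|lebesgue_on ?B. g x \<bullet> h x\<bar> \<le> (LINT x|lebesgue_on ?B. \<bar>g x \<bullet> h x\<bar>)"
      by (rule integral_abs_bound)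
    also have "\<dots> \<le> (LINT x|lebesgue_on ?B. M * norm (g x))"
    proof (intro integral_mono)
      show "integrable (lebesgue_on ?B) (\<lambda>x. \<bar>g x \<bullet> h x\<bar>)"
        using L2_integrable_inner[OF gB(1) h(1)] by (rule integrable_abs)
      show "integrable (lebesgue_on ?B) (\<lambda>x. M * norm (g x))"
        using L2_Cauchy_Schwarz_1(1)[OF _ gB(1)] by simp
      have "\<bar>g x \<bullet> h x\<bar> \<le> norm (g x) * norm (h x)" for x by (rule Cauchy_Schwarz_ineq2)
      also have "norm (g x) * norm (h x) \<le> norm (g x) * M" for x by (intro mult_left_mono h(2)) simp
      finally show "\<bar>g x \<bullet> h x\<bar> \<le> M * norm (g x)" for x by (simp add: mult.commute)
    qed
    finally show ?thesis by simp
  qed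
  ultimately have "\<bar>LINT x|lebesgue_on \<Omega>. g x \<bullet> h x\<bar> \<le> M * (LINT x|lebesgue_on ?B. norm (g x))" by simp
  then have "(LINT x|lebesgue_on \<Omega>. g x \<bullet> h x)\<^sup>2 \<le> (M * (LINT x|lebesgue_on ?B. norm (g x)))\<^sup>2"
    using power_mono[OF _ abs_ge_zero, of _ _ 2] by fastforce
  also have "\<dots> = M\<^sup>2 * (LINT x|lebesgue_on ?B. norm (g x))\<^sup>2" by (rule power_mult_distrib)
  also have "\<dots> \<le> M\<^sup>2 * (measure lebesgue ?B * (L2_norm ?B g)\<^sup>2)"
    by (intro mult_left_mono L2_Cauchy_Schwarz_1(2) gB(1)) auto
  also have "\<dots> \<le> M\<^sup>2 * (measure lebesgue ?B * (L2_norm S g)\<^sup>2)"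
    by (intro mult_left_mono power_mono gB(2)) auto
  finally show ?thesis using measure_ball(1)[of \<rho> x0] \<rho> by (simp add: mult.assoc)
qed

lemma bump_integral_bounds:
  fixes x0 :: "'a::euclidean_space"
  assumes \<rho>: "\<rho> > 0" and \<Omega>: "ball x0 \<rho> \<subseteq> \<Omega>" "\<Omega> \<in> sets lebesgue"
    and S: "ball x0 \<rho> \<subseteq> S" "S \<in> sets lebesgue"
  shows "g \<in> L2 S \<Longrightarrow> (LINT x|lebesgue_on \<Omega>. g x * bump x0 \<rho> x)\<^sup>2
      \<le> (unit_ball_vol (real DIM('a)) * \<rho> ^ DIM('a)) * (L2_norm S g)\<^sup>2"
    and "G \<in> L2 S \<Longrightarrow> (\<And>x. norm (bump_grad x0 \<rho> x) \<le> C / \<rho>) \<Longrightarrow>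
      (LINT x|lebesgue_on \<Omega>. G x \<bullet> bump_grad x0 \<rho> x)\<^sup>2
      \<le> (C / \<rho>)\<^sup>2 * (unit_ball_vol (real DIM('a)) * \<rho> ^ DIM('a)) * (L2_norm S G)\<^sup>2"
proof -
  have b: "bump x0 \<rho> \<in> L2 (ball x0 \<rho>)" "bump_grad x0 \<rho> \<in> L2 (ball x0 \<rho>)"
    by (rule bump_L2[OF lmeasurable_ball \<rho>])+
  have "norm (bump x0 \<rho> x) \<le> 1" for x using bump_nonneg[of x0 \<rho> x] bump_le_1[of x0 \<rho> x] by simp
  from ball_integral_bound[OF assms _ b(1) this bump_outside(1)[OF \<rho>]]
  show "g \<in> L2 S \<Longrightarrow> (LINT x|lebesgue_on \<Omega>. g x * bump x0 \<rho> x)\<^sup>2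
      \<le> (unit_ball_vol (real DIM('a)) * \<rho> ^ DIM('a)) * (L2_norm S g)\<^sup>2" by simp
  show "G \<in> L2 S \<Longrightarrow> (\<And>x. norm (bump_grad x0 \<rho> x) \<le> C / \<rho>) \<Longrightarrow>
      (LINT x|lebesgue_on \<Omega>. G x \<bullet> bump_grad x0 \<rho> x)\<^sup>2
      \<le> (C / \<rho>)\<^sup>2 * (unit_ball_vol (real DIM('a)) * \<rho> ^ DIM('a)) * (L2_norm S G)\<^sup>2"
    by (rule ball_integral_bound[OF assms _ b(2) _ bump_outside(2)[OF \<rho>]])
qed

lemma integral_bump_lower:
  fixes x0 :: "'a::euclidean_space"
  assumes \<rho>: "\<rho> > 0" and \<Omega>: "ball x0 \<rho> \<subseteq> \<Omega>" "\<Omega> \<in> lmeasurable"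
  shows "exp (- (4 / 3)) * (unit_ball_vol (real DIM('a)) * (\<rho> / 2) ^ DIM('a)) \<le> (LINT x|lebesgue_on \<Omega>. bump x0 \<rho> x)"
proof -
  interpret finite_measure "lebesgue_on \<Omega>" using \<Omega>(2) by (rule finite_measure_lebesgue_on)
  have sb: "ball x0 (\<rho> / 2) \<subseteq> \<Omega>" using \<Omega>(1) \<rho> by (auto simp: subset_eq)
  have "(LINT x|lebesgue_on \<Omega>. exp (- (4 / 3)) * indicat_real (ball x0 (\<rho> / 2)) x)
      \<le> (LINT x|lebesgue_on \<Omega>. bump x0 \<rho> x)"
  proof (rule integral_mono)
    show "integrable (lebesgue_on \<Omega>) (\<lambda>x. exp (- (4 / 3)) * indicat_real (ball x0 (\<rho> / 2)) x)"
    proof (rule integrable_const_bound[where B = "exp (- (4 / 3))"])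
      have "ball x0 (\<rho> / 2) \<in> sets lebesgue" by simp
      then show "(\<lambda>x. exp (- (4 / 3)) * indicat_real (ball x0 (\<rho> / 2)) x) \<in> borel_measurable (lebesgue_on \<Omega>)"
        by (intro measurable_restrict_space1 borel_measurable_times borel_measurable_indicator) auto
    qed (simp add: indicator_def)
    show "integrable (lebesgue_on \<Omega>) (bump x0 \<rho>)"
      using L2_Cauchy_Schwarz_1(1)[OF \<Omega>(2) bump_L2(1)[OF \<Omega>(2) \<rho>, of x0]] by (simp add: bump_nonneg)
    show "exp (- (4 / 3)) * indicat_real (ball x0 (\<rho> / 2)) x \<le> bump x0 \<rho> x" for x
      using bump_lower[OF \<rho>, of x x0] bump_nonneg[of x0 \<rho> x] by (auto simp: indicator_def)
  qed
  moreover have "(LINT x|lebesgue_on \<Omega>. exp (- (4 / 3)) * indicat_real (ball x0 (\<rho> / 2)) x)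
      = exp (- (4 / 3)) * measure lebesgue (ball x0 (\<rho> / 2))"
    using sb \<Omega>(2) by (simp add: measure_restrict_space Int_absorb2[OF sb] fmeasurableD)
  ultimately show ?thesis using measure_ball(1)[of "\<rho> / 2" x0] \<rho> by simp
qed

text \<open>From x0 one moves by r/2 along the gradient, upwards if the value d at x0 is nonnegative
  and downwards otherwise, so that |d| and the gain |g| r/2 add up. On the ball of radius r/4 at
  most half of the gain is lost, and |d| + |g| r/4 is comparable to the bound |d| + |g| h since h
  \<le> \<kappa> r.\<close>

lemma affine_sign_ball:
  fixes g x0 :: "'a::euclidean_space"
  assumes r: "r > 0" "r \<le> h" and \<kappa>: "h \<le> \<kappa> * r"
  obtains x1 s M where "norm (x1 - x0) \<le> r / 2" "s = 1 \<or> s = - 1" "M \<ge> 0"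
    "\<And>x. x \<in> cball x0 h \<Longrightarrow> \<bar>c + g \<bullet> x\<bar> \<le> M"
    "\<And>x. x \<in> ball x1 (r / 4) \<Longrightarrow> M / (4 * \<kappa>) \<le> s * (c + g \<bullet> x)"
proof -
  define d where "d = c + g \<bullet> x0"
  define s :: real where "s = (if d \<ge> 0 then 1 else - 1)"
  define x1 where "x1 = x0 + (s * (r / 2)) *\<^sub>R sgn g"
  define M where "M = \<bar>d\<bar> + norm g * h"
  have s: "s = 1 \<or> s = - 1" "s * d = \<bar>d\<bar>" "s * s = 1" by (auto simp: s_def)
  have \<kappa>1: "\<kappa> \<ge> 1" using assms by (smt (verit) mult_le_cancel_right1)
  have aff: "c + g \<bullet> x = d + g \<bullet> (x - x0)" for x by (simp add: d_def inner_diff_right)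
  show ?thesis
  proof (rule that[OF _ s(1), of x1 M])
    have "norm (sgn g) \<le> 1" by (simp add: norm_sgn)
    then have "(r / 2) * norm (sgn g) \<le> r / 2" using r(1) by (intro mult_left_le) auto
    moreover have "\<bar>s * (r / 2)\<bar> = r / 2" using s(1) r(1) by auto
    ultimately show "norm (x1 - x0) \<le> r / 2" unfolding x1_def by simp
    show "M \<ge> 0" using r by (simp add: M_def)
    show "\<bar>c + g \<bullet> x\<bar> \<le> M" if "x \<in> cball x0 h" for x
    proof -
      have "\<bar>g \<bullet> (x - x0)\<bar> \<le> norm g * norm (x - x0)" by (rule Cauchy_Schwarz_ineq2)
      also have "\<dots> \<le> norm g * h" using that by (intro mult_left_mono) (auto simp: dist_norm norm_minus_commute)
      finally show ?thesis unfolding aff M_def by linarith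
    qed
    show "M / (4 * \<kappa>) \<le> s * (c + g \<bullet> x)" if x: "x \<in> ball x1 (r / 4)" for x
    proof -
      have "g \<bullet> sgn g = norm g"
        by (cases "g = 0") (simp_all add: sgn_div_norm dot_square_norm power2_eq_square)
      then have 1: "s * (g \<bullet> (x1 - x0)) = (r / 2) * norm g"
        using s(3) by (simp add: x1_def mult.assoc[symmetric])
      have "\<bar>g \<bullet> (x - x1)\<bar> \<le> norm g * norm (x - x1)" by (rule Cauchy_Schwarz_ineq2)
      also have "\<dots> \<le> norm g * (r / 4)" using x by (intro mult_left_mono) (auto simp: dist_norm norm_minus_commute)
      finally have "\<bar>s * (g \<bullet> (x - x1))\<bar> \<le> norm g * (r / 4)" using s(1) by (auto simp: abs_mult)
      moreover have "s * (c + g \<bullet> x) = \<bar>d\<bar> + s * (g \<bullet> (x1 - x0)) + s * (g \<bullet> (x - x1))"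
        unfolding aff by (simp add: s(2)[symmetric] inner_diff_right algebra_simps)
      moreover have "norm g * (r / 4) = (r * norm g) / 4" "r / 2 * norm g = (r * norm g) / 2" by simp_all
      ultimately have "\<bar>d\<bar> + norm g * (r / 4) \<le> s * (c + g \<bullet> x)" using 1 by linarith
      moreover have "M / (4 * \<kappa>) \<le> \<bar>d\<bar> + norm g * (r / 4)"
      proof -
        have "M \<le> 4 * \<kappa> * (\<bar>d\<bar> + norm g * (r / 4))"
        proof -
          have "\<bar>d\<bar> \<le> 4 * \<kappa> * \<bar>d\<bar>" using \<kappa>1 mult_right_mono[of 1 "4 * \<kappa>" "\<bar>d\<bar>"] by simp
          moreover have "norm g * h \<le> norm g * (\<kappa> * r)" using \<kappa> by (intro mult_left_mono) auto
          ultimately show ?thesis by (simp add: M_def algebra_simps)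
        qed
        then show ?thesis using \<kappa>1 by (simp add: divide_simps mult.commute)
      qed
      ultimately show ?thesis by linarith
    qed
  qed
qed

lemma square_diff3: "(a - b - c)\<^sup>2 \<le> 3 * (a\<^sup>2 + b\<^sup>2 + c\<^sup>2)" for a b c :: real
proof -
  have "0 \<le> (a + b)\<^sup>2 + (a + c)\<^sup>2 + (b - c)\<^sup>2" by simp
  then show ?thesis by (simp add: power2_eq_square algebra_simps)
qed

text \<open>The real arithmetic of the next estimate: \<open>w\<close> stands for the volume of a ball of radius \<open>\<rho>\<close>.\<close>

lemma residual_arithmetic:
  fixes M w \<kappa> C e S Q \<rho> I1 I2 I3 :: real
  assumes w: "w > 0" and \<rho>: "\<rho> > 0" and \<kappa>: "\<kappa> \<ge> 1" and M: "M \<ge> 0"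
    and low: "M / (4 * \<kappa>) * (exp (- (4 / 3)) * (w / 2 ^ n)) \<le> \<bar>I1 - I2 - I3\<bar>"
    and I1: "I1\<^sup>2 \<le> (C / \<rho>)\<^sup>2 * w * e\<^sup>2" and I2: "I2\<^sup>2 \<le> w * S\<^sup>2" and I3: "I3\<^sup>2 \<le> w * Q\<^sup>2"
    and h: "0 \<le> h" "h \<le> 4 * \<kappa> * \<rho>"
    and R: "R\<^sup>2 \<le> M\<^sup>2 * ((4 * \<kappa>) ^ n * w)"
  shows "h\<^sup>2 * R\<^sup>2 \<le> (4 * \<kappa>) ^ (n + 2) * (3 * (4 * \<kappa> * exp (4 / 3) * 2 ^ n)\<^sup>2 * (C\<^sup>2 + 1))
      * (e\<^sup>2 + h\<^sup>2 * S\<^sup>2 + h\<^sup>2 * Q\<^sup>2)"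
proof -
  \<comment> \<open>1/k collects the losses in the lower bound: 1/(4\<kappa>) from the ball of
    constant sign, e^(-4/3) from the bump on half its radius, 2^(-n) from the volume of that smaller
    ball.\<close>
  define k where "k = 4 * \<kappa> * exp (4 / 3) * 2 ^ n"
  have k: "k > 0" using \<kappa> by (simp add: k_def)
  have kM: "M / (4 * \<kappa>) * (exp (- (4 / 3)) * (w / 2 ^ n)) = M * w / k"
  proof -
    have "M / (4 * \<kappa>) * (1 / a * (w / b)) = M * w / (4 * \<kappa> * a * b)" for a b :: real
      by (simp add: mult.assoc)
    from this[of "exp (4 / 3)" "2 ^ n"] show ?thesis
      unfolding k_def exp_minus[of "4 / 3"] inverse_eq_divide .
  qed
  have "0 \<le> M * w / k" using M w k by simp
  then have "(M * w / k)\<^sup>2 \<le> \<bar>I1 - I2 - I3\<bar>\<^sup>2"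
    using low unfolding kM by (intro power_mono) auto
  also have "\<dots> \<le> 3 * (I1\<^sup>2 + I2\<^sup>2 + I3\<^sup>2)" using square_diff3[of I1 I2 I3] by simp
  also have "\<dots> \<le> 3 * ((C / \<rho>)\<^sup>2 * w * e\<^sup>2 + w * S\<^sup>2 + w * Q\<^sup>2)"
    using I1 I2 I3 by (intro mult_left_mono add_mono) auto
  finally have "M\<^sup>2 * w * w / k\<^sup>2 \<le> 3 * ((C / \<rho>)\<^sup>2 * e\<^sup>2 + S\<^sup>2 + Q\<^sup>2) * w"
    by (simp add: power_divide power_mult_distrib power2_eq_square algebra_simps)
  then have "M\<^sup>2 * w / k\<^sup>2 \<le> 3 * ((C / \<rho>)\<^sup>2 * e\<^sup>2 + S\<^sup>2 + Q\<^sup>2)"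
    using mult_right_le_imp_le[OF _ w, of "M\<^sup>2 * w / k\<^sup>2"] by simp
  then have Mw: "M\<^sup>2 * w \<le> 3 * k\<^sup>2 * ((C / \<rho>)\<^sup>2 * e\<^sup>2 + S\<^sup>2 + Q\<^sup>2)"
  proof -
    have "a \<le> 3 * b * z" if "a / b \<le> 3 * z" "b > 0" for a b z :: real
      using that by (simp add: pos_divide_le_eq mult.commute mult.left_commute)
    from this[OF \<open>M\<^sup>2 * w / k\<^sup>2 \<le> _\<close>] k show ?thesis by simp
  qed
  define q where "q = 4 * \<kappa>"
  have q: "q \<ge> 1" using \<kappa> by (simp add: q_def)
  \<comment> \<open>The weight h compensates the 1/\<rho> of the bump gradient. Taking C^2 + 1
    instead of C^2 makes the same factor at least 1, so that it covers the terms without C.\<close>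
  have hq: "h\<^sup>2 * (C / \<rho>)\<^sup>2 \<le> q\<^sup>2 * (C\<^sup>2 + 1)"
  proof -
    have "h / \<rho> \<le> q" using h \<rho> by (simp add: q_def pos_divide_le_eq)
    then have "(h / \<rho>)\<^sup>2 \<le> q\<^sup>2" using h(1) \<rho> by (intro power_mono) auto
    then have "(h / \<rho>)\<^sup>2 * C\<^sup>2 \<le> q\<^sup>2 * (C\<^sup>2 + 1)" by (intro mult_mono) auto
    then show ?thesis by (simp add: power_divide)
  qed
  have q1: "1 \<le> q\<^sup>2 * (C\<^sup>2 + 1)"
  proof -
    have "1 * 1 \<le> q\<^sup>2 * (C\<^sup>2 + 1)" using q by (intro mult_mono) auto
    then show ?thesis by simp
  qed
  have "h\<^sup>2 * R\<^sup>2 \<le> h\<^sup>2 * (q ^ n * (M\<^sup>2 * w))"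
    using R by (intro mult_left_mono) (auto simp: q_def mult.commute mult.left_commute)
  also have "\<dots> \<le> h\<^sup>2 * (q ^ n * (3 * k\<^sup>2 * ((C / \<rho>)\<^sup>2 * e\<^sup>2 + S\<^sup>2 + Q\<^sup>2)))"
    using Mw q by (intro mult_left_mono) auto
  also have "\<dots> = q ^ n * (3 * k\<^sup>2) * ((h\<^sup>2 * (C / \<rho>)\<^sup>2) * e\<^sup>2 + 1 * (h\<^sup>2 * S\<^sup>2) + 1 * (h\<^sup>2 * Q\<^sup>2))"
    by (simp add: algebra_simps)
  also have "\<dots> \<le> q ^ n * (3 * k\<^sup>2) * ((q\<^sup>2 * (C\<^sup>2 + 1)) * e\<^sup>2 + (q\<^sup>2 * (C\<^sup>2 + 1)) * (h\<^sup>2 * S\<^sup>2) + (q\<^sup>2 * (C\<^sup>2 + 1)) * (h\<^sup>2 * Q\<^sup>2))"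
    using q by (intro mult_left_mono add_mono mult_right_mono hq q1) auto
  also have "\<dots> = q ^ (n + 2) * (3 * k\<^sup>2 * (C\<^sup>2 + 1)) * (e\<^sup>2 + h\<^sup>2 * S\<^sup>2 + h\<^sup>2 * Q\<^sup>2)"
    unfolding power_add by (simp only: algebra_simps)
  finally show ?thesis by (simp only: q_def k_def)
qed

text \<open>Here y is the finite element function, E stands for the gradient of its error, and the
  data are s + q. For the state, \<open>s\<close>, \<open>s\<^sub>T\<close> and \<open>q\<close> are
  the exact control, the discrete control and f; for the adjoint they are the exact state, the
  discrete state and \<open>- y\<^sub>\<Omega>\<close>. Piecewise constant controls are affine on
  closed elements only almost everywhere.\<close>

locale galerkin_residual =
  fixes \<Omega> :: "'a::euclidean_space set" and T y s s\<^sub>T q E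
  assumes \<Omega>: "lipschitz_polytopal_domain \<Omega>" and T: "simplicial_mesh \<Omega> T"
    and y: "y \<in> fe_space \<Omega> T"
    and data: "s \<in> L2 \<Omega>" "s\<^sub>T \<in> L2 \<Omega>" "q \<in> L2 \<Omega>" "E \<in> L2 \<Omega>"
    and affine: "\<And>K. K \<in> T \<Longrightarrow> \<exists>p\<in>polys 1. AE x in lebesgue_on K. s\<^sub>T x = p x"
    and residual: "\<And>x0 r. r > 0 \<Longrightarrow> cball x0 r \<subseteq> \<Omega> \<Longrightarrow>
      (LINT x|lebesgue_on \<Omega>. E x \<bullet> bump_grad x0 r x) + (LINT x|lebesgue_on \<Omega>. pw_grad T y x \<bullet> bump_grad x0 r x)
        = (LINT x|lebesgue_on \<Omega>. (s x + q x) * bump x0 r x)"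
begin

lemma domain: "open \<Omega>" "bounded \<Omega>" "\<Omega> \<in> lmeasurable" "\<Omega> \<in> sets lebesgue"
  using \<Omega> by (auto simp: lipschitz_polytopal_domain_def intro: lmeasurable_open)

lemma L2_closure:
  assumes "g \<in> L2 \<Omega>" "S \<subseteq> closure \<Omega>" "S \<in> sets lebesgue"
  shows "g \<in> L2 S"
  using L2_mono(1)[OF assms(1) domain(4) assms(3) mesh_measure(1)[OF \<Omega> T]] assms(2)
    mesh_measure(2)[OF \<Omega> T] by simp

lemma polys_L2: "p \<in> polys l \<Longrightarrow> S \<in> lmeasurable \<Longrightarrow> bounded S \<Longrightarrow> p \<in> L2 S"
proof -
  assume p: "p \<in> polys l" and S: "S \<in> lmeasurable" "bounded S"
  obtain c g where pe: "p = (\<lambda>x. c + g \<bullet> x)" using p by (auto simp: polys_def)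
  then have c: "continuous_on A p" for A by (auto intro!: continuous_intros)
  have "p \<in> L2 (closure S)" using S(2) by (intro L2_continuous c) (simp add: compact_closure)
  from L2_mono(1)[OF this _ _ negligible_empty] show "p \<in> L2 S"
    using S closure_subset[of S] by (auto simp: fmeasurableD)
qed

lemma element_measurable: "K \<in> T \<Longrightarrow> K \<in> sets lebesgue" "K \<in> T \<Longrightarrow> K \<in> lmeasurable"
  using mesh_element(3)[OF T] by (auto intro: lmeasurable_compact fmeasurableD)

lemma element_interior: "K \<in> T \<Longrightarrow> interior K \<subseteq> \<Omega>"
  using interior_mono[OF mesh_element(7)[OF T]] interior_closure_lipschitz[OF \<Omega>] by blast

text \<open>With the affine part R = p + P of the residual, the tested equation reads \<integral> R
  bump = I1 - I2 - I3, where the terms on the right come from the error, the data error and the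
  oscillation. On the chosen ball R keeps its sign, so the left side controls the maximum of |R|
  times the volume of the ball.\<close>

lemma element_residual_bound:
  assumes K: "K \<in> T" and r: "r > 0" "cball x0 r \<subseteq> K" and \<kappa>: "diameter K \<le> \<kappa> * r"
    and C: "\<And>(x0::'a) r x. r > 0 \<Longrightarrow> norm (bump_grad x0 r x) \<le> C / r" and P: "P \<in> polys 1"
  shows "(diameter K)\<^sup>2 * (L2_norm K (\<lambda>x. s\<^sub>T x + q x))\<^sup>2 \<le>
    (2 * ((4 * \<kappa>) ^ (DIM('a) + 2) * (3 * (4 * \<kappa> * exp (4 / 3) * 2 ^ DIM('a))\<^sup>2 * (C\<^sup>2 + 1))) + 2)
    * ((L2_norm K E)\<^sup>2 + (diameter K)\<^sup>2 * (L2_norm K (\<lambda>x. s x - s\<^sub>T x))\<^sup>2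
       + (diameter K)\<^sup>2 * (L2_norm K (\<lambda>x. q x - P x))\<^sup>2)"
proof -
  define h where "h = diameter K"
  note mK = mesh_element[OF T K] and sK = element_measurable[OF K]
  have rh: "2 * r \<le> h" unfolding h_def
    using diameter_subset[OF r(2) compact_imp_bounded[OF mK(3)]] r(1) by simp
  obtain p where p: "p \<in> polys 1" "AE x in lebesgue_on K. s\<^sub>T x = p x" using affine[OF K] by blast
  obtain c1 g1 c2 g2 where pP: "p = (\<lambda>x. c1 + g1 \<bullet> x)" "P = (\<lambda>x. c2 + g2 \<bullet> x)"
    using p(1) P by (auto simp: polys_def)
  define R where "R x = (c1 + c2) + (g1 + g2) \<bullet> x" for x
  have Rp: "R \<in> polys 1" by (auto simp: polys_def R_def[abs_def])
  have Req: "p x + P x = R x" for x by (simp add: pP R_def inner_add_left)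
  obtain x1 \<sigma> M where x1: "norm (x1 - x0) \<le> r / 2" and \<sigma>: "\<sigma> = 1 \<or> \<sigma> = - 1" and M: "M \<ge> 0"
    "\<And>x. x \<in> cball x0 h \<Longrightarrow> \<bar>R x\<bar> \<le> M" "\<And>x. x \<in> ball x1 (r / 4) \<Longrightarrow> M / (4 * \<kappa>) \<le> \<sigma> * R x"
    unfolding R_def by (rule affine_sign_ball[of r h \<kappa> x0 "c1 + c2" "g1 + g2"])
      (use r rh \<kappa> in \<open>auto simp: h_def\<close>)
  have \<kappa>1: "\<kappa> \<ge> 1"
  proof (rule ccontr)
    assume "\<not> \<kappa> \<ge> 1"
    then have "\<kappa> * r \<le> 1 * r" using r(1) by (intro mult_right_mono) auto
    then show False using \<kappa> rh r(1) unfolding h_def by linarith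
  qed
  \<comment> \<open>The shift r/2 of the centre and the radius r/4 add up to less than r, so the
    closed ball lies in the interior of K and hence in \<Omega>.\<close>
  define \<rho> where "\<rho> = r / 4"
  have \<rho>: "\<rho> > 0" using r by (simp add: \<rho>_def)
  have cK: "cball x1 \<rho> \<subseteq> interior K"
  proof -
    have "cball x1 \<rho> \<subseteq> ball x0 r"
    proof
      fix x assume "x \<in> cball x1 \<rho>"
      then have "dist x0 x \<le> r / 2 + r / 4"
        using dist_triangle[of x0 x x1] x1 by (simp add: \<rho>_def dist_norm norm_minus_commute)
      then show "x \<in> ball x0 r" using r(1) by simp
    qed
    moreover have "ball x0 r \<subseteq> interior K"
      using r(2) ball_subset_cball[of x0 r] by (intro interior_maximal) auto
    ultimately show ?thesis by blast
  qed
  then have c\<Omega>: "cball x1 \<rho> \<subseteq> \<Omega>" using element_interior[OF K] by blast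
  have bK: "ball x1 \<rho> \<subseteq> interior K" "ball x1 \<rho> \<subseteq> K" "ball x1 \<rho> \<subseteq> \<Omega>"
    using cK c\<Omega> interior_subset[of K] ball_subset_cball[of x1 \<rho>] by blast+
  have b0: "bump x1 \<rho> x = 0" "bump_grad x1 \<rho> x = 0" if "x \<notin> ball x1 \<rho>" for x
    using bump_outside[OF \<rho> that] .
  note L2K = L2_closure[OF _ mK(7) sK(1)]
  note bumpL2 = bump_L2[OF domain(3) \<rho>, of x1]
  have sd: "(\<lambda>x. s x - s\<^sub>T x) \<in> L2 \<Omega>" by (rule L2_diff[OF data(1,2)])
  have P\<Omega>: "P \<in> L2 \<Omega>" "R \<in> L2 \<Omega>" using polys_L2[OF _ domain(3,2)] P Rp by auto
  have qd: "(\<lambda>x. q x - P x) \<in> L2 \<Omega>" by (rule L2_diff[OF data(3) P\<Omega>(1)])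
  define I1 where "I1 = (LINT x|lebesgue_on \<Omega>. E x \<bullet> bump_grad x1 \<rho> x)"
  define I2 where "I2 = (LINT x|lebesgue_on \<Omega>. (s x - s\<^sub>T x) * bump x1 \<rho> x)"
  define I3 where "I3 = (LINT x|lebesgue_on \<Omega>. (q x - P x) * bump x1 \<rho> x)"
  have i: "integrable (lebesgue_on \<Omega>) (\<lambda>x. f x * bump x1 \<rho> x)" if "f \<in> L2 \<Omega>" for f :: "'a \<Rightarrow> real"
    using L2_integrable_inner[OF that bumpL2(1)] by simp
  have zero: "(LINT x|lebesgue_on \<Omega>. pw_grad T y x \<bullet> bump_grad x1 \<rho> x) = 0"
  proof -
    define d where "d = elem_grad y K"
    have "(LINT x|lebesgue_on \<Omega>. pw_grad T y x \<bullet> bump_grad x1 \<rho> x) = (LINT x|lebesgue_on \<Omega>. 1 * (bump_grad x1 \<rho> x \<bullet> d))"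
    proof (rule Bochner_Integration.integral_cong[OF refl])
      show "pw_grad T y x \<bullet> bump_grad x1 \<rho> x = 1 * (bump_grad x1 \<rho> x \<bullet> d)" for x
        using b0(2)[of x] pw_grad_eq[OF T K, of x y] bK(1)
        by (cases "x \<in> ball x1 \<rho>") (auto simp: d_def inner_commute)
    qed
    also have "\<dots> = (LINT x|lborel. 1 * (bump_grad x1 \<rho> x \<bullet> d))"
    proof (rule lebesgue_on_eq_lborel(1)[OF _ domain(4)])
      show "(\<lambda>x. 1 * (bump_grad x1 \<rho> x \<bullet> d)) \<in> borel_measurable borel"
        by (intro borel_measurable_continuous_onI continuous_on_mult continuous_on_const
            continuous_on_inner continuous_on_bump_grad)
      show "1 * (bump_grad x1 \<rho> x \<bullet> d) = 0" if "x \<notin> \<Omega>" for x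
      proof -
        have "x \<notin> ball x1 \<rho>" using that bK(3) by blast
        from b0(2)[OF this] show ?thesis by simp
      qed
    qed
    also have "\<dots> = 0" by (rule integral_bump_grad_translation_invariant[OF \<rho>, of _ 1]) auto
    finally show ?thesis .
  qed
  have Rint: "(LINT x|lebesgue_on \<Omega>. R x * bump x1 \<rho> x) = I1 - I2 - I3"
  proof -
    have "AE x in lebesgue. x \<in> K \<longrightarrow> s\<^sub>T x = p x"
      using p(2) sK(1) by (simp add: AE_restrict_space_iff)
    then have "AE x in lebesgue_on \<Omega>. (s x + q x) * bump x1 \<rho> x
        = (s x - s\<^sub>T x) * bump x1 \<rho> x + (q x - P x) * bump x1 \<rho> x + R x * bump x1 \<rho> x"
      using domain(4) unfolding AE_restrict_space_iff[of \<Omega> lebesgue, simplified, OF domain(4)]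
    proof eventually_elim
      case (elim x)
      show ?case
      proof (cases "x \<in> ball x1 \<rho>")
        case True
        then have "s\<^sub>T x = p x" using elim bK(2) by blast
        then show ?thesis by (simp add: Req[symmetric] algebra_simps)
      qed (simp add: b0(1))
    qed
    then have "(LINT x|lebesgue_on \<Omega>. (s x + q x) * bump x1 \<rho> x)
        = (LINT x|lebesgue_on \<Omega>. (s x - s\<^sub>T x) * bump x1 \<rho> x + (q x - P x) * bump x1 \<rho> x + R x * bump x1 \<rho> x)"
      using i[OF L2_add[OF data(1,3)]] i[OF sd] i[OF qd] i[OF P\<Omega>(2)]
      by (intro integral_cong_AE borel_measurable_integrable Bochner_Integration.integrable_add) auto
    also have "\<dots> = I2 + I3 + (LINT x|lebesgue_on \<Omega>. R x * bump x1 \<rho> x)"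
      using i[OF sd] i[OF qd] i[OF P\<Omega>(2)] by (simp add: I2_def I3_def)
    finally show ?thesis using residual[OF \<rho> c\<Omega>] zero by (simp add: I1_def)
  qed
  define w where "w = unit_ball_vol (real DIM('a)) * \<rho> ^ DIM('a)"
  have w: "w > 0" using \<rho> by (simp add: w_def unit_ball_vol_pos)
  have low: "M / (4 * \<kappa>) * (exp (- (4 / 3)) * (w / 2 ^ DIM('a))) \<le> \<bar>I1 - I2 - I3\<bar>"
  proof -
    have "exp (- (4 / 3)) * (w / 2 ^ DIM('a)) \<le> (LINT x|lebesgue_on \<Omega>. bump x1 \<rho> x)"
      using integral_bump_lower[OF \<rho> bK(3) domain(3)] by (simp add: w_def power_divide)
    then have "M / (4 * \<kappa>) * (exp (- (4 / 3)) * (w / 2 ^ DIM('a)))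
        \<le> M / (4 * \<kappa>) * (LINT x|lebesgue_on \<Omega>. bump x1 \<rho> x)"
      using M(1) \<kappa>1 by (intro mult_left_mono) auto
    also have "\<dots> = (LINT x|lebesgue_on \<Omega>. M / (4 * \<kappa>) * bump x1 \<rho> x)" by simp
    also have "\<dots> \<le> (LINT x|lebesgue_on \<Omega>. \<sigma> * (R x * bump x1 \<rho> x))"
    proof (rule integral_mono)
      have "(\<lambda>_. M / (4 * \<kappa>)) \<in> L2 \<Omega>" using domain(3) by (intro L2_bounded[of _ _ "\<bar>M / (4 * \<kappa>)\<bar>"]) auto
      then show "integrable (lebesgue_on \<Omega>) (\<lambda>x. M / (4 * \<kappa>) * bump x1 \<rho> x)" by (rule i)
      show "integrable (lebesgue_on \<Omega>) (\<lambda>x. \<sigma> * (R x * bump x1 \<rho> x))"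
        using i[OF P\<Omega>(2)] by (intro integrable_mult_right)
      show "M / (4 * \<kappa>) * bump x1 \<rho> x \<le> \<sigma> * (R x * bump x1 \<rho> x)" for x
      proof (cases "x \<in> ball x1 \<rho>")
        case True
        then have "M / (4 * \<kappa>) * bump x1 \<rho> x \<le> (\<sigma> * R x) * bump x1 \<rho> x"
          using M(3)[of x] by (intro mult_right_mono bump_nonneg) (simp add: \<rho>_def)
        then show ?thesis by (simp add: mult.assoc)
      qed (simp add: b0(1))
    qed
    also have "\<dots> = \<sigma> * (I1 - I2 - I3)" using Rint by simp
    also have "\<dots> \<le> \<bar>I1 - I2 - I3\<bar>" using \<sigma> by auto
    finally show ?thesis .
  qed
  note bounds = bump_integral_bounds[OF \<rho> bK(3) domain(4) bK(2) sK(1)]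
  have I: "I1\<^sup>2 \<le> (C / \<rho>)\<^sup>2 * w * (L2_norm K E)\<^sup>2" "I2\<^sup>2 \<le> w * (L2_norm K (\<lambda>x. s x - s\<^sub>T x))\<^sup>2"
    "I3\<^sup>2 \<le> w * (L2_norm K (\<lambda>x. q x - P x))\<^sup>2"
    unfolding I1_def I2_def I3_def w_def
    using bounds(2)[OF L2K[OF data(4)] C[OF \<rho>]] bounds(1)[OF L2K[OF sd]] bounds(1)[OF L2K[OF qd]] by auto
  have h: "0 \<le> h" "h \<le> 4 * \<kappa> * \<rho>" using rh r(1) \<kappa> by (auto simp: h_def \<rho>_def)
  \<comment> \<open>M bounds R on this larger ball. Its volume is compared with that of the bump
    ball by h \<le> 4\<kappa>\<rho>.\<close>
  have KC: "K \<subseteq> cball x0 h"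
  proof
    fix x assume "x \<in> K"
    moreover have "x0 \<in> K" using r by auto
    ultimately show "x \<in> cball x0 h"
      using diameter_bounded_bound[OF compact_imp_bounded[OF mK(3)], of x0 x] by (simp add: h_def)
  qed
  have "(L2_norm K R)\<^sup>2 \<le> M\<^sup>2 * measure lebesgue K"
    using M(2) KC by (intro L2_norm_square_bound sK(2) L2K P\<Omega>(2)) auto
  also have "\<dots> \<le> M\<^sup>2 * (unit_ball_vol (real DIM('a)) * h ^ DIM('a))"
    by (intro mult_left_mono measure_subset_cball[OF h(1) sK(1) KC]) auto
  also have "\<dots> \<le> M\<^sup>2 * (unit_ball_vol (real DIM('a)) * (4 * \<kappa> * \<rho>) ^ DIM('a))"
    using h by (intro mult_left_mono power_mono) (auto simp: unit_ball_vol_nonneg)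
  finally have "(L2_norm K R)\<^sup>2 \<le> M\<^sup>2 * ((4 * \<kappa>) ^ DIM('a) * w)"
    by (simp add: w_def power_mult_distrib mult_ac)
  note RB = residual_arithmetic[OF w \<rho> \<kappa>1 M(1) low I h this]
  have "AE x in lebesgue_on K. s\<^sub>T x + q x = R x + (q x - P x)"
    using p(2) by eventually_elim (simp add: Req[symmetric])
  then have "(L2_norm K (\<lambda>x. s\<^sub>T x + q x))\<^sup>2 = (L2_norm K (\<lambda>x. R x + (q x - P x)))\<^sup>2"
    using L2_norm_cong_AE[OF L2K[OF L2_add[OF data(2,3)]] L2K[OF L2_add[OF P\<Omega>(2) qd]]] by simp
  also have "\<dots> \<le> 2 * (L2_norm K R)\<^sup>2 + 2 * (L2_norm K (\<lambda>x. q x - P x))\<^sup>2"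
    by (rule L2_norm_add_square[OF L2K[OF P\<Omega>(2)] L2K[OF qd]])
  finally have "h\<^sup>2 * (L2_norm K (\<lambda>x. s\<^sub>T x + q x))\<^sup>2
      \<le> h\<^sup>2 * (2 * (L2_norm K R)\<^sup>2 + 2 * (L2_norm K (\<lambda>x. q x - P x))\<^sup>2)"
    by (intro mult_left_mono) auto
  then have fin: "h\<^sup>2 * (L2_norm K (\<lambda>x. s\<^sub>T x + q x))\<^sup>2
      \<le> 2 * (h\<^sup>2 * (L2_norm K R)\<^sup>2) + 2 * (h\<^sup>2 * (L2_norm K (\<lambda>x. q x - P x))\<^sup>2)"
    by (simp add: algebra_simps)
  \<comment> \<open>The added 2 pays for q - P, which is split off before R is estimated.\<close>
  have "2 * x + 2 * c \<le> (2 * A + 2) * (a + b + c)" if "x \<le> A * (a + b + c)" "0 \<le> a" "0 \<le> b" for x A a b c :: real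
    using that by (simp add: algebra_simps)
  from this[OF RB] fin show ?thesis unfolding h_def by simp
qed

end

section \<open>Jump residuals\<close>

text \<open>The prism of height \<open>1\<close> over a side of diameter \<open>h\<close> is covered by \<open>1 + 1 / h\<close> balls of
  radius \<open>2 * h\<close>.\<close>

lemma hyperplane_measure_bound:
  fixes \<nu> :: "'a::euclidean_space"
  assumes \<nu>: "norm \<nu> = 1" and h: "h > 0" and \<gamma>: "\<gamma> \<in> sets borel" "\<gamma> \<subseteq> cball g0 h"
  shows "measure (hyperplane_measure \<nu> c) \<gamma> \<le> (1 / h + 1) * (unit_ball_vol (real DIM('a)) * (2 * h) ^ DIM('a))"
proof -
  define Z where "Z = {x. c \<le> \<nu> \<bullet> x \<and> \<nu> \<bullet> x \<le> c + 1}"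
  define f where "f x = x - (\<nu> \<bullet> x - c) *\<^sub>R \<nu>" for x
  have Z: "closed Z"
  proof -
    have "Z = {x. c \<le> \<nu> \<bullet> x} \<inter> {x. \<nu> \<bullet> x \<le> c + 1}" by (auto simp: Z_def)
    then show ?thesis using closed_halfspace_le[of \<nu> "c + 1"] closed_halfspace_ge[of c \<nu>] by auto
  qed
  have f: "f \<in> borel_measurable borel"
    unfolding f_def[abs_def] by (intro borel_measurable_continuous_onI continuous_intros)
  have fm: "f \<in> measurable (restrict_space lborel Z) borel"
    by (rule measurable_restrict_space1) (use f in simp)
  have pre: "f -` \<gamma> \<inter> Z \<in> sets borel"
    using measurable_sets[OF f \<gamma>(1)] Z by (intro sets.Int) auto
  have "measure (hyperplane_measure \<nu> c) \<gamma> = measure (restrict_space lborel Z) (f -` \<gamma> \<inter> space (restrict_space lborel Z))"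
    unfolding hyperplane_measure_def Z_def[symmetric] f_def[abs_def, symmetric]
    by (rule measure_distr[OF fm \<gamma>(1)])
  also have "space (restrict_space lborel Z) = Z" by (simp add: space_restrict_space)
  also have "measure (restrict_space lborel Z) (f -` \<gamma> \<inter> Z) = measure lborel (f -` \<gamma> \<inter> Z)"
    using Z by (intro measure_restrict_space) auto
  finally have 1: "measure (hyperplane_measure \<nu> c) \<gamma> = measure lebesgue (f -` \<gamma> \<inter> Z)" using pre by simp
  define N where "N = nat \<lfloor>1 / h\<rfloor>"
  define B where "B j = cball (g0 + (real j * h) *\<^sub>R \<nu>) (2 * h)" for j
  have sub: "f -` \<gamma> \<inter> Z \<subseteq> (\<Union>j\<in>{..N}. B j)"
  proof
    fix x assume x: "x \<in> f -` \<gamma> \<inter> Z"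
    define t where "t = \<nu> \<bullet> x - c"
    have t: "0 \<le> t" "t \<le> 1" using x by (auto simp: t_def Z_def)
    have g: "norm (f x - g0) \<le> h" using x \<gamma>(2) by (auto simp: subset_eq dist_norm norm_minus_commute)
    \<comment> \<open>A point at height t is within h of the height j h, and its foot is within h of
      \<open>g0\<close>; this gives the radius 2h.\<close>
    define j where "j = nat \<lfloor>t / h\<rfloor>"
    have th: "0 \<le> t / h" "t / h \<le> 1 / h" using t h by (auto intro: divide_right_mono)
    have j: "real j \<le> t / h" "t / h \<le> real j + 1"
      using th(1) by (auto simp: j_def)
    have "j \<le> N" unfolding j_def N_def using th(2) by (intro nat_mono floor_mono)
    have "real j * h \<le> t" "t \<le> real j * h + h"
      using j h by (auto simp: pos_le_divide_eq pos_divide_le_eq algebra_simps)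
    then have th2: "\<bar>t - real j * h\<bar> \<le> h" by simp
    have "x - (g0 + (real j * h) *\<^sub>R \<nu>) = (f x - g0) + (t - real j * h) *\<^sub>R \<nu>"
      by (simp add: f_def t_def algebra_simps)
    then have "norm (x - (g0 + (real j * h) *\<^sub>R \<nu>)) \<le> norm (f x - g0) + norm ((t - real j * h) *\<^sub>R \<nu>)"
      by (metis norm_triangle_ineq)
    also have "\<dots> \<le> h + h" using g th2 \<nu> by (intro add_mono) auto
    finally have "x \<in> B j" by (simp add: B_def dist_norm norm_minus_commute)
    then show "x \<in> (\<Union>j\<in>{..N}. B j)" using \<open>j \<le> N\<close> by blast
  qed
  have "measure lebesgue (f -` \<gamma> \<inter> Z) \<le> measure lebesgue (\<Union>j\<in>{..N}. B j)"
    using sub pre by (intro measure_mono_fmeasurable) (auto simp: B_def intro!: fmeasurable.finite_UN)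
  also have "\<dots> \<le> (\<Sum>j\<in>{..N}. measure lebesgue (B j))"
    by (intro measure_UNION_le) (auto simp: B_def)
  also have "\<dots> = (real N + 1) * (unit_ball_vol (real DIM('a)) * (2 * h) ^ DIM('a))"
  proof -
    have "measure lebesgue (B j) = unit_ball_vol (real DIM('a)) * (2 * h) ^ DIM('a)" for j
      unfolding B_def by (rule measure_ball(2)) (use h in simp)
    then show ?thesis by (simp only: sum_constant card_atMost) simp
  qed
  also have "\<dots> \<le> (1 / h + 1) * (unit_ball_vol (real DIM('a)) * (2 * h) ^ DIM('a))"
  proof (intro mult_right_mono add_right_mono)
    show "real N \<le> 1 / h" using h by (simp add: N_def)
  qed (use h in \<open>auto simp: unit_ball_vol_nonneg\<close>)
  finally show ?thesis by (simp add: 1)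
qed

lemma side_integral_const:
  "side_integral \<nu> \<gamma> (\<lambda>_. a) = a * measure (hyperplane_measure \<nu> (THE c. \<forall>x\<in>\<gamma>. \<nu> \<bullet> x = c)) \<gamma>"
proof -
  have "space (hyperplane_measure \<nu> c) = UNIV" for c by (simp add: hyperplane_measure_def)
  then show ?thesis
    unfolding side_integral_def set_lebesgue_integral_def real_scaleR_def
    by (subst integral_mult_left_zero) simp
qed

text \<open>The factor h of the indicator turns 1/h + 1 into 1 + h. This is where the size of the
  domain enters the constant.\<close>

lemma side_integral_bound:
  fixes \<nu> :: "'a::euclidean_space"
  assumes "norm \<nu> = 1" "h > 0" "closed \<gamma>" "\<gamma> \<subseteq> cball g0 h" "a \<ge> 0"
  shows "h * side_integral \<nu> \<gamma> (\<lambda>_. a) \<le> a * ((1 + h) * (unit_ball_vol (real DIM('a)) * (2 * h) ^ DIM('a)))"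
proof -
  have "h * measure (hyperplane_measure \<nu> c) \<gamma>
      \<le> h * ((1 / h + 1) * (unit_ball_vol (real DIM('a)) * (2 * h) ^ DIM('a)))" for c
    using assms by (intro mult_left_mono hyperplane_measure_bound) auto
  also have "h * ((1 / h + 1) * w) = (1 + h) * w" for w
    using assms(2) by (simp add: distrib_left distrib_right)
  finally show ?thesis
    unfolding side_integral_const using mult_left_mono[OF _ assms(5)] by (simp only: mult.left_commute)
qed

text \<open>The bump decreases away from x0, so its derivative along \<nu> is nonnegative below the
  hyperplane, and the integral may be restricted to the small ball of
  \<open>bump_grad_lower\<close>.\<close>

lemma integral_bump_grad_halfspace_lower:
  fixes \<nu> :: "'a::euclidean_space"
  assumes \<nu>: "norm \<nu> = 1" "\<nu> \<bullet> x0 = c" and \<rho>: "\<rho> > 0"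
    and int: "integrable lborel (\<lambda>x. indicator {x. \<nu> \<bullet> x < c} x * (bump_grad x0 \<rho> x \<bullet> \<nu>))"
  shows "exp (- (16 / 7)) / (2 * \<rho>) * (unit_ball_vol (real DIM('a)) * (\<rho> / 4) ^ DIM('a))
    \<le> (LINT x|lborel. indicator {x. \<nu> \<bullet> x < c} x * (bump_grad x0 \<rho> x \<bullet> \<nu>))"
proof -
  define B where "B = ball (x0 - (\<rho> / 2) *\<^sub>R \<nu>) (\<rho> / 4)"
  define a where "a = exp (- (16 / 7)) / (2 * \<rho>)"
  have a: "a > 0" using \<rho> by (simp add: a_def)
  have \<nu>\<nu>: "\<nu> \<bullet> \<nu> = 1" using \<nu>(1) by (simp add: dot_square_norm)
  have "a * measure lebesgue B = (LINT x|lborel. a * indicator B x)"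
    by (simp add: B_def)
  also have "\<dots> \<le> (LINT x|lborel. indicator {x. \<nu> \<bullet> x < c} x * (bump_grad x0 \<rho> x \<bullet> \<nu>))"
  proof (rule integral_mono[OF _ int])
    show "integrable lborel (\<lambda>x. a * indicator B x)"
      unfolding B_def using emeasure_lborel_ball_finite[of "x0 - (\<rho> / 2) *\<^sub>R \<nu>" "\<rho> / 4"]
      by (intro integrable_mult_right integrable_real_indicator) auto
    fix x
    show "a * indicator B x \<le> indicator {x. \<nu> \<bullet> x < c} x * (bump_grad x0 \<rho> x \<bullet> \<nu>)"
    proof (cases "x \<in> B")
      case True
      define v where "v = x - (x0 - (\<rho> / 2) *\<^sub>R \<nu>)"
      have v: "norm v < \<rho> / 4" using True by (simp add: v_def B_def dist_norm norm_minus_commute)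
      have "\<bar>\<nu> \<bullet> v\<bar> \<le> norm v" using Cauchy_Schwarz_ineq2[of \<nu> v] \<nu>(1) by simp
      moreover have "\<nu> \<bullet> x = \<nu> \<bullet> v + c - \<rho> / 2"
        by (simp add: v_def inner_diff_right inner_add_right \<nu> \<nu>\<nu>)
      ultimately have "\<nu> \<bullet> x < c" using v \<rho> by linarith
      moreover have "a \<le> bump_grad x0 \<rho> x \<bullet> \<nu>"
        unfolding a_def by (rule bump_grad_lower[OF \<rho> \<nu>(1)]) (use True in \<open>simp add: B_def\<close>)
      ultimately show ?thesis using True by simp
    next
      case False
      have "0 \<le> bump_grad x0 \<rho> x \<bullet> \<nu>" if "\<nu> \<bullet> x < c"
      proof -
        have "(x - x0) \<bullet> \<nu> \<le> 0" using that \<nu>(2) by (simp add: inner_diff_right inner_commute[of _ \<nu>])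
        then have "0 \<le> (- 2 * flat_exp1 (1 - ((x - x0) \<bullet> (x - x0)) / \<rho>\<^sup>2) / \<rho>\<^sup>2) * ((x - x0) \<bullet> \<nu>)"
          by (intro mult_nonpos_nonpos) (auto intro: divide_nonpos_nonneg simp: flat_exp1_nonneg)
        then show ?thesis by (simp only: bump_grad_def inner_scaleR_left)
      qed
      then show ?thesis using False by (simp add: indicator_def)
    qed
  qed
  finally show ?thesis using measure_ball(1)[of "\<rho> / 4" "x0 - (\<rho> / 2) *\<^sub>R \<nu>"] \<rho> by (simp add: a_def B_def)
qed

text \<open>The sets may overlap, as closed elements do in a common side, hence only an
  inequality.\<close>

lemma L2_norm_Un_square:
  assumes g: "g \<in> L2 (A \<union> B)" and AB: "A \<in> sets lebesgue" "B \<in> sets lebesgue"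
  shows "(L2_norm (A \<union> B) g)\<^sup>2 \<le> (L2_norm A g)\<^sup>2 + (L2_norm B g)\<^sup>2"
proof -
  let ?f = "\<lambda>S x. if x \<in> S then (norm (g x))\<^sup>2 else 0"
  have U: "A \<union> B \<in> sets lebesgue" using AB by auto
  have eq: "(L2_norm S g)\<^sup>2 = integral\<^sup>L lebesgue (?f S)" if "S \<in> sets lebesgue" for S
    using that by (simp add: L2_norm_square Lebesgue_Measure.integral_restrict_UNIV)
  have i: "integrable lebesgue (?f S)" if "S \<in> sets lebesgue" "S \<subseteq> A \<union> B" for S
    using L2_square_integrable[OF L2_mono(1)[OF g U that(1) negligible_empty]] that
    by (simp add: Lebesgue_Measure.integrable_restrict_UNIV)
  have "integral\<^sup>L lebesgue (?f (A \<union> B)) \<le> integral\<^sup>L lebesgue (\<lambda>x. ?f A x + ?f B x)"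
    using i[OF U] i[OF AB(1)] i[OF AB(2)] by (intro integral_mono Bochner_Integration.integrable_add) auto
  also have "\<dots> = integral\<^sup>L lebesgue (?f A) + integral\<^sup>L lebesgue (?f B)"
    using i[OF AB(1)] i[OF AB(2)] by (intro Bochner_Integration.integral_add) auto
  finally show ?thesis using eq AB U by simp
qed

text \<open>Counterpart of \<open>residual_arithmetic\<close> for a side: J is the jump, m the
  integral of the normal derivative over half the ball, w the volume of the ball. N is already a
  squared norm, unlike e and S. Multiplication by \<rho>^2 / (a^2 w) isolates J^2 w, which scales
  like h times the squared norm of the jump on the side.\<close>

lemma jump_arithmetic:
  fixes J m a w C e S N \<rho> I1 I2 I3 :: real
  assumes w: "w > 0" and \<rho>: "\<rho> > 0" and a: "a > 0" and m: "a * w / \<rho> \<le> m"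
    and J: "J * m = I2 + I3 - I1"
    and I1: "I1\<^sup>2 \<le> (C / \<rho>)\<^sup>2 * w * e\<^sup>2" and I2: "I2\<^sup>2 \<le> w * S\<^sup>2" and I3: "I3\<^sup>2 \<le> w * N"
  shows "J\<^sup>2 * w \<le> 3 / a\<^sup>2 * (C\<^sup>2 * e\<^sup>2 + \<rho>\<^sup>2 * S\<^sup>2 + \<rho>\<^sup>2 * N)"
proof -
  have "0 \<le> a * w / \<rho>" using a w \<rho> by simp
  then have "(a * w / \<rho>)\<^sup>2 \<le> m\<^sup>2" using m by (intro power_mono) auto
  then have "J\<^sup>2 * (a * w / \<rho>)\<^sup>2 \<le> J\<^sup>2 * m\<^sup>2" by (intro mult_left_mono) auto
  also have "\<dots> = (I1 - I2 - I3)\<^sup>2"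
    unfolding power_mult_distrib[symmetric] J by (simp add: power2_eq_square algebra_simps)
  also have "\<dots> \<le> 3 * (I1\<^sup>2 + I2\<^sup>2 + I3\<^sup>2)" by (rule square_diff3)
  also have "\<dots> \<le> 3 * ((C / \<rho>)\<^sup>2 * w * e\<^sup>2 + w * S\<^sup>2 + w * N)"
    using I1 I2 I3 by (intro mult_left_mono add_mono) auto
  finally have "J\<^sup>2 * (a * w / \<rho>)\<^sup>2 * (\<rho>\<^sup>2 / (a\<^sup>2 * w)) \<le> 3 * ((C / \<rho>)\<^sup>2 * w * e\<^sup>2 + w * S\<^sup>2 + w * N) * (\<rho>\<^sup>2 / (a\<^sup>2 * w))"
    using w by (intro mult_right_mono) auto
  moreover have "J\<^sup>2 * (a * w / \<rho>)\<^sup>2 * (\<rho>\<^sup>2 / (a\<^sup>2 * w)) = J\<^sup>2 * w"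
    using w \<rho> a by (simp add: power_divide power_mult_distrib power2_eq_square)
  moreover have "3 * ((C / \<rho>)\<^sup>2 * w * e\<^sup>2 + w * S\<^sup>2 + w * N) * (\<rho>\<^sup>2 / (a\<^sup>2 * w))
      = 3 / a\<^sup>2 * (C\<^sup>2 * e\<^sup>2 + \<rho>\<^sup>2 * S\<^sup>2 + \<rho>\<^sup>2 * N)"
  proof -
    have "3 * ((C / \<rho>)\<^sup>2 * w * e\<^sup>2 + w * S\<^sup>2 + w * N) * (\<rho>\<^sup>2 / (a\<^sup>2 * w))
        = 3 / a\<^sup>2 * (((C / \<rho>)\<^sup>2 * \<rho>\<^sup>2) * e\<^sup>2 * (w / w) + \<rho>\<^sup>2 * S\<^sup>2 * (w / w) + \<rho>\<^sup>2 * N * (w / w))"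
      by (simp add: distrib_left distrib_right add_divide_distrib mult_ac)
    then show ?thesis using w \<rho> by (simp add: power_divide)
  qed
  ultimately show ?thesis by simp
qed

context galerkin_residual
begin

text \<open>Off the hyperplane the gradient on the ball is dK' + H (dK - dK') with the half space
  indicator H. The constant dK' and the tangential part of dK - dK' integrate to 0 by translation
  invariance. What remains is the normal part, which is the jump.\<close>

lemma jump_integral:
  assumes K: "K \<in> T" "K' \<in> T" "K \<noteq> K'" and \<gamma>: "\<gamma> facet_of K" "\<gamma> facet_of K'"
    and \<nu>: "\<nu> = outer_normal K \<gamma>" "norm \<nu> = 1" "outer_normal K' \<gamma> = - \<nu>" "\<nu> \<bullet> x\<gamma> = c"
    and \<rho>: "\<rho> > 0" "ball x\<gamma> \<rho> \<subseteq> \<Omega>"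
    and B: "\<And>x. x \<in> ball x\<gamma> \<rho> \<Longrightarrow> \<nu> \<bullet> x \<le> c \<Longrightarrow> x \<in> K" "\<And>x. x \<in> ball x\<gamma> \<rho> \<Longrightarrow> c \<le> \<nu> \<bullet> x \<Longrightarrow> x \<in> K'"
  obtains m where "exp (- (16 / 7)) / (2 * \<rho>) * (unit_ball_vol (real DIM('a)) * (\<rho> / 4) ^ DIM('a)) \<le> m"
    "(LINT x|lebesgue_on \<Omega>. pw_grad T y x \<bullet> bump_grad x\<gamma> \<rho> x) = jump T y \<gamma> * m"
proof -
  define dK where "dK = elem_grad y K"
  define dK' where "dK' = elem_grad y K'"
  define bg where "bg = bump_grad x\<gamma> \<rho>"
  define H where "H = indicat_real {x. \<nu> \<bullet> x < c}"
  have \<nu>\<nu>: "\<nu> \<bullet> \<nu> = 1" using \<nu>(2) by (simp add: dot_square_norm)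
  have bg0: "bg x = 0" if "x \<notin> ball x\<gamma> \<rho>" for x using bump_outside(2)[OF \<rho>(1) that] by (simp add: bg_def)
  have Hm: "{x. \<nu> \<bullet> x < c} \<in> sets borel" using open_halfspace_lt[of \<nu> c] by auto
  have bgm: "(\<lambda>x. bg x \<bullet> v) \<in> borel_measurable borel" for v
    unfolding bg_def by (intro borel_measurable_continuous_onI continuous_on_inner continuous_on_const
        continuous_on_bump_grad)
  have bgi: "integrable lborel (\<lambda>x. bg x \<bullet> v)" for v
  proof -
    have "(\<lambda>_. v) \<in> L2 \<Omega>" using domain(3) by (intro L2_bounded[of _ _ "norm v"]) auto
    from L2_integrable_inner[OF bump_L2(2)[OF domain(3) \<rho>(1)] this]
    have "integrable (lebesgue_on \<Omega>) (\<lambda>x. bg x \<bullet> v)" by (simp add: bg_def)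
    then show ?thesis
      by (subst (asm) lebesgue_on_eq_lborel(2)[OF bgm domain(4)]) (use bg0 \<rho>(2) in force)+
  qed
  have Hi: "integrable lborel (\<lambda>x. H x * (bg x \<bullet> v))" for v
    unfolding H_def real_scaleR_def[symmetric] using Hm by (intro integrable_mult_indicator bgi) auto
  have H0: "H (x + t *\<^sub>R v) = H x" if "\<nu> \<bullet> v = 0" for x t v
    using that by (simp add: H_def inner_add_right indicator_def)
  have null: "AE x in lebesgue. \<nu> \<bullet> x \<noteq> c"
  proof -
    have "\<nu> \<noteq> 0" using \<nu>(2) by auto
    then have "{x. \<nu> \<bullet> x = c} \<in> null_sets lebesgue"
      using negligible_hyperplane[of \<nu> c] by (simp add: negligible_iff_null_sets)
    from AE_not_in[OF this] show ?thesis by simp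
  qed
  have split: "pw_grad T y x \<bullet> bg x = H x * (bg x \<bullet> (dK - dK')) + bg x \<bullet> dK'" if nx: "\<nu> \<bullet> x \<noteq> c" for x
  proof (cases "x \<in> ball x\<gamma> \<rho>")
    case True
    show ?thesis
    proof (cases "\<nu> \<bullet> x < c")
      case lt: True
      have "ball x\<gamma> \<rho> \<inter> {x. \<nu> \<bullet> x < c} \<subseteq> interior K"
        using B(1) by (intro interior_maximal open_Int open_ball open_halfspace_lt) auto
      then have "pw_grad T y x = dK" using True lt pw_grad_eq[OF T K(1)] by (auto simp: dK_def)
      then show ?thesis using lt by (simp add: H_def inner_diff_right inner_commute)
    next
      case False
      then have gt: "\<nu> \<bullet> x > c" using nx by simp
      have "ball x\<gamma> \<rho> \<inter> {x. \<nu> \<bullet> x > c} \<subseteq> interior K'"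
        using B(2) by (intro interior_maximal open_Int open_ball open_halfspace_gt) auto
      then have "pw_grad T y x = dK'" using True gt pw_grad_eq[OF T K(2)] by (auto simp: dK'_def)
      then show ?thesis using gt by (simp add: H_def inner_commute)
    qed
  qed (simp add: bg0)
  define e where "e = dK - dK'"
  define v where "v = e - (\<nu> \<bullet> e) *\<^sub>R \<nu>"
  have v0: "\<nu> \<bullet> v = 0" by (simp add: v_def inner_diff_right \<nu>\<nu>)
  define m where "m = (LINT x|lborel. H x * (bg x \<bullet> \<nu>))"
  have rhs_m: "(\<lambda>x. H x * (bg x \<bullet> (dK - dK')) + bg x \<bullet> dK') \<in> borel_measurable borel"
    using borel_measurable_integrable[OF Hi] bgm by (intro borel_measurable_add) auto
  have "(LINT x|lebesgue_on \<Omega>. pw_grad T y x \<bullet> bg x)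
      = (LINT x|lebesgue_on \<Omega>. H x * (bg x \<bullet> (dK - dK')) + bg x \<bullet> dK')"
  proof (rule integral_cong_AE)
    show "(\<lambda>x. pw_grad T y x \<bullet> bg x) \<in> borel_measurable (lebesgue_on \<Omega>)"
      unfolding bg_def
      by (intro borel_measurable_integrable L2_integrable_inner pw_grad_L2[OF T domain(3)] bump_L2(2)[OF domain(3) \<rho>(1)])
    show "(\<lambda>x. H x * (bg x \<bullet> (dK - dK')) + bg x \<bullet> dK') \<in> borel_measurable (lebesgue_on \<Omega>)"
      by (intro measurable_restrict_space1 measurable_completion) (use rhs_m in simp)
    show "AE x in lebesgue_on \<Omega>. pw_grad T y x \<bullet> bg x = H x * (bg x \<bullet> (dK - dK')) + bg x \<bullet> dK'"
      unfolding AE_restrict_space_iff[of \<Omega> lebesgue, simplified, OF domain(4)]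
      using null by eventually_elim (use split in blast)
  qed
  also have "\<dots> = (LINT x|lborel. H x * (bg x \<bullet> (dK - dK')) + bg x \<bullet> dK')"
  proof (rule lebesgue_on_eq_lborel(1)[OF rhs_m domain(4)])
    fix x assume "x \<notin> \<Omega>"
    then have "x \<notin> ball x\<gamma> \<rho>" using \<rho>(2) by blast
    from bg0[OF this] show "H x * (bg x \<bullet> (dK - dK')) + bg x \<bullet> dK' = 0" by simp
  qed
  also have "\<dots> = (LINT x|lborel. H x * (bg x \<bullet> e)) + (LINT x|lborel. bg x \<bullet> dK')"
    using Hi bgi by (simp add: e_def)
  also have "(LINT x|lborel. bg x \<bullet> dK') = 0"
    using integral_bump_grad_translation_invariant[OF \<rho>(1), of "\<lambda>_. 1" 1 dK' x\<gamma>] by (simp add: bg_def)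
  also have "(LINT x|lborel. H x * (bg x \<bullet> e)) = (LINT x|lborel. (\<nu> \<bullet> e) * (H x * (bg x \<bullet> \<nu>)) + H x * (bg x \<bullet> v))"
    by (intro Bochner_Integration.integral_cong refl) (simp add: v_def inner_diff_right algebra_simps)
  also have "\<dots> = (\<nu> \<bullet> e) * m + (LINT x|lborel. H x * (bg x \<bullet> v))"
    using Hi by (simp add: m_def)
  also have "(LINT x|lborel. H x * (bg x \<bullet> v)) = 0"
    unfolding bg_def
  proof (rule integral_bump_grad_translation_invariant[OF \<rho>(1)])
    show "H \<in> borel_measurable borel" unfolding H_def using Hm by (intro borel_measurable_indicator) simp
    show "\<bar>H x\<bar> \<le> 1" for x by (simp add: H_def indicator_def)
  qed (rule H0[OF v0])
  also have "\<nu> \<bullet> e = jump T y \<gamma>"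
    using jump_eq[OF T K \<gamma>, of y] \<nu>(1,3) by (simp add: e_def dK_def dK'_def inner_diff_right)
  finally have "(LINT x|lebesgue_on \<Omega>. pw_grad T y x \<bullet> bump_grad x\<gamma> \<rho> x) = jump T y \<gamma> * m"
    by (simp add: bg_def)
  moreover have "exp (- (16 / 7)) / (2 * \<rho>) * (unit_ball_vol (real DIM('a)) * (\<rho> / 4) ^ DIM('a)) \<le> m"
    using integral_bump_grad_halfspace_lower[OF \<nu>(2,4) \<rho>(1)] Hi[of \<nu>] by (simp add: m_def H_def bg_def)
  ultimately show ?thesis using that by blast
qed

end

text \<open>The powers of 4\<kappa> come from h \<le> 4\<kappa>\<rho>: n for the volumes, 2 for the
  bump gradient. The squared factor is k of \<open>residual_arithmetic\<close>, 3 comes from the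
  three integrals, the outer 2 and + 2 from splitting off q - P.\<close>

definition resid_const :: "nat \<Rightarrow> real \<Rightarrow> real \<Rightarrow> real" where
  "resid_const n \<kappa> C = 2 * ((4 * \<kappa>) ^ (n + 2) * (3 * (4 * \<kappa> * exp (4 / 3) * 2 ^ n)\<^sup>2 * (C\<^sup>2 + 1))) + 2"

text \<open>1 + h comes from the prism, 8\<kappa>(1 + \<kappa>) compares 2h with the bump radius,
  and the next factor is the 3 / a^2 of \<open>jump_arithmetic\<close>. In the sum, C^2 belongs to
  the error, 1 to the data error, the last term to the residuals of the two elements.\<close>

definition jump_const :: "nat \<Rightarrow> real \<Rightarrow> real \<Rightarrow> real \<Rightarrow> real" where
  "jump_const n \<kappa> C h = (1 + h) * (8 * \<kappa> * (1 + \<kappa>)) ^ n * (3 / (exp (- (16 / 7)) / (2 * 4 ^ n))\<^sup>2)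
     * (C\<^sup>2 + 1 + 2 * \<kappa>\<^sup>2 * resid_const n \<kappa> C)"

lemma resid_const_pos: "\<kappa> \<ge> 0 \<Longrightarrow> resid_const n \<kappa> C > 0"
  unfolding resid_const_def by (intro add_nonneg_pos mult_nonneg_nonneg) auto

lemma jump_const_nonneg: "\<kappa> \<ge> 0 \<Longrightarrow> h \<ge> 0 \<Longrightarrow> jump_const n \<kappa> C h \<ge> 0"
  unfolding jump_const_def using resid_const_pos[of \<kappa> n C]
  by (intro mult_nonneg_nonneg add_nonneg_nonneg) auto

text \<open>All of J, e, S, O2, N, NK and NK' stand for squared quantities. The aim is to trade h'
  for h: \<rho> is below both, so \<rho>^2 N is bounded by the two weighted residuals, and the
  remaining h'^2 costs a factor \<kappa>^2.\<close>

lemma side_arithmetic: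
  fixes J h h' \<kappa> w e S O2 \<rho> A C D N NK NK' :: real
  assumes "0 \<le> w" and \<kappa>: "\<kappa> \<ge> 1" and \<rho>: "0 < \<rho>" "\<rho> \<le> h" "\<rho> \<le> h'" and h': "h' \<le> \<kappa> * h"
    and D: "D \<ge> 0" and A: "A \<ge> 0" and nn: "0 \<le> e" "0 \<le> S" "0 \<le> O2" "0 \<le> NK" "0 \<le> NK'"
    and J: "J * w \<le> A * (C\<^sup>2 * e + \<rho>\<^sup>2 * S + \<rho>\<^sup>2 * N)"
    and N: "N \<le> NK + NK'"
    and NK: "h\<^sup>2 * NK \<le> D * (e + h\<^sup>2 * S + O2)" and NK': "h'\<^sup>2 * NK' \<le> D * (e + h'\<^sup>2 * S + O2)"
  shows "J * w \<le> A * (C\<^sup>2 + 1 + 2 * \<kappa>\<^sup>2 * D) * (e + h\<^sup>2 * S + O2)"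
proof -
  define X where "X = e + h\<^sup>2 * S + O2"
  have X: "e \<le> X" "h\<^sup>2 * S \<le> X" "O2 \<le> X" "0 \<le> X" using nn by (auto simp: X_def)
  have k2: "\<kappa>\<^sup>2 \<ge> 1" using power_mono[OF \<kappa>, of 2] by simp
  have r2: "\<rho>\<^sup>2 \<le> h\<^sup>2" "\<rho>\<^sup>2 \<le> h'\<^sup>2" using \<rho> by (auto intro: power_mono)
  have "h' \<ge> 0" using \<rho> by simp
  then have "h'\<^sup>2 \<le> (\<kappa> * h)\<^sup>2" using h' by (intro power_mono) auto
  then have h2: "h'\<^sup>2 * S \<le> \<kappa>\<^sup>2 * (h\<^sup>2 * S)"
    using mult_right_mono[OF \<open>h'\<^sup>2 \<le> (\<kappa> * h)\<^sup>2\<close> nn(2)] by (simp add: power_mult_distrib mult.assoc)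
  have "e + h'\<^sup>2 * S + O2 \<le> \<kappa>\<^sup>2 * e + \<kappa>\<^sup>2 * (h\<^sup>2 * S) + \<kappa>\<^sup>2 * O2"
    using h2 mult_right_mono[OF k2 nn(1)] mult_right_mono[OF k2 nn(3)] by linarith
  also have "\<dots> = \<kappa>\<^sup>2 * X" by (simp add: X_def algebra_simps)
  finally have e2: "e + h'\<^sup>2 * S + O2 \<le> \<kappa>\<^sup>2 * X" .
  have X1: "X \<le> \<kappa>\<^sup>2 * X" using mult_right_mono[OF k2 X(4)] by simp
  have "\<rho>\<^sup>2 * N \<le> \<rho>\<^sup>2 * (NK + NK')" using N by (intro mult_left_mono) auto
  also have "\<dots> \<le> h\<^sup>2 * NK + h'\<^sup>2 * NK'"
    using mult_right_mono[OF r2(1) nn(4)] mult_right_mono[OF r2(2) nn(5)] by (simp add: distrib_left)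
  also have "\<dots> \<le> D * X + D * (\<kappa>\<^sup>2 * X)"
    using NK NK' mult_left_mono[OF e2 D] by (simp add: X_def)
  also have "\<dots> \<le> D * (\<kappa>\<^sup>2 * X) + D * (\<kappa>\<^sup>2 * X)" by (rule add_right_mono[OF mult_left_mono[OF X1 D]])
  finally have n2: "\<rho>\<^sup>2 * N \<le> 2 * \<kappa>\<^sup>2 * D * X" by (simp add: algebra_simps)
  have s2: "\<rho>\<^sup>2 * S \<le> X" using mult_right_mono[OF r2(1) nn(2)] X(2) by linarith
  have c2: "C\<^sup>2 * e \<le> C\<^sup>2 * X" using X(1) by (intro mult_left_mono) auto
  have "C\<^sup>2 * e + \<rho>\<^sup>2 * S + \<rho>\<^sup>2 * N \<le> (C\<^sup>2 + 1 + 2 * \<kappa>\<^sup>2 * D) * X"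
    using c2 s2 n2 by (simp add: distrib_right)
  from mult_left_mono[OF this A] J show ?thesis by (simp add: X_def mult.assoc)
qed

context galerkin_residual
begin

lemma L2_norm_element_le:
  assumes g: "g \<in> L2 \<Omega>" and M: "M \<subseteq> T" and S: "S \<in> sets lebesgue" "S \<subseteq> \<Union>M"
  shows "(L2_norm S g)\<^sup>2 \<le> (L2_norm (\<Union>M) g)\<^sup>2"
proof -
  have "finite M" using mesh_finite[OF T] M finite_subset by blast
  then have U: "\<Union>M \<in> sets lebesgue" using element_measurable(1) M by (intro sets.finite_Union) auto
  have "\<Union>M \<subseteq> closure \<Omega>" using M T by (auto simp: simplicial_mesh_def)
  from L2_mono(2)[OF L2_closure[OF g this U] U S(1) negligible_empty] S(2)
  show ?thesis by (intro power_mono) auto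
qed

text \<open>A bump across the side bounds the jump by the error, the data error and the residuals of
  both adjacent elements, to which the element estimate applies. The diameters h and h' then have to
  be compared.\<close>

lemma side_jump_bound:
  assumes dim: "DIM('a) \<ge> 2" and K: "K \<in> T" and \<gamma>: "\<gamma> \<in> sides_of T K"
    and inball: "\<And>L. L \<in> T \<Longrightarrow> \<exists>x r. r > 0 \<and> cball x r \<subseteq> L \<and> diameter L \<le> \<kappa> * r" and \<kappa>: "\<kappa> \<ge> 1"
    and C: "\<And>(x0::'a) r x. r > 0 \<Longrightarrow> norm (bump_grad x0 r x) \<le> C / r"
    and P: "\<And>L. P L \<in> polys 1"
    and osc: "\<And>L. L \<in> patch T K \<Longrightarrow> (diameter L)\<^sup>2 * (L2_norm L (\<lambda>x. q x - P L x))\<^sup>2 \<le> O2"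
    and H: "diameter K \<le> H"
  shows "diameter K * side_integral (outer_normal K \<gamma>) \<gamma> (\<lambda>_. (jump T y \<gamma>)\<^sup>2)
    \<le> jump_const DIM('a) \<kappa> C H * ((L2_norm (\<Union>(patch T K)) E)\<^sup>2
       + (diameter K)\<^sup>2 * (L2_norm (\<Union>(patch T K)) (\<lambda>x. s x - s\<^sub>T x))\<^sup>2 + O2)"
proof -
  obtain K' where K': "K' \<in> T" "K \<noteq> K'" and f: "\<gamma> facet_of K" "\<gamma> facet_of K'" and pK': "K' \<in> patch T K"
    by (rule side_neighbour[OF \<gamma> K]) (rule that)
  have pK: "K \<in> patch T K" by (simp add: patch_def)
  have pT: "patch T K \<subseteq> T" using K by (auto simp: patch_def)
  note mK = mesh_element[OF T K] and mK' = mesh_element[OF T K'(1)]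
  define h where "h = diameter K"
  define h' where "h' = diameter K'"
  obtain x0 r where r: "r > 0" "cball x0 r \<subseteq> K" "h \<le> \<kappa> * r" using inball[OF K] by (auto simp: h_def)
  obtain x0' r' where r': "r' > 0" "cball x0' r' \<subseteq> K'" "h' \<le> \<kappa> * r'" using inball[OF K'(1)] by (auto simp: h'_def)
  define \<nu> where "\<nu> = outer_normal K \<gamma>"
  obtain c x\<gamma> where geo: "norm \<nu> = 1" "outer_normal K' \<gamma> = - \<nu>" "K \<subseteq> {x. \<nu> \<bullet> x \<le> c}" "K' \<subseteq> {x. c \<le> \<nu> \<bullet> x}"
    "\<nu> \<bullet> x\<gamma> = c" "\<And>w. \<nu> \<bullet> w = 0 \<Longrightarrow> norm w \<le> r \<Longrightarrow> x\<gamma> + w \<in> \<gamma>"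
    "\<And>\<rho> w. \<rho> > 0 \<Longrightarrow> 2 * \<rho> \<le> r \<Longrightarrow> 2 * \<rho> * (1 + diameter K / r) \<le> r \<Longrightarrow> norm w \<le> \<rho> \<Longrightarrow>
      \<nu> \<bullet> w \<le> 0 \<Longrightarrow> x\<gamma> + w \<in> K"
    "\<And>\<rho> w. \<rho> > 0 \<Longrightarrow> 2 * \<rho> \<le> r' \<Longrightarrow> 2 * \<rho> * (1 + diameter K' / r') \<le> r \<Longrightarrow> norm w \<le> \<rho> \<Longrightarrow>
      0 \<le> \<nu> \<bullet> w \<Longrightarrow> x\<gamma> + w \<in> K'"
    by (rule interior_side_geometry[OF T K K' f r(1,2) r'(1,2), folded \<nu>_def]) (rule that)
  \<comment> \<open>For d \<ge> 2 there is a direction orthogonal to n, along which the disc has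
    length 2t. As the disc lies in the common side, each inscribed radius also bounds the diameter
    of the neighbour from below.\<close>
  have width: "2 * t \<le> diameter S" if S: "compact S" "\<gamma> \<subseteq> S" and t: "t > 0"
    and D: "\<And>w. n \<bullet> w = 0 \<Longrightarrow> norm w \<le> t \<Longrightarrow> z + w \<in> \<gamma>" for S t n z
  proof -
    obtain v where v: "v \<noteq> 0" "orthogonal n v" using orthogonal_to_vector_exists[OF dim] by metis
    define u where "u = (t / norm v) *\<^sub>R v"
    have u: "norm u = t" "n \<bullet> u = 0" using v t by (auto simp: u_def orthogonal_def)
    have "z + u \<in> S" "z + - u \<in> S" using D[of u] D[of "- u"] u S(2) by auto
    from diameter_bounded_bound[OF compact_imp_bounded[OF S(1)] this]
    have "norm (2 *\<^sub>R u) \<le> diameter S" by (simp add: dist_norm scaleR_2)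
    then show ?thesis using u(1) by simp
  qed
  have rh': "2 * r \<le> h'"
    unfolding h'_def by (rule width[OF mK'(3) facet_of_imp_subset[OF f(2)] r(1) geo(6)])
  \<comment> \<open>The roles of K and K' are exchanged, so that the disc stems from the inscribed
    ball of K'.\<close>
  have r'h: "2 * r' \<le> h"
    unfolding h_def
    by (rule interior_side_geometry[OF T K'(1) K K'(2)[symmetric] f(2,1) r'(1,2) r(1,2)])
       (rule width[OF mK(3) facet_of_imp_subset[OF f(1)] r'(1)])
  have rh: "2 * r \<le> h"
    unfolding h_def using diameter_subset[OF r(2) compact_imp_bounded[OF mK(3)]] r(1) by simp
  have h'h: "h' \<le> \<kappa> * h"
  proof -
    have "\<kappa> * r' \<le> \<kappa> * h" using r'h r'(1) \<kappa> by (intro mult_left_mono) auto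
    then show ?thesis using r'(3) by linarith
  qed
  \<comment> \<open>As h/r and h'/r' are at most \<kappa>, this radius suits both half balls; the
    condition 2\<rho> \<le> r' uses 2r \<le> h' \<le> \<kappa> r'.\<close>
  define \<rho> where "\<rho> = r / (2 * (1 + \<kappa>))"
  have \<rho>: "\<rho> > 0" using r(1) \<kappa> by (simp add: \<rho>_def)
  have \<rho>r: "2 * \<rho> * (1 + \<kappa>) = r" 
  proof -
    have "2 * (r / (2 * k)) * k = r" if "k > 0" for k using that by simp
    from this[of "1 + \<kappa>"] \<kappa> show ?thesis by (simp only: \<rho>_def)
  qed
  have \<rho>1: "2 * \<rho> \<le> r" using \<rho>r mult_left_mono[of 1 "1 + \<kappa>" "2 * \<rho>"] \<rho> \<kappa> by simp
  have \<rho>2: "2 * \<rho> \<le> r'"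
  proof -
    have "2 * r \<le> \<kappa> * r'" using rh' r'(3) by linarith
    moreover have "\<kappa> * (2 * \<rho>) \<le> r" using \<rho>r \<rho> by (simp add: algebra_simps)
    ultimately have "\<kappa> * (2 * \<rho>) \<le> \<kappa> * r'" using r(1) by linarith
    then show ?thesis using \<kappa> by simp
  qed
  have \<rho>3: "2 * \<rho> * (1 + h / r) \<le> r" "2 * \<rho> * (1 + h' / r') \<le> r"
  proof -
    have "h / r \<le> \<kappa>" "h' / r' \<le> \<kappa>" using r(1,3) r'(1,3) by (auto simp: pos_divide_le_eq)
    then have "2 * \<rho> * (1 + h / r) \<le> 2 * \<rho> * (1 + \<kappa>)" "2 * \<rho> * (1 + h' / r') \<le> 2 * \<rho> * (1 + \<kappa>)"
      using \<rho> by (auto intro!: mult_left_mono)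
    then show "2 * \<rho> * (1 + h / r) \<le> r" "2 * \<rho> * (1 + h' / r') \<le> r" using \<rho>r by simp_all
  qed
  have half: "x \<in> K" if "x \<in> ball x\<gamma> \<rho>" "\<nu> \<bullet> x \<le> c" for x
    using geo(7)[OF \<rho> \<rho>1 \<rho>3(1)[unfolded h_def], of "x - x\<gamma>"] that geo(5)
    by (simp add: dist_norm norm_minus_commute inner_diff_right)
  have half': "x \<in> K'" if "x \<in> ball x\<gamma> \<rho>" "c \<le> \<nu> \<bullet> x" for x
    using geo(8)[OF \<rho> \<rho>2 \<rho>3(2)[unfolded h'_def], of "x - x\<gamma>"] that geo(5)
    by (simp add: dist_norm norm_minus_commute inner_diff_right)
  have ballKK': "ball x\<gamma> \<rho> \<subseteq> K \<union> K'" using half half' linear by blast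
  have ball\<Omega>: "ball x\<gamma> \<rho> \<subseteq> \<Omega>"
  proof -
    have "ball x\<gamma> \<rho> \<subseteq> closure \<Omega>" using ballKK' mK(7) mK'(7) by blast
    then have "ball x\<gamma> \<rho> \<subseteq> interior (closure \<Omega>)" by (rule interior_maximal) simp
    then show ?thesis using interior_closure_lipschitz[OF \<Omega>] by simp
  qed
  \<comment> \<open>Half the radius, so that the closed ball supporting the bump lies in the open
    ball and hence in \<Omega>.\<close>
  define d where "d = \<rho> / 2"
  have d: "d > 0" "d \<le> h" "d \<le> h'" using \<rho> \<rho>1 rh rh' by (auto simp: d_def)
  have db: "cball x\<gamma> d \<subseteq> ball x\<gamma> \<rho>" "ball x\<gamma> d \<subseteq> ball x\<gamma> \<rho>" using \<rho> by (auto simp: d_def)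
  obtain m where m: "exp (- (16 / 7)) / (2 * d) * (unit_ball_vol (real DIM('a)) * (d / 4) ^ DIM('a)) \<le> m"
    "(LINT x|lebesgue_on \<Omega>. pw_grad T y x \<bullet> bump_grad x\<gamma> d x) = jump T y \<gamma> * m"
    by (rule jump_integral[OF K K' f \<nu>_def geo(1,2,5) d(1)]) (use db ball\<Omega> half half' that in blast)+
  define w where "w = unit_ball_vol (real DIM('a)) * d ^ DIM('a)"
  have w: "w > 0" using d by (simp add: w_def unit_ball_vol_pos)
  define a :: real where "a = exp (- (16 / 7)) / (2 * 4 ^ DIM('a))"
  have a: "a > 0" by (simp add: a_def)
  have am: "a * w / d \<le> m"
    using m(1) by (simp add: a_def w_def power_divide mult_ac)
  define U where "U = \<Union>(patch T K)"
  have finp: "finite (patch T K)" using mesh_finite[OF T] pT finite_subset by blast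
  have "U \<in> sets lebesgue"
    unfolding U_def using element_measurable(1) pT finp by (intro sets.finite_Union) auto
  moreover have "U \<subseteq> closure \<Omega>" unfolding U_def using pT mesh_element(7)[OF T] by blast
  ultimately have U: "U \<in> sets lebesgue" "U \<subseteq> closure \<Omega>" by blast+
  have KU: "K \<union> K' \<in> sets lebesgue" "K \<union> K' \<subseteq> U" "K \<union> K' \<subseteq> closure \<Omega>"
    using element_measurable(1)[OF K] element_measurable(1)[OF K'(1)] pK pK' mK(7) mK'(7) by (auto simp: U_def)
  have sd: "(\<lambda>x. s x - s\<^sub>T x) \<in> L2 \<Omega>" by (rule L2_diff[OF data(1,2)])
  have sq: "(\<lambda>x. s\<^sub>T x + q x) \<in> L2 \<Omega>" by (rule L2_add[OF data(2,3)])
  have i: "integrable (lebesgue_on \<Omega>) (\<lambda>x. f x * bump x\<gamma> d x)" if "f \<in> L2 \<Omega>" for f :: "'a \<Rightarrow> real"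
    using L2_integrable_inner[OF that bump_L2(1)[OF domain(3) d(1)]] by simp
  define I1 where "I1 = (LINT x|lebesgue_on \<Omega>. E x \<bullet> bump_grad x\<gamma> d x)"
  define I2 where "I2 = (LINT x|lebesgue_on \<Omega>. (s x - s\<^sub>T x) * bump x\<gamma> d x)"
  define I3 where "I3 = (LINT x|lebesgue_on \<Omega>. (s\<^sub>T x + q x) * bump x\<gamma> d x)"
  have J: "jump T y \<gamma> * m = I2 + I3 - I1"
  proof -
    have "(LINT x|lebesgue_on \<Omega>. (s x + q x) * bump x\<gamma> d x)
        = (LINT x|lebesgue_on \<Omega>. (s x - s\<^sub>T x) * bump x\<gamma> d x + (s\<^sub>T x + q x) * bump x\<gamma> d x)"
      by (intro Bochner_Integration.integral_cong refl) (simp add: algebra_simps)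
    also have "\<dots> = I2 + I3" using i[OF sd] i[OF sq] by (simp add: I2_def I3_def)
    finally show ?thesis using residual[OF d(1) order_trans[OF db(1) ball\<Omega>]] m(2) by (simp add: I1_def)
  qed
  have bU: "ball x\<gamma> d \<subseteq> \<Omega>" "ball x\<gamma> d \<subseteq> U" "ball x\<gamma> d \<subseteq> K \<union> K'" using db ball\<Omega> ballKK' KU by auto
  note bounds = bump_integral_bounds[OF d(1) bU(1) domain(4)]
  have I: "I1\<^sup>2 \<le> (C / d)\<^sup>2 * w * (L2_norm U E)\<^sup>2" "I2\<^sup>2 \<le> w * (L2_norm U (\<lambda>x. s x - s\<^sub>T x))\<^sup>2"
    "I3\<^sup>2 \<le> w * (L2_norm (K \<union> K') (\<lambda>x. s\<^sub>T x + q x))\<^sup>2"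
    unfolding I1_def I2_def I3_def w_def
    using bounds(2)[OF bU(2) U(1) L2_closure[OF data(4) U(2,1)] C[OF d(1)]]
      bounds(1)[OF bU(2) U(1) L2_closure[OF sd U(2,1)]]
      bounds(1)[OF bU(3) KU(1) L2_closure[OF sq KU(3,1)]] by auto
  have N: "(L2_norm (K \<union> K') (\<lambda>x. s\<^sub>T x + q x))\<^sup>2
      \<le> (L2_norm K (\<lambda>x. s\<^sub>T x + q x))\<^sup>2 + (L2_norm K' (\<lambda>x. s\<^sub>T x + q x))\<^sup>2"
    by (rule L2_norm_Un_square[OF L2_closure[OF sq KU(3,1)] element_measurable(1)[OF K] element_measurable(1)[OF K'(1)]])
  define D where "D = resid_const DIM('a) \<kappa> C"
  have D: "D \<ge> 0" unfolding D_def using resid_const_pos[of \<kappa> "DIM('a)" C] \<kappa> by simp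
  have res: "(diameter L)\<^sup>2 * (L2_norm L (\<lambda>x. s\<^sub>T x + q x))\<^sup>2
      \<le> D * ((L2_norm U E)\<^sup>2 + (diameter L)\<^sup>2 * (L2_norm U (\<lambda>x. s x - s\<^sub>T x))\<^sup>2 + O2)"
    if L: "L \<in> patch T K" for L
  proof -
    have LT: "L \<in> T" using L pT by blast
    obtain z t where zt: "t > 0" "cball z t \<subseteq> L" "diameter L \<le> \<kappa> * t" using inball[OF LT] by blast
    have LU: "L \<subseteq> \<Union>(patch T K)" using L by blast
    have "(L2_norm L E)\<^sup>2 + (diameter L)\<^sup>2 * (L2_norm L (\<lambda>x. s x - s\<^sub>T x))\<^sup>2
         + (diameter L)\<^sup>2 * (L2_norm L (\<lambda>x. q x - P L x))\<^sup>2
      \<le> (L2_norm U E)\<^sup>2 + (diameter L)\<^sup>2 * (L2_norm U (\<lambda>x. s x - s\<^sub>T x))\<^sup>2 + O2"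
      unfolding U_def
      by (intro add_mono osc L mult_left_mono L2_norm_element_le[OF _ pT element_measurable(1)[OF LT] LU] data(4) sd) simp
    note mult_left_mono[OF this D]
    moreover have "(diameter L)\<^sup>2 * (L2_norm L (\<lambda>x. s\<^sub>T x + q x))\<^sup>2
      \<le> D * ((L2_norm L E)\<^sup>2 + (diameter L)\<^sup>2 * (L2_norm L (\<lambda>x. s x - s\<^sub>T x))\<^sup>2
         + (diameter L)\<^sup>2 * (L2_norm L (\<lambda>x. q x - P L x))\<^sup>2)"
      unfolding D_def resid_const_def by (rule element_residual_bound[OF LT zt _ P[of L]]) (rule C)
    ultimately show ?thesis by (rule order_trans[rotated])
  qed
  define A where "A = 3 / a\<^sup>2"
  define e where "e = (L2_norm U E)\<^sup>2"
  define S where "S = (L2_norm U (\<lambda>x. s x - s\<^sub>T x))\<^sup>2"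
  have O2: "O2 \<ge> 0" using osc[OF pK] by (meson order_trans mult_nonneg_nonneg zero_le_power2)
  have jw: "(jump T y \<gamma>)\<^sup>2 * w \<le> A * (C\<^sup>2 + 1 + 2 * \<kappa>\<^sup>2 * D) * (e + h\<^sup>2 * S + O2)"
  proof (rule side_arithmetic[OF _ \<kappa> d h'h D])
    show "(jump T y \<gamma>)\<^sup>2 * w \<le> A * (C\<^sup>2 * e + d\<^sup>2 * S + d\<^sup>2 * (L2_norm (K \<union> K') (\<lambda>x. s\<^sub>T x + q x))\<^sup>2)"
      unfolding A_def e_def S_def by (rule jump_arithmetic[OF w d(1) a am J I])
  qed (use w N res[OF pK] res[OF pK'] O2 in \<open>auto simp: A_def e_def S_def h_def h'_def\<close>)
  have h0: "h > 0" using rh r(1) by simp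
  have "x\<gamma> \<in> \<gamma>" using geo(6)[of 0] r(1) by simp
  then have "x\<gamma> \<in> K" using facet_of_imp_subset[OF f(1)] by blast
  have \<gamma>s: "\<gamma> \<subseteq> cball x\<gamma> h"
  proof
    fix x assume "x \<in> \<gamma>"
    then have "x \<in> K" using facet_of_imp_subset[OF f(1)] by blast
    from diameter_bounded_bound[OF compact_imp_bounded[OF mK(3)] \<open>x\<gamma> \<in> K\<close> this] show "x \<in> cball x\<gamma> h"
      by (simp add: h_def)
  qed
  have \<gamma>c: "closed \<gamma>"
    using facet_of_imp_face_of[OF f(1)] face_of_imp_closed mK(2,4) by blast
  \<comment> \<open>h \<le> \<kappa> r, and r = 4(1 + \<kappa>) d by the choice of \<rho> and
    d.\<close>
  have hd: "2 * h \<le> 8 * \<kappa> * (1 + \<kappa>) * d"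
  proof -
    have "h \<le> \<kappa> * (2 * (2 * d) * (1 + \<kappa>))" using r(3) \<rho>r by (simp add: d_def)
    then show ?thesis by (simp add: algebra_simps)
  qed
  have "(2 * h) ^ DIM('a) \<le> (8 * \<kappa> * (1 + \<kappa>) * d) ^ DIM('a)"
    using h0 by (intro power_mono hd) simp
  then have vol: "unit_ball_vol (real DIM('a)) * (2 * h) ^ DIM('a)
      \<le> unit_ball_vol (real DIM('a)) * (8 * \<kappa> * (1 + \<kappa>) * d) ^ DIM('a)"
    by (intro mult_left_mono) (auto simp: unit_ball_vol_nonneg)
  from side_integral_bound[OF geo(1) h0 \<gamma>c \<gamma>s, of "(jump T y \<gamma>)\<^sup>2"]
  have "h * side_integral \<nu> \<gamma> (\<lambda>_. (jump T y \<gamma>)\<^sup>2)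
      \<le> (jump T y \<gamma>)\<^sup>2 * ((1 + h) * (unit_ball_vol (real DIM('a)) * (2 * h) ^ DIM('a)))" by simp
  also have "\<dots> \<le> (jump T y \<gamma>)\<^sup>2 * ((1 + H) * (unit_ball_vol (real DIM('a)) * (8 * \<kappa> * (1 + \<kappa>) * d) ^ DIM('a)))"
    using H h0 by (intro mult_left_mono mult_mono vol) (auto simp: h_def unit_ball_vol_nonneg)
  also have "\<dots> = (1 + H) * (8 * \<kappa> * (1 + \<kappa>)) ^ DIM('a) * ((jump T y \<gamma>)\<^sup>2 * w)"
    unfolding w_def power_mult_distrib[of _ d] by (simp only: mult_ac)
  also have "\<dots> \<le> (1 + H) * (8 * \<kappa> * (1 + \<kappa>)) ^ DIM('a) * (A * (C\<^sup>2 + 1 + 2 * \<kappa>\<^sup>2 * D) * (e + h\<^sup>2 * S + O2))"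
    using H h0 \<kappa> by (intro mult_left_mono jw mult_nonneg_nonneg zero_le_power) (auto simp: h_def)
  also have "\<dots> = jump_const DIM('a) \<kappa> C H * (e + h\<^sup>2 * S + O2)"
    by (simp only: jump_const_def A_def a_def D_def mult.assoc)
  finally show ?thesis by (simp only: e_def S_def h_def \<nu>_def U_def)
qed

end

context galerkin_residual
begin

text \<open>The element residual and the at most d + 1 sides are bounded by multiples of the same
  sum of squares X, and X is at most the square of the sum, which yields the unsquared form.
  \<theta> stands for the oscillation on the patch.\<close>

theorem efficiency:
  assumes dim: "DIM('a) \<ge> 2" and K: "K \<in> T"
    and inball: "\<And>L. L \<in> T \<Longrightarrow> \<exists>x r. r > 0 \<and> cball x r \<subseteq> L \<and> diameter L \<le> \<kappa> * r" and \<kappa>: "\<kappa> \<ge> 1"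
    and C: "\<And>(x0::'a) r x. r > 0 \<Longrightarrow> norm (bump_grad x0 r x) \<le> C / r"
    and P: "\<And>L. P L \<in> polys 1"
    and osc: "\<And>L. L \<in> patch T K \<Longrightarrow> (diameter L)\<^sup>2 * (L2_norm L (\<lambda>x. q x - P L x))\<^sup>2 \<le> \<theta>\<^sup>2" and \<theta>: "\<theta> \<ge> 0"
    and H: "diameter K \<le> H"
  shows "sqrt ((diameter K)\<^sup>2 * (L2_norm K (\<lambda>x. s\<^sub>T x + q x))\<^sup>2 + diameter K * (jump_norm T K y)\<^sup>2)
    \<le> sqrt (resid_const DIM('a) \<kappa> C + (real DIM('a) + 1) * jump_const DIM('a) \<kappa> C H)
      * (L2_norm (\<Union>(patch T K)) E + diameter K * L2_norm (\<Union>(patch T K)) (\<lambda>x. s x - s\<^sub>T x) + \<theta>)"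
proof -
  define h where "h = diameter K"
  define U where "U = \<Union>(patch T K)"
  define X where "X = (L2_norm U E)\<^sup>2 + h\<^sup>2 * (L2_norm U (\<lambda>x. s x - s\<^sub>T x))\<^sup>2 + \<theta>\<^sup>2"
  define D where "D = resid_const DIM('a) \<kappa> C"
  define J where "J = jump_const DIM('a) \<kappa> C H"
  have h: "h \<ge> 0" unfolding h_def using mesh_element(3)[OF T K] by (intro diameter_ge_0 compact_imp_bounded)
  have D: "D > 0" unfolding D_def using \<kappa> by (intro resid_const_pos) simp
  have J: "J \<ge> 0" unfolding J_def using \<kappa> h H by (intro jump_const_nonneg) (auto simp: h_def)
  have X: "X \<ge> 0" by (simp add: X_def)
  have pT: "patch T K \<subseteq> T" using K by (auto simp: patch_def)
  have KU: "K \<subseteq> \<Union>(patch T K)" by (auto simp: patch_def)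
  have sd: "(\<lambda>x. s x - s\<^sub>T x) \<in> L2 \<Omega>" by (rule L2_diff[OF data(1,2)])
  obtain x r where xr: "r > 0" "cball x r \<subseteq> K" "diameter K \<le> \<kappa> * r" using inball[OF K] by blast
  have "(L2_norm K E)\<^sup>2 + h\<^sup>2 * (L2_norm K (\<lambda>x. s x - s\<^sub>T x))\<^sup>2 + h\<^sup>2 * (L2_norm K (\<lambda>x. q x - P K x))\<^sup>2 \<le> X"
    unfolding X_def U_def h_def
    by (intro add_mono osc mult_left_mono L2_norm_element_le[OF _ pT element_measurable(1)[OF K] KU] data(4) sd)
       (auto simp: patch_def)
  then have "D * ((L2_norm K E)\<^sup>2 + h\<^sup>2 * (L2_norm K (\<lambda>x. s x - s\<^sub>T x))\<^sup>2 + h\<^sup>2 * (L2_norm K (\<lambda>x. q x - P K x))\<^sup>2) \<le> D * X"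
    using D by (intro mult_left_mono) auto
  moreover have "h\<^sup>2 * (L2_norm K (\<lambda>x. s\<^sub>T x + q x))\<^sup>2 \<le> D * ((L2_norm K E)\<^sup>2
      + h\<^sup>2 * (L2_norm K (\<lambda>x. s x - s\<^sub>T x))\<^sup>2 + h\<^sup>2 * (L2_norm K (\<lambda>x. q x - P K x))\<^sup>2)"
    unfolding D_def resid_const_def h_def by (rule element_residual_bound[OF K xr _ P[of K]]) (rule C)
  ultimately have 1: "h\<^sup>2 * (L2_norm K (\<lambda>x. s\<^sub>T x + q x))\<^sup>2 \<le> D * X"
    by (rule order_trans[rotated])
  have nn: "0 \<le> side_integral (outer_normal K \<gamma>) \<gamma> (\<lambda>_. (jump T y \<gamma>)\<^sup>2)" for \<gamma>
    unfolding side_integral_const by simp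
  have "h * (jump_norm T K y)\<^sup>2 = h * (\<Sum>\<gamma>\<in>sides_of T K. side_integral (outer_normal K \<gamma>) \<gamma> (\<lambda>_. (jump T y \<gamma>)\<^sup>2))"
    unfolding jump_norm_def using nn by (simp add: sum_nonneg)
  also have "\<dots> = (\<Sum>\<gamma>\<in>sides_of T K. h * side_integral (outer_normal K \<gamma>) \<gamma> (\<lambda>_. (jump T y \<gamma>)\<^sup>2))"
    by (rule sum_distrib_left)
  also have "\<dots> \<le> (\<Sum>\<gamma>\<in>sides_of T K. J * X)"
  proof (rule sum_mono)
    fix \<gamma> assume \<gamma>: "\<gamma> \<in> sides_of T K"
    show "h * side_integral (outer_normal K \<gamma>) \<gamma> (\<lambda>_. (jump T y \<gamma>)\<^sup>2) \<le> J * X"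
      unfolding J_def X_def U_def h_def
      by (rule side_jump_bound[where P = P, OF dim K \<gamma>])
         (erule inball | rule \<kappa> | erule C | rule P | erule osc | rule H)+
  qed
  also have "\<dots> = real (card (sides_of T K)) * (J * X)" by simp
  also have "\<dots> \<le> (real DIM('a) + 1) * (J * X)"
    using card_sides_of(2)[OF T K] J X by (intro mult_right_mono) auto
  finally have 2: "h * (jump_norm T K y)\<^sup>2 \<le> (real DIM('a) + 1) * J * X" by (simp add: mult.assoc)
  define Y where "Y = L2_norm U E + h * L2_norm U (\<lambda>x. s x - s\<^sub>T x) + \<theta>"
  have Y: "Y \<ge> 0" using h \<theta> by (simp add: Y_def)
  have sq3: "a\<^sup>2 + b\<^sup>2 + c\<^sup>2 \<le> (a + b + c)\<^sup>2" if "0 \<le> a" "0 \<le> b" "0 \<le> c" for a b c :: real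
    using that by (simp add: power2_eq_square algebra_simps)
  have "X \<le> Y\<^sup>2"
    unfolding X_def Y_def using sq3[of "L2_norm U E" "h * L2_norm U (\<lambda>x. s x - s\<^sub>T x)" \<theta>] h \<theta>
    by (simp add: power_mult_distrib)
  then have "(D + (real DIM('a) + 1) * J) * X \<le> (D + (real DIM('a) + 1) * J) * Y\<^sup>2"
    using D J by (intro mult_left_mono) auto
  then have "h\<^sup>2 * (L2_norm K (\<lambda>x. s\<^sub>T x + q x))\<^sup>2 + h * (jump_norm T K y)\<^sup>2 \<le> (D + (real DIM('a) + 1) * J) * Y\<^sup>2"
    using 1 2 by (simp only: distrib_right)
  then have "sqrt (h\<^sup>2 * (L2_norm K (\<lambda>x. s\<^sub>T x + q x))\<^sup>2 + h * (jump_norm T K y)\<^sup>2) \<le> sqrt ((D + (real DIM('a) + 1) * J) * Y\<^sup>2)"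
    by (rule real_sqrt_le_mono)
  also have "\<dots> = sqrt (D + (real DIM('a) + 1) * J) * Y" using Y by (simp add: real_sqrt_mult)
  finally show ?thesis by (simp only: h_def Y_def U_def D_def J_def)
qed

end

section \<open>Oscillation\<close>

lemma polys_eq_on_interior:
  assumes "interior K \<noteq> {}" "p \<in> polys l" "r \<in> polys l" "\<And>x. x \<in> interior K \<Longrightarrow> p x = r x"
  shows "p = r"
proof -
  obtain c g c' g' where e: "p = (\<lambda>x. c + g \<bullet> x)" "r = (\<lambda>x. c' + g' \<bullet> x)" using assms by (auto simp: polys_def)
  have "g = g'"
    by (rule affine_gradient_unique[of "interior K" c g c' g']) (use assms e in auto)
  moreover obtain x where "x \<in> interior K" using assms(1) by blast
  ultimately show ?thesis using assms(4)[of x] e by simp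
qed

text \<open>The part of the interior of K where p does not vanish is open and null, hence empty, and
  an affine function that vanishes on a nonempty open set is 0.\<close>

lemma polys_L2_zero:
  assumes K: "compact K" "interior K \<noteq> {}" and p: "p \<in> polys l" and 0: "L2_inner K p p = 0"
  shows "p = (\<lambda>x. 0)"
proof -
  obtain c g where e: "p = (\<lambda>x. c + g \<bullet> x)" using p by (auto simp: polys_def)
  have cont: "continuous_on S p" for S unfolding e by (intro continuous_intros)
  have Ks: "K \<in> sets lebesgue" using K(1) lmeasurable_compact by blast
  have L: "p \<in> L2 K" by (rule L2_continuous[OF K(1) cont])
  have "(LINT x|lebesgue_on K. (p x)\<^sup>2) = 0" using 0 by (simp add: L2_inner_def power2_eq_square)
  moreover have "integrable (lebesgue_on K) (\<lambda>x. (p x)\<^sup>2)" using L2_square_integrable[OF L] by simp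
  ultimately have "AE x in lebesgue_on K. (p x)\<^sup>2 = 0" by (subst (asm) integral_nonneg_eq_0_iff_AE) auto
  then have ae: "AE x in lebesgue. x \<in> K \<longrightarrow> p x = 0" using Ks by (simp add: AE_restrict_space_iff)
  define Z where "Z = interior K \<inter> {x. p x \<noteq> 0}"
  have "open {x. p x \<noteq> 0}" by (rule open_Collect_neq[OF cont continuous_on_const])
  then have "open Z" unfolding Z_def by (intro open_Int open_interior)
  moreover have "negligible Z"
  proof -
    have "AE x in lebesgue. x \<notin> Z" using ae
    proof eventually_elim
      case (elim x)
      then show ?case using interior_subset[of K] by (auto simp: Z_def)
    qed
    moreover have "Z \<in> sets lebesgue" using \<open>open Z\<close> by auto
    ultimately show ?thesis by (simp add: negligible_iff_null_sets AE_iff_null_sets)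
  qed
  ultimately have "Z = {}" using open_not_negligible by blast
  then show ?thesis
    by (intro polys_eq_on_interior[OF K(2) p]) (auto simp: Z_def polys_def intro!: exI[of _ 0])
qed

text \<open>The inner product with an affine function involves h only through the moments
  \<integral> h and \<integral> h x, so orthogonality to all affine functions is a finite linear
  system.\<close>

lemma L2_inner_polys:
  fixes h :: "'a::euclidean_space \<Rightarrow> real"
  assumes K: "compact K" and h: "h \<in> L2 K"
  shows "integrable (lebesgue_on K) h" "integrable (lebesgue_on K) (\<lambda>x. h x *\<^sub>R x)"
    and "L2_inner K h (\<lambda>x. c + g \<bullet> x) = c * (LINT x|lebesgue_on K. h x) + g \<bullet> (LINT x|lebesgue_on K. h x *\<^sub>R x)"
proof -
  show 1: "integrable (lebesgue_on K) h"
    using L2_integrable_inner[OF h L2_continuous[OF K, of "\<lambda>_. 1::real"]] by simp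
  have c: "continuous_on K (\<lambda>x. x \<bullet> i)" for i :: 'a by (intro continuous_intros)
  have "integrable (lebesgue_on K) (\<lambda>x. h x * (x \<bullet> i))" for i
    using L2_integrable_inner[OF h L2_continuous[OF K c[of i]]] by simp
  then have "integrable (lebesgue_on K) (\<lambda>x. \<Sum>i\<in>Basis. (h x * (x \<bullet> i)) *\<^sub>R i)"
    by (intro Bochner_Integration.integrable_sum integrable_scaleR_left)
  moreover have "(\<Sum>i\<in>Basis. (h x * (x \<bullet> i)) *\<^sub>R i) = h x *\<^sub>R x" for x
    by (subst (3) euclidean_representation[of x, symmetric]) (simp add: scaleR_sum_right)
  ultimately show 2: "integrable (lebesgue_on K) (\<lambda>x. h x *\<^sub>R x)" by simp
  have "L2_inner K h (\<lambda>x. c + g \<bullet> x) = (LINT x|lebesgue_on K. c * h x + g \<bullet> (h x *\<^sub>R x))"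
    unfolding L2_inner_def by (intro Bochner_Integration.integral_cong refl) (simp add: algebra_simps)
  also have "\<dots> = c * (LINT x|lebesgue_on K. h x) + g \<bullet> (LINT x|lebesgue_on K. h x *\<^sub>R x)"
    using 1 2 by (simp del: inner_scaleR_right)
  finally show "L2_inner K h (\<lambda>x. c + g \<bullet> x) = c * (LINT x|lebesgue_on K. h x) + g \<bullet> (LINT x|lebesgue_on K. h x *\<^sub>R x)" .
qed

text \<open>The Gram map of the basis \<open>1, x\<^sub>1, \<dots>, x\<^sub>d\<close> is injective, hence surjective.\<close>

lemma L2_proj_exists:
  fixes h :: "'a::euclidean_space \<Rightarrow> real"
  assumes K: "compact K" "interior K \<noteq> {}" and h: "h \<in> L2 K" and l: "l \<in> {0, 1}"
  shows "\<exists>p\<in>polys l. \<forall>r\<in>polys l. L2_inner K (\<lambda>x. h x - p x) r = 0"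
proof -
  have pc: "(\<lambda>x. c + g \<bullet> x) \<in> L2 K" for c and g :: 'a by (intro L2_continuous[OF K(1)] continuous_intros)
  define F where "F f = (LINT x|lebesgue_on K. f x)" for f :: "'a \<Rightarrow> real"
  define G where "G f = (LINT x|lebesgue_on K. f x *\<^sub>R x)" for f :: "'a \<Rightarrow> real"
  note ip = L2_inner_polys[OF K(1), folded F_def G_def]
  show ?thesis
  proof (cases "l = 0")
    case True
    \<comment> \<open>For degree 0 the projection is the mean value, with the measure of K written
      as F 1.\<close>
    have "F (\<lambda>_. 1) \<noteq> 0"
    proof
      assume "F (\<lambda>_. 1) = 0"
      then have "L2_inner K (\<lambda>_. 1) (\<lambda>_. 1) = 0" by (simp add: L2_inner_def F_def)
      moreover have "(\<lambda>_. 1) \<in> polys 0" by (auto simp: polys_def)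
      ultimately have "(\<lambda>_::'a. 1::real) = (\<lambda>x. 0)" using polys_L2_zero[OF K] by blast
      then show False by (metis zero_neq_one)
    qed
    moreover define c where "c = F h / F (\<lambda>_. 1)"
    ultimately have c: "c * F (\<lambda>_. 1) = F h" by simp
    have i: "integrable (lebesgue_on K) h" "integrable (lebesgue_on K) (\<lambda>_. c)"
      using ip(1)[OF h] ip(1)[OF pc[of c 0]] by auto
    have "F (\<lambda>x. h x - c) = F h - F (\<lambda>_. c)" unfolding F_def using i by simp
    also have "F (\<lambda>_. c) = c * F (\<lambda>_. 1)"
      unfolding F_def by (subst Bochner_Integration.integral_mult_right_zero[symmetric]) simp
    finally have "F (\<lambda>x. h x - c) = 0" using c by simp
    then have "L2_inner K (\<lambda>x. h x - c) (\<lambda>x. b) = 0" for b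
      by (simp add: L2_inner_def F_def)
    moreover have "(\<lambda>x. c) \<in> polys l" "\<And>r. r \<in> polys l \<Longrightarrow> \<exists>b. r = (\<lambda>x. b)"
      using True by (auto simp: polys_def)
    ultimately show ?thesis by (intro bexI[of _ "\<lambda>x. c"]) auto
  next
    case False
    then have l1: "l = 1" using l by simp
    define Q where "Q cg x = fst cg + snd cg \<bullet> x" for cg :: "real \<times> 'a" and x
    define A where "A cg = (F (Q cg), G (Q cg))" for cg
    have Q: "Q cg \<in> L2 K" for cg unfolding Q_def[abs_def] by (rule pc)
    have Qp: "Q cg \<in> polys 1" for cg unfolding Q_def[abs_def] polys_def by auto
    have "linear A"
    proof (rule linearI)
      fix u v :: "real \<times> 'a" and a :: real
      have "Q (u + v) = (\<lambda>x. Q u x + Q v x)" "Q (a *\<^sub>R u) = (\<lambda>x. a * Q u x)"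
        by (auto simp: Q_def inner_add_left algebra_simps)
      then show "A (u + v) = A u + A v" "A (a *\<^sub>R u) = a *\<^sub>R A u"
        using ip(1)[OF Q[of u]] ip(2)[OF Q[of u]] ip(1)[OF Q[of v]] ip(2)[OF Q[of v]]
        by (auto simp: A_def F_def G_def scaleR_add_left simp flip: scaleR_scaleR)
    qed
    moreover have "inj A"
    proof (rule linear_injective_0[OF \<open>linear A\<close>, THEN iffD2], intro allI impI)
      fix u assume "A u = 0"
      then have "F (Q u) = 0" "G (Q u) = 0" by (auto simp: A_def zero_prod_def)
      \<comment> \<open>Vanishing moments make \<open>Q u\<close> orthogonal to every affine
        function, in particular to itself.\<close>
      then have "L2_inner K (Q u) (Q u) = 0" using ip(3)[OF Q[of u], of "fst u" "snd u"] by (simp add: Q_def[abs_def])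
      then have "Q u = (\<lambda>x. 0)" using polys_L2_zero[OF K Qp] by blast
      then have Q0: "fst u + snd u \<bullet> x = 0" for x by (simp add: Q_def[abs_def] fun_eq_iff)
      then have "fst u = 0" using Q0[of 0] by simp
      moreover from this have "snd u = 0" using Q0[of "snd u"] by simp
      ultimately show "u = 0" by (simp add: prod_eq_iff)
    qed
    ultimately have "surj A" by (rule linear_injective_imp_surjective) (rule refl)
    then obtain u where u: "A u = (F h, G h)" by (metis surjD)
    define d where "d x = h x - Q u x" for x
    have d: "d \<in> L2 K" unfolding d_def[abs_def] by (rule L2_diff[OF h Q])
    have "F d = F h - F (Q u)" "G d = G h - G (Q u)"
      unfolding d_def[abs_def] F_def G_def scaleR_diff_left
      using ip(1)[OF h] ip(1)[OF Q[of u]] ip(2)[OF h] ip(2)[OF Q[of u]] by auto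
    then have "F d = 0" "G d = 0" using u by (auto simp: A_def)
    then have "L2_inner K d (\<lambda>x. c + g \<bullet> x) = 0" for c g using ip(3)[OF d] by simp
    then show ?thesis
      unfolding l1 using Qp[of u] by (intro bexI[of _ "Q u"]) (auto simp: polys_def d_def[abs_def])
  qed
qed

text \<open>Resolves the definite description in \<open>L2_proj\<close>: the difference of two
  candidates is orthogonal to itself. The projections can then serve as the polynomials P in the
  residual estimates.\<close>

lemma L2_proj_polys:
  fixes h :: "'a::euclidean_space \<Rightarrow> real"
  assumes K: "compact K" "interior K \<noteq> {}" and h: "h \<in> L2 K" and l: "l \<in> {0, 1}"
  shows "L2_proj l K h \<in> polys l"
proof -
  obtain p where p: "p \<in> polys l" "\<forall>r\<in>polys l. L2_inner K (\<lambda>x. h x - p x) r = 0"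
    using L2_proj_exists[OF assms] by blast
  have "L2_proj l K h = p"
    unfolding L2_proj_def
  proof (rule the_equality)
    show "p \<in> polys l \<and> (\<forall>r\<in>polys l. L2_inner K (\<lambda>x. h x - p x) r = 0)" using p by blast
    fix p' assume p': "p' \<in> polys l \<and> (\<forall>r\<in>polys l. L2_inner K (\<lambda>x. h x - p' x) r = 0)"
    have L: "r \<in> L2 K" "\<exists>c g. r = (\<lambda>x. c + g \<bullet> x)" if rl: "r \<in> polys l" for r
    proof -
      obtain c g where r: "r = (\<lambda>x. c + g \<bullet> x)" using rl by (auto simp: polys_def)
      then show "\<exists>c g. r = (\<lambda>x. c + g \<bullet> x)" by blast
      show "r \<in> L2 K" unfolding r by (intro L2_continuous[OF K(1)] continuous_intros)
    qed
    define d where "d x = p' x - p x" for x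
    have d: "d \<in> polys l"
    proof -
      obtain c g c' g' where "l = 0 \<longrightarrow> g = 0" "l = 0 \<longrightarrow> g' = 0" "p = (\<lambda>x. c + g \<bullet> x)" "p' = (\<lambda>x. c' + g' \<bullet> x)"
        using p(1) p' by (auto simp: polys_def)
      then show ?thesis
        unfolding polys_def d_def[abs_def]
        by (auto intro!: exI[of _ "c' - c"] exI[of _ "g' - g"] simp: inner_diff_left)
    qed
    have "L2_inner K d d = L2_inner K (\<lambda>x. h x - p x) d - L2_inner K (\<lambda>x. h x - p' x) d"
      unfolding L2_inner_def
      using L2_integrable_inner[OF L2_diff[OF h L(1)[OF p(1)]] L(1)[OF d]]
        L2_integrable_inner[OF L2_diff[OF h L(1)[of p']] L(1)[OF d]] p'
      by (subst Bochner_Integration.integral_diff[symmetric])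
         (auto intro!: Bochner_Integration.integral_cong simp: d_def algebra_simps)
    then have "L2_inner K d d = 0" using p p' d by simp
    then have "d = (\<lambda>x. 0)" by (rule polys_L2_zero[OF K d])
    then show "p' = p" by (auto simp: d_def fun_eq_iff)
  qed
  then show ?thesis using p(1) by simp
qed

lemma polys_mono: "p \<in> polys l \<Longrightarrow> p \<in> polys 1"
  by (auto simp: polys_def)

lemma osc_element_le:
  assumes "finite M" "L \<in> M"
  shows "(diameter L)\<^sup>2 * (L2_norm L (\<lambda>x. g x - L2_proj l L g x))\<^sup>2 \<le> (osc l 0 g M)\<^sup>2" "0 \<le> osc l 0 g M"
proof -
  let ?f = "\<lambda>K. (diameter K)\<^sup>2 * (L2_norm K (\<lambda>x. g x - L2_proj l K g x))\<^sup>2"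
  have o: "osc l 0 g M = sqrt (\<Sum>K\<in>M. ?f K)" by (simp add: osc_def)
  have "0 \<le> (\<Sum>K\<in>M. ?f K)" by (intro sum_nonneg) auto
  then show "0 \<le> osc l 0 g M" "?f L \<le> (osc l 0 g M)\<^sup>2"
    unfolding o using member_le_sum[OF assms(2) _ assms(1), of ?f] by auto
qed

section \<open>Application to the state and the adjoint\<close>

theorem lemma5p6:
  fixes \<Omega> :: "'a::euclidean_space set"
    and T0 :: "'a set set"
    and \<TT> :: "'a set set set"
    and l :: nat
  assumes "DIM('a) \<in> {2, 3}"
    and "lipschitz_polytopal_domain \<Omega>"
    and "mesh_family \<Omega> T0 \<TT>"
    and "l \<in> {0, 1}"
  shows "\<exists>C>0. \<forall>f\<in>L2 \<Omega>. \<forall>y\<^sub>\<Omega>\<in>L2 \<Omega>. \<forall>\<alpha>>0. \<forall>\<beta>>0. \<forall>a<0. \<forall>b>0.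
    \<forall>y p u lam. continuous_system \<Omega> f y\<^sub>\<Omega> \<alpha> \<beta> a b y p u lam \<longrightarrow>
    (\<forall>T\<in>\<TT>. \<forall>y\<^sub>T p\<^sub>T u\<^sub>T lam\<^sub>T.
      discrete_system \<Omega> T f y\<^sub>\<Omega> \<alpha> \<beta> a b y\<^sub>T p\<^sub>T u\<^sub>T lam\<^sub>T \<longrightarrow>
      (\<forall>K\<in>T.
        indicator_y T f u\<^sub>T y\<^sub>T K
          \<le> C * (H1_seminorm \<Omega> (\<Union>(patch T K)) (\<lambda>x. y x - y\<^sub>T x)
               + diameter K * L2_norm (\<Union>(patch T K)) (\<lambda>x. u x - u\<^sub>T x)
               + osc l 0 f (patch T K)) \<and>
        indicator_p T y\<^sub>\<Omega> y\<^sub>T p\<^sub>T K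
          \<le> C * (H1_seminorm \<Omega> (\<Union>(patch T K)) (\<lambda>x. p x - p\<^sub>T x)
               + diameter K * L2_norm (\<Union>(patch T K)) (\<lambda>x. y x - y\<^sub>T x)
               + osc l 0 y\<^sub>\<Omega> (patch T K))))"
proof -
  have dim: "DIM('a) \<ge> 2" using assms(1) by auto
  have \<Omega>: "open \<Omega>" "bounded \<Omega>" "\<Omega> \<in> lmeasurable"
    using assms(2) by (auto simp: lipschitz_polytopal_domain_def intro: lmeasurable_open)
  have mesh: "simplicial_mesh \<Omega> T" if "T \<in> \<TT>" for T using assms(3) that by (simp add: mesh_family_def)
  obtain \<sigma> where \<sigma>: "\<sigma> > 0" "\<And>T K. T \<in> \<TT> \<Longrightarrow> K \<in> T \<Longrightarrow> diameter K \<le> \<sigma> * inball_diameter K"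
    using assms(3) unfolding mesh_family_def shape_regular_def by blast
  \<comment> \<open>4\<sigma> is the ratio from \<open>shape_regular_inball\<close>; the maximum
    provides \<kappa> \<ge> 1 for the residual bounds.\<close>
  define \<kappa> where "\<kappa> = max 1 (4 * \<sigma>)"
  have \<kappa>: "\<kappa> \<ge> 1" by (simp add: \<kappa>_def)
  have inball: "\<exists>x r. r > 0 \<and> cball x r \<subseteq> L \<and> diameter L \<le> \<kappa> * r" if T: "T \<in> \<TT>" and L: "L \<in> T" for T L
  proof -
    obtain x r where r: "r > 0" "cball x r \<subseteq> L" "diameter L \<le> 4 * \<sigma> * r"
      by (rule shape_regular_inball[OF mesh_element(3,6)[OF mesh[OF T] L] \<sigma>(1) \<sigma>(2)[OF T L]]) (rule that)
    have "4 * \<sigma> * r \<le> \<kappa> * r" using r(1) by (intro mult_right_mono) (auto simp: \<kappa>_def)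
    then have "diameter L \<le> \<kappa> * r" using r(3) by (rule order_trans[rotated])
    then show ?thesis using r by blast
  qed
  obtain C where C: "C > 0" "\<And>(x0::'a) r x. r > 0 \<Longrightarrow> norm (bump_grad x0 r x) \<le> C / r"
    using bump_grad_bound by blast
  \<comment> \<open>A common bound for the elements of all meshes, which keeps the constant c
    independent of the mesh.\<close>
  define H where "H = diameter (closure \<Omega>)"
  have H0: "H \<ge> 0" unfolding H_def using \<Omega>(2) by (intro diameter_ge_0) (simp add: bounded_closure)
  have H: "diameter K \<le> H" if "T \<in> \<TT>" "K \<in> T" for T K
    unfolding H_def using mesh_element(7)[OF mesh[OF that(1)] that(2)] \<Omega>(2)
    by (intro diameter_subset) (auto simp: bounded_closure)
  define c where "c = sqrt (resid_const DIM('a) \<kappa> C + (real DIM('a) + 1) * jump_const DIM('a) \<kappa> C H)"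
  have c: "c > 0"
    unfolding c_def using resid_const_pos[of \<kappa> "DIM('a)" C] jump_const_nonneg[of \<kappa> H "DIM('a)" C] \<kappa> H0
    by (intro real_sqrt_gt_zero add_pos_nonneg mult_nonneg_nonneg) auto
  \<comment> \<open>One estimate for both indicators: z is the exact solution,
    \<open>y\<^sub>T\<close> its finite element approximation, and \<theta> bounds the oscillation
    of q measured with the polynomials P.\<close>
  have main: "sqrt ((diameter K)\<^sup>2 * (L2_norm K (\<lambda>x. s\<^sub>T x + q x))\<^sup>2 + diameter K * (jump_norm T K y\<^sub>T)\<^sup>2)
      \<le> c * (H1_seminorm \<Omega> (\<Union>(patch T K)) (\<lambda>x. z x - y\<^sub>T x)
          + diameter K * L2_norm (\<Union>(patch T K)) (\<lambda>x. s x - s\<^sub>T x) + \<theta>)"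
    if TT: "T \<in> \<TT>" and K: "K \<in> T" and z: "z \<in> H1_0 \<Omega>" and y: "y\<^sub>T \<in> fe_space \<Omega> T"
      and L2: "s \<in> L2 \<Omega>" "s\<^sub>T \<in> L2 \<Omega>" "q \<in> L2 \<Omega>"
      and aff: "\<And>K. K \<in> T \<Longrightarrow> \<exists>p\<in>polys 1. AE x in lebesgue_on K. s\<^sub>T x = p x"
      and eq: "\<And>v. v \<in> H1_0 \<Omega> \<Longrightarrow> L2_inner \<Omega> (wgrad \<Omega> z) (wgrad \<Omega> v) = L2_inner \<Omega> (\<lambda>x. s x + q x) v"
      and P: "\<And>L. L \<in> T \<Longrightarrow> P L \<in> polys 1" and \<theta>: "\<theta> \<ge> 0"
      and osc: "\<And>L. L \<in> patch T K \<Longrightarrow> (diameter L)\<^sup>2 * (L2_norm L (\<lambda>x. q x - P L x))\<^sup>2 \<le> \<theta>\<^sup>2"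
    for T K z y\<^sub>T s s\<^sub>T q P \<theta>
  proof -
    note m = mesh[OF TT]
    note w = fe_space_weak_gradient[OF m y \<Omega>(1,2)]
    note g = galerkin_error_bump[OF \<Omega>(1,3) z L2_add[OF L2(1,3)] eq w(1) pw_grad_L2[OF m \<Omega>(3)] w(2)]
    interpret galerkin_residual \<Omega> T y\<^sub>T s s\<^sub>T q "wgrad \<Omega> (\<lambda>x. z x - y\<^sub>T x)"
      by unfold_locales (use assms(2) m y L2 g aff in auto)
    \<comment> \<open>\<open>efficiency\<close> asks for a polynomial for every set L; off the mesh
      0 serves as a default.\<close>
    define P' where "P' L = (if L \<in> T then P L else (\<lambda>x. 0))" for L
    have P': "P' L \<in> polys 1" for L using P by (auto simp: P'_def polys_def intro!: exI[of _ 0])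
    have "patch T K \<subseteq> T" using K by (auto simp: patch_def)
    then have osc': "(diameter L)\<^sup>2 * (L2_norm L (\<lambda>x. q x - P' L x))\<^sup>2 \<le> \<theta>\<^sup>2" if "L \<in> patch T K" for L
      using osc[OF that] that by (auto simp: P'_def)
    show ?thesis
      unfolding c_def H1_seminorm_def
      by (rule efficiency[where P = P', OF dim K])
         (erule inball[OF TT] | rule \<kappa> | erule C(2) | rule P' | erule osc' | rule \<theta> | rule H[OF TT K])+
  qed
  show ?thesis
  proof (intro exI[of _ c] conjI c ballI allI impI)
    fix f y\<^sub>\<Omega> \<alpha> \<beta> a b y p u lam T y\<^sub>T p\<^sub>T u\<^sub>T lam\<^sub>T K
    assume f: "f \<in> L2 \<Omega>" and y\<Omega>: "y\<^sub>\<Omega> \<in> L2 \<Omega>" and T: "T \<in> \<TT>" and K: "K \<in> T"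
      and cs: "continuous_system \<Omega> f y\<^sub>\<Omega> \<alpha> \<beta> a b y p u lam"
      and ds: "discrete_system \<Omega> T f y\<^sub>\<Omega> \<alpha> \<beta> a b y\<^sub>T p\<^sub>T u\<^sub>T lam\<^sub>T"
    note m = mesh[OF T]
    have fin: "finite (patch T K)"
      using mesh_finite[OF m] K by (auto simp: patch_def intro: finite_subset[of _ "insert K T"])
    have C: "y \<in> H1_0 \<Omega>" "p \<in> H1_0 \<Omega>" "u \<in> L2 \<Omega>"
      "\<And>v. v \<in> H1_0 \<Omega> \<Longrightarrow> L2_inner \<Omega> (wgrad \<Omega> y) (wgrad \<Omega> v) = L2_inner \<Omega> (\<lambda>x. u x + f x) v"
      "\<And>w. w \<in> H1_0 \<Omega> \<Longrightarrow> L2_inner \<Omega> (wgrad \<Omega> w) (wgrad \<Omega> p) = L2_inner \<Omega> (\<lambda>x. y x - y\<^sub>\<Omega> x) w"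
      using cs by (auto simp: continuous_system_def optimality_system_def)
    have D: "y\<^sub>T \<in> fe_space \<Omega> T" "p\<^sub>T \<in> fe_space \<Omega> T" "u\<^sub>T \<in> pw_const \<Omega> T"
      using ds by (auto simp: discrete_system_def optimality_system_def)
    have yL: "y \<in> L2 \<Omega>" using C(1) by (simp add: H1_0_def H1_def)
    have yTL: "y\<^sub>T \<in> L2 \<Omega>" by (rule fe_space_weak_gradient(1)[OF m D(1) \<Omega>(1,2)])
    \<comment> \<open>In the adjoint equation the test function stands in the first
      argument.\<close>
    have comm: "L2_inner S g h = L2_inner S h g" for S :: "'a set" and g h :: "'a \<Rightarrow> 'a"
      by (simp add: L2_inner_def inner_commute)
    have proj: "L2_proj l L g \<in> polys 1" if "L \<in> T" "g \<in> L2 \<Omega>" for L g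
    proof -
      have "L \<in> sets lebesgue" using mesh_element(3)[OF m that(1)] lmeasurable_compact by blast
      then have "g \<in> L2 L"
        using L2_mono(1)[OF that(2) _ _ mesh_measure(1)[OF assms(2) m]] mesh_element(7)[OF m that(1)]
          mesh_measure(2)[OF assms(2) m] \<Omega>(3) by (auto simp: fmeasurableD)
      then show ?thesis
        using L2_proj_polys[OF mesh_element(3,6)[OF m that(1)] _ assms(4)] polys_mono by blast
    qed
    show "indicator_y T f u\<^sub>T y\<^sub>T K
        \<le> c * (H1_seminorm \<Omega> (\<Union>(patch T K)) (\<lambda>x. y x - y\<^sub>T x)
             + diameter K * L2_norm (\<Union>(patch T K)) (\<lambda>x. u x - u\<^sub>T x) + osc l 0 f (patch T K))"
      unfolding indicator_y_def
    proof (rule main[OF T K C(1) D(1) C(3) _ f _ C(4)])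
      show "u\<^sub>T \<in> L2 \<Omega>" using D(3) by (simp add: pw_const_def)
      show "\<exists>p\<in>polys 1. AE x in lebesgue_on K. u\<^sub>T x = p x" if "K \<in> T" for K
        using D(3) that polys_mono by (fastforce simp: pw_const_def)
      show "L2_proj l L f \<in> polys 1" if "L \<in> T" for L by (rule proj[OF that f])
      show "(diameter L)\<^sup>2 * (L2_norm L (\<lambda>x. f x - L2_proj l L f x))\<^sup>2 \<le> (osc l 0 f (patch T K))\<^sup>2"
        if "L \<in> patch T K" for L by (rule osc_element_le(1)[OF fin that])
      show "0 \<le> osc l 0 f (patch T K)" by (rule osc_element_le(2)[OF fin, of K]) (simp add: patch_def)
    qed
    \<comment> \<open>Here q is \<open>- y\<^sub>\<Omega>\<close>, so the projections are negated as
      well; the norms in the oscillation stay the same.\<close>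
    have "sqrt ((diameter K)\<^sup>2 * (L2_norm K (\<lambda>x. y\<^sub>T x + - y\<^sub>\<Omega> x))\<^sup>2 + diameter K * (jump_norm T K p\<^sub>T)\<^sup>2)
        \<le> c * (H1_seminorm \<Omega> (\<Union>(patch T K)) (\<lambda>x. p x - p\<^sub>T x)
             + diameter K * L2_norm (\<Union>(patch T K)) (\<lambda>x. y x - y\<^sub>T x) + osc l 0 y\<^sub>\<Omega> (patch T K))"
    proof (rule main[OF T K C(2) D(2) yL yTL L2_minus[OF y\<Omega>], where P = "\<lambda>L x. - L2_proj l L y\<^sub>\<Omega> x"])
      show "\<exists>p\<in>polys 1. AE x in lebesgue_on L. y\<^sub>T x = p x" if L: "L \<in> T" for L
      proof -
        obtain p where "p \<in> polys 1" "\<forall>x\<in>L. y\<^sub>T x = p x" using D(1) L by (auto simp: fe_space_def)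
        then show ?thesis by (intro bexI[of _ p] AE_I2) auto
      qed
      show "L2_inner \<Omega> (wgrad \<Omega> p) (wgrad \<Omega> v) = L2_inner \<Omega> (\<lambda>x. y x + - y\<^sub>\<Omega> x) v" if "v \<in> H1_0 \<Omega>" for v
        using C(5)[OF that] comm by simp
      show "(\<lambda>x. - L2_proj l L y\<^sub>\<Omega> x) \<in> polys 1" if L: "L \<in> T" for L
      proof -
        obtain c g where "L2_proj l L y\<^sub>\<Omega> = (\<lambda>x. c + g \<bullet> x)" using proj[OF L y\<Omega>] by (auto simp: polys_def)
        then show ?thesis by (auto simp: polys_def intro!: exI[of _ "- c"] exI[of _ "- g"])
      qed
      show "(diameter L)\<^sup>2 * (L2_norm L (\<lambda>x. - y\<^sub>\<Omega> x - - L2_proj l L y\<^sub>\<Omega> x))\<^sup>2 \<le> (osc l 0 y\<^sub>\<Omega> (patch T K))\<^sup>2"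
        if "L \<in> patch T K" for L
      proof -
        have "L2_norm L (\<lambda>x. - y\<^sub>\<Omega> x - - L2_proj l L y\<^sub>\<Omega> x) = L2_norm L (\<lambda>x. y\<^sub>\<Omega> x - L2_proj l L y\<^sub>\<Omega> x)"
          unfolding L2_norm_def by (simp add: power2_commute)
        then show ?thesis using osc_element_le(1)[OF fin that, of y\<^sub>\<Omega> l] by simp
      qed
      show "0 \<le> osc l 0 y\<^sub>\<Omega> (patch T K)" by (rule osc_element_le(2)[OF fin, of K]) (simp add: patch_def)
    qed
    then show "indicator_p T y\<^sub>\<Omega> y\<^sub>T p\<^sub>T K
        \<le> c * (H1_seminorm \<Omega> (\<Union>(patch T K)) (\<lambda>x. p x - p\<^sub>T x)
             + diameter K * L2_norm (\<Union>(patch T K)) (\<lambda>x. y x - y\<^sub>T x) + osc l 0 y\<^sub>\<Omega> (patch T K))"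
      unfolding indicator_p_def by simp
  qed
qed

end
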